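(* Let $V$ be the solution of the convertible bond problem (P) described in the context, under the standing assumptions stated there. Then $V$ is uniformly $C^{1,1}_x\cap C^{0,1}_t$ in $\overline{D_T}\setminus\{x=0\}$. That is, $V$ is differentiable in $x$, and there is a constant $C$, depending only on the data $K,\gamma,T,\sigma,r,q,c$, such that $|V|\le C$, $|V_x|\le C$, $|V_x(x,t)-V_x(y,t)|\le C|x-y|$ and $|V(x,t)-V(x,s)|\le C|t-s|$ for all $(x,t),(y,t),(x,s)\in\overline{D_T}\setminus\{x=0\}$.
   Context: Constants: $K>0$ (call price and face value), $\gamma>0$ (conversion factor), $T>0$ (maturity), $\sigma>0$ (volatility), $r>0$ (interest rate), $q>0$ (dividend rate), $c\ge 0$ (coupon rate). Put $D_T=(0,K/\gamma)\times(0,T)$ and $$\mathcal{L}=-\partial_t-\tfrac12\sigma^2x^2\partial_{xx}-(r-q)x\,\partial_x+r.$$ Problem (P): find $V$ with $\gamma x\le V\le K$ in $D_T$ such that $$\mathcal{L}V=c\ \text{ in } D_T\cap\{\gamma x<V<K\},\qquad \mathcal{L}V\ge c\ \text{ in } D_T,$$ $$V(K/\gamma,t)=K\ \ (0\le t\le T),\qquad V(x,T)=K\ \ (0\le x\le K/\gamma).$$ A solution $V$ belongs to $W^{2,p}_{x,\mathrm{loc}}\cap W^{1,p}_{t,\mathrm{loc}}(D_T)$ for $1<p<\infty$ (i.e. $V,V_x,V_{xx},V_t\in L^p_{\mathrm{loc}}(D_T)$), the (in)equalities hold almost everywhere, and the boundary values are attained continuously. In particular there is a smooth fit along the free boundary.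 No boundary value is prescribed on $\{x=0\}$. Standing assumptions: $c<rK$ and $c<qK$. Only solutions with $\lim_{x\to0}x^2V_{xx}(x,t)=\lim_{x\to0}xV_x(x,t)=0$ are considered (in this class the solution is unique). The conversion (exercise) region $\Lambda=\{(x,t)\in D_T: V(x,t)=\gamma x\}$ is nonempty. *)

theory Defs
  imports "HOL-Analysis.Analysis"
begin

text \<open>Points of the plane are pairs \<open>(x, t)\<close> with \<open>x\<close> the share price and \<open>t\<close> the time.\<close>

section \<open>Weak derivatives and local parabolic Sobolev spaces\<close>

text \<open>\<open>P i j\<close> is the mixed partial derivative of order \<open>i\<close> in \<open>x\<close> and \<open>j\<close> in \<open>t\<close>.\<close>

definition smooth_plane :: "(real \<times> real \<Rightarrow> real) \<Rightarrow> bool" where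
  "smooth_plane \<phi> \<longleftrightarrow>
     (\<exists>P :: nat \<Rightarrow> nat \<Rightarrow> real \<times> real \<Rightarrow> real.
        P 0 0 = \<phi> \<and>
        (\<forall>i j. continuous_on UNIV (P i j) \<and>
           (\<forall>x t. ((\<lambda>y. P i j (y, t)) has_real_derivative P (Suc i) j (x, t)) (at x) \<and>
                  ((\<lambda>s. P i j (x, s)) has_real_derivative P i (Suc j) (x, t)) (at t))))"

definition test_functions :: "(real \<times> real) set \<Rightarrow> (real \<times> real \<Rightarrow> real) set" where
  "test_functions D =
     {\<phi>. smooth_plane \<phi> \<and> compact (closure {z. \<phi> z \<noteq> 0}) \<and> closure {z. \<phi> z \<noteq> 0} \<subseteq> D}"

definition Lp_loc :: "real \<Rightarrow> (real \<times> real) set \<Rightarrow> (real \<times> real \<Rightarrow> real) \<Rightarrow> bool" where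
  "Lp_loc p D f \<longleftrightarrow>
     f \<in> borel_measurable (lebesgue_on D) \<and>
     (\<forall>S. compact S \<and> S \<subseteq> D \<longrightarrow> set_integrable lebesgue S (\<lambda>z. \<bar>f z\<bar> powr p))"

text \<open>\<open>weak_dx D f g\<close>: the function \<open>g\<close> is (a representative of) the weak derivative of \<open>f\<close>
  in \<open>x\<close> on \<open>D\<close>. It is only meaningful for locally integrable \<open>f\<close> and \<open>g\<close>, and is only used
  together with \<open>Lp_loc\<close>.\<close>

definition weak_dx ::
  "(real \<times> real) set \<Rightarrow> (real \<times> real \<Rightarrow> real) \<Rightarrow> (real \<times> real \<Rightarrow> real) \<Rightarrow> bool" where
  "weak_dx D f g \<longleftrightarrow>
     (\<forall>\<phi>\<in>test_functions D.
        (LINT z:D|lebesgue. f z * deriv (\<lambda>y. \<phi> (y, snd z)) (fst z)) =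
        - (LINT z:D|lebesgue. g z * \<phi> z))"

definition weak_dt ::
  "(real \<times> real) set \<Rightarrow> (real \<times> real \<Rightarrow> real) \<Rightarrow> (real \<times> real \<Rightarrow> real) \<Rightarrow> bool" where
  "weak_dt D f g \<longleftrightarrow>
     (\<forall>\<phi>\<in>test_functions D.
        (LINT z:D|lebesgue. f z * deriv (\<lambda>s. \<phi> (fst z, s)) (snd z)) =
        - (LINT z:D|lebesgue. g z * \<phi> z))"

definition W21p_loc ::
  "real \<Rightarrow> (real \<times> real) set \<Rightarrow> (real \<times> real \<Rightarrow> real) \<Rightarrow>
   (real \<times> real \<Rightarrow> real) \<Rightarrow> (real \<times> real \<Rightarrow> real) \<Rightarrow> (real \<times> real \<Rightarrow> real) \<Rightarrow> bool" where
  "W21p_loc p D V Vx Vxx Vt \<longleftrightarrow>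
     Lp_loc p D V \<and> Lp_loc p D Vx \<and> Lp_loc p D Vxx \<and> Lp_loc p D Vt \<and>
     weak_dx D V Vx \<and> weak_dx D Vx Vxx \<and> weak_dt D V Vt"

section \<open>The convertible bond problem\<close>

definition cb_domain :: "real \<Rightarrow> real \<Rightarrow> real \<Rightarrow> (real \<times> real) set" where
  "cb_domain K \<gamma> T = {0<..<K / \<gamma>} \<times> {0<..<T}"

text \<open>The part of the boundary that carries data; \<open>{0} \<times> {0..<T}\<close> and the initial
  segment \<open>t = 0\<close>, \<open>x < K / \<gamma>\<close> carry none.\<close>

definition cb_boundary :: "real \<Rightarrow> real \<Rightarrow> real \<Rightarrow> (real \<times> real) set" where
  "cb_boundary K \<gamma> T = {K / \<gamma>} \<times> {0..T} \<union> {0..K / \<gamma>} \<times> {T}"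

definition cb_op ::
  "real \<Rightarrow> real \<Rightarrow> real \<Rightarrow> (real \<times> real \<Rightarrow> real) \<Rightarrow>
   (real \<times> real \<Rightarrow> real) \<Rightarrow> (real \<times> real \<Rightarrow> real) \<Rightarrow> (real \<times> real \<Rightarrow> real) \<Rightarrow>
   real \<times> real \<Rightarrow> real" where
  "cb_op \<sigma> r q V Vx Vxx Vt z =
     - Vt z - 1/2 * \<sigma>\<^sup>2 * (fst z)\<^sup>2 * Vxx z - (r - q) * fst z * Vx z + r * V z"

text \<open>Continuity of \<open>V\<close> on the domain selects the continuous representative of the Sobolev
  function; continuity up to \<open>cb_boundary\<close> says that the boundary values are attained
  continuously. Nothing is said about the values of \<open>V\<close> at other points.\<close>

definition cb_solution ::
  "real \<Rightarrow> real \<Rightarrow> real \<Rightarrow> real \<Rightarrow> real \<Rightarrow> real \<Rightarrow> real \<Rightarrow> (real \<times> real \<Rightarrow> real) \<Rightarrow>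
   (real \<times> real \<Rightarrow> real) \<Rightarrow> (real \<times> real \<Rightarrow> real) \<Rightarrow> (real \<times> real \<Rightarrow> real) \<Rightarrow> bool" where
  "cb_solution K \<gamma> T \<sigma> r q c V Vx Vxx Vt \<longleftrightarrow>
     (let D = cb_domain K \<gamma> T; L = cb_op \<sigma> r q V Vx Vxx Vt in
        (\<forall>p>1. W21p_loc p D V Vx Vxx Vt) \<and>
        continuous_on (D \<union> cb_boundary K \<gamma> T) V \<and>
        (\<forall>z\<in>D. \<gamma> * fst z \<le> V z \<and> V z \<le> K) \<and>
        (AE z in lebesgue. z \<in> D \<and> \<gamma> * fst z < V z \<and> V z < K \<longrightarrow> L z = c) \<and>
        (AE z in lebesgue. z \<in> D \<longrightarrow> L z \<ge> c) \<and>
        (\<forall>z\<in>cb_boundary K \<gamma> T. V z = K))"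

text \<open>As \<open>Vx\<close> and \<open>Vxx\<close> are weak derivatives, the limits are required of some representatives
  only, namely of the ones passed as arguments.\<close>

definition vanishing_at_zero ::
  "real \<Rightarrow> (real \<times> real \<Rightarrow> real) \<Rightarrow> (real \<times> real \<Rightarrow> real) \<Rightarrow> bool" where
  "vanishing_at_zero T Vx Vxx \<longleftrightarrow>
     (\<forall>t\<in>{0<..<T}. ((\<lambda>x. x\<^sup>2 * Vxx (x, t)) \<longlongrightarrow> 0) (at_right 0) \<and>
                   ((\<lambda>x. x * Vx (x, t)) \<longlongrightarrow> 0) (at_right 0))"

definition conversion_region ::
  "real \<Rightarrow> real \<Rightarrow> real \<Rightarrow> (real \<times> real \<Rightarrow> real) \<Rightarrow> (real \<times> real) set" where
  "conversion_region K \<gamma> T V = {z \<in> cb_domain K \<gamma> T. V z = \<gamma> * fst z}"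

section \<open>Uniform regularity\<close>

text \<open>The derivative in \<open>x\<close> is taken within the slice of \<open>S\<close>, hence is one-sided at an end point
  of the slice. For a solution \<open>V\<close> of the bond problem this is to be asserted of an extension \<open>U\<close>
  of \<open>V\<close> to the initial segment \<open>t = 0\<close>, where \<open>V\<close> has no prescribed values; the Lipschitz bound
  in \<open>t\<close> then forces \<open>U\<close> to be the continuous extension.\<close>

definition uniformly_C11x_C01t ::
  "real \<Rightarrow> (real \<times> real) set \<Rightarrow> (real \<times> real \<Rightarrow> real) \<Rightarrow> bool" where
  "uniformly_C11x_C01t C S U \<longleftrightarrow>
     (\<exists>Ux :: real \<times> real \<Rightarrow> real.
        (\<forall>x t. (x, t) \<in> S \<longrightarrow>
           ((\<lambda>y. U (y, t)) has_real_derivative Ux (x, t)) (at x within {y. (y, t) \<in> S})) \<and>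
        (\<forall>z\<in>S. \<bar>U z\<bar> \<le> C) \<and>
        (\<forall>z\<in>S. \<bar>Ux z\<bar> \<le> C) \<and>
        (\<forall>x y t. (x, t) \<in> S \<and> (y, t) \<in> S \<longrightarrow> \<bar>Ux (x, t) - Ux (y, t)\<bar> \<le> C * \<bar>x - y\<bar>) \<and>
        (\<forall>x t s. (x, t) \<in> S \<and> (x, s) \<in> S \<longrightarrow> \<bar>U (x, t) - U (x, s)\<bar> \<le> C * \<bar>t - s\<bar>))"

end

theory Submission
  imports Defs
begin

text \<open>In the variable \<open>y = ln x\<close> the operator of the bond problem has constant coefficients,
\<open>L = - \<partial>\<^sub>s - a \<partial>\<^sub>y\<^sub>y - b \<partial>\<^sub>y + r\<close> with \<open>a = \<sigma>\<^sup>2 / 2\<close> and \<open>b = r - q - a\<close>, so it commutes with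
mollification. A bound \<open>k \<le> LV\<close> almost everywhere therefore becomes a classical bound for the
mollified value, and the maximum principle for Sobolev solutions reduces to the elementary one
for smooth functions (\<open>weak_maximum_principle\<close>, \<open>comparison\<close>).

What mollification cannot see is the size of \<open>LV\<close> on the sets \<open>V = \<gamma> x\<close> and \<open>V = K\<close>, where only
\<open>LV \<ge> c\<close> is given. There one uses that a weak derivative of a function vanishes almost
everywhere on each of its level sets (\<open>weak_dx_level_set\<close>, \<open>weak_dt_level_set\<close>). Applied to \<open>V\<close> and
then to its derivative it gives \<open>LV = q \<gamma> x\<close> on the first set and \<open>LV = r K\<close> on the second, so that
\<open>LV\<close> is bounded (\<open>L_bounds\<close>).

The constraint \<open>V \<le> K\<close> may be active in the interior. But \<open>K - V\<close> is a nonnegative supersolution away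
from the conversion region, and a moving bump placed below it shows that once \<open>V < K\<close> at a single
point, \<open>V < K\<close> at all earlier times (\<open>below_face_value_spreads\<close>). Hence \<open>V = K\<close> from some time \<open>t0\<close> on,
while before \<open>t0\<close> the bond solves an obstacle problem with the single obstacle \<open>\<gamma> x\<close>.

Before \<open>t0\<close> the value is compared with its own translates in time and dilations in price. This yields
\<open>0 \<le> V\<^sub>t \<le> r K - c\<close> and \<open>0 \<le> V\<^sub>x \<le> \<gamma>\<close> as bounds for increments. The bounds for \<open>LV\<close> now control
\<open>x\<^sup>2 V\<^sub>x\<^sub>x\<close>, and thereby \<open>V\<^sub>x\<^sub>x\<close> away from \<open>x = 0\<close>. Near \<open>x = 0\<close> there is no conversion, because \<open>V\<close> is at
least the value \<open>\<beta>(t)\<close> of the bond without conversion. There \<open>V - \<beta>\<close> solves \<open>LU = 0\<close> with zero final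
value, and barriers of the form \<open>x\<^sup>2 e\<^bsup>\<Lambda>(t0 - t)\<^esup>\<close> show that \<open>V - \<beta>\<close>, its time derivative and
\<open>x V\<^sub>x\<close> are \<open>O(x\<^sup>2)\<close>; the equation then bounds \<open>V\<^sub>x\<^sub>x\<close> up to \<open>x = 0\<close>.

All these bounds are proved for mollifications, uniformly in the mollification parameter. A bound on
the second derivative is passed to the limit as a Lipschitz estimate between difference quotients
(\<open>quot_lip\<close>), a property that survives pointwise limits and that gives the derivative and its
Lipschitz bound back (\<open>quot_lip_derivative\<close>), also at the closed end \<open>x = K / \<gamma>\<close> and at \<open>t = 0\<close>.\<close>

section \<open>Smooth functions of one variable\<close>

definition smooth_line :: "(real \<Rightarrow> real) \<Rightarrow> bool" where
  "smooth_line f \<longleftrightarrow> (\<exists>F. F (0::nat) = f \<and> (\<forall>n x. (F n has_real_derivative F (Suc n) x) (at x)))"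

text \<open>Smoothness by coinduction: iterating a choice of derivatives inside a family that is closed
  under differentiation produces all higher derivatives.\<close>

lemma smooth_line_family:
  assumes S: "\<And>f. f \<in> S \<Longrightarrow> \<exists>g\<in>S. \<forall>x. (f has_real_derivative g x) (at x)"
    and f: "f \<in> S"
  shows "smooth_line f"
proof -
  obtain d where d: "\<And>f. f \<in> S \<Longrightarrow> d f \<in> S \<and> (\<forall>x. (f has_real_derivative d f x) (at x))"
    using S by metis
  define F where "F n = (d ^^ n) f" for n
  have inS: "F n \<in> S" for n
    by (induction n) (use d f in \<open>auto simp: F_def\<close>)
  have "(F n has_real_derivative F (Suc n) x) (at x)" for n x
    using d[OF inS[of n]] by (simp add: F_def)
  then show ?thesis unfolding smooth_line_def
    by (intro exI[of _ F]) (simp add: F_def)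
qed

lemma smooth_line_has_deriv:
  assumes "smooth_line f"
  shows "(f has_real_derivative deriv f x) (at x)"
  using assms unfolding smooth_line_def
  by (metis DERIV_deriv_iff_real_differentiable real_differentiable_def)

lemma smooth_line_deriv:
  assumes "smooth_line f"
  shows "smooth_line (deriv f)"
proof -
  obtain F where F: "F 0 = f" "\<And>n x. (F n has_real_derivative F (Suc n) x) (at x)"
    using assms unfolding smooth_line_def by auto
  have "deriv f = F 1"
    using F by (intro ext DERIV_imp_deriv) (metis One_nat_def)
  then show ?thesis unfolding smooth_line_def
    by (intro exI[of _ "\<lambda>n. F (Suc n)"]) (use F in auto)
qed

lemma smooth_line_continuous: "smooth_line f \<Longrightarrow> continuous_on A f"
  by (meson DERIV_continuous_on has_field_derivative_at_within smooth_line_has_deriv)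

text \<open>The sums of products, a family that is closed under differentiation by the product rule.\<close>

inductive_set prod_span :: "(real \<Rightarrow> real) set \<Rightarrow> (real \<Rightarrow> real) set \<Rightarrow> (real \<Rightarrow> real) set"
  for A B where
  base: "f \<in> A \<Longrightarrow> g \<in> B \<Longrightarrow> (\<lambda>x. f x * g x) \<in> prod_span A B"
| add: "f \<in> prod_span A B \<Longrightarrow> g \<in> prod_span A B \<Longrightarrow> (\<lambda>x. f x + g x) \<in> prod_span A B"

lemma smooth_line_mult:
  assumes "smooth_line f" "smooth_line g"
  shows "smooth_line (\<lambda>x. f x * g x)"
proof (rule smooth_line_family)
  let ?S = "prod_span (Collect smooth_line) (Collect smooth_line)"
  show "(\<lambda>x. f x * g x) \<in> ?S"
    using assms by (intro prod_span.base) auto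
  show "\<exists>k\<in>?S. \<forall>x. (h has_real_derivative k x) (at x)" if "h \<in> ?S" for h
    using that
  proof induction
    case (base f g)
    then have "(\<lambda>x. deriv f x * g x + f x * deriv g x) \<in> ?S"
      by (intro prod_span.intros) (auto intro: smooth_line_deriv)
    moreover have "((\<lambda>x. f x * g x) has_real_derivative deriv f x * g x + f x * deriv g x) (at x)" for x
      using base by (auto intro!: derivative_eq_intros smooth_line_has_deriv)
    ultimately show ?case by (metis (no_types, lifting))
  next
    case (add f g)
    then obtain f' g' where "f' \<in> ?S" "\<forall>x. (f has_real_derivative f' x) (at x)"
      "g' \<in> ?S" "\<forall>x. (g has_real_derivative g' x) (at x)" by blast
    then show ?case
      by (intro bexI[of _ "\<lambda>x. f' x + g' x"] prod_span.add) (auto intro!: derivative_eq_intros)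
  qed
qed

lemma smooth_line_affine:
  assumes "smooth_line f"
  shows "smooth_line (\<lambda>x. f (\<alpha> + \<beta> * x))"
proof -
  obtain F where F: "F (0::nat) = f" "\<And>n x. (F n has_real_derivative F (Suc n) x) (at x)"
    using assms unfolding smooth_line_def by auto
  have "((\<lambda>x. \<beta> ^ n * F n (\<alpha> + \<beta> * x)) has_real_derivative \<beta> ^ Suc n * F (Suc n) (\<alpha> + \<beta> * x)) (at x)" for n x
    by (rule derivative_eq_intros DERIV_chain2[OF F(2)] refl | simp)+
  then show ?thesis unfolding smooth_line_def
    by (intro exI[of _ "\<lambda>n x. \<beta> ^ n * F n (\<alpha> + \<beta> * x)"]) (use F(1) in auto)
qed

lemma smooth_line_const: "smooth_line (\<lambda>x. c)"
  unfolding smooth_line_def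
  by (intro exI[of _ "\<lambda>n x. if n = 0 then c else 0"]) auto

lemma smooth_line_cmult: "smooth_line f \<Longrightarrow> smooth_line (\<lambda>x. c * f x)"
  by (rule smooth_line_mult[OF smooth_line_const])

lemma smooth_line_exp_cmult: "smooth_line (\<lambda>x. exp (c * x))"
  unfolding smooth_line_def
  by (intro exI[of _ "\<lambda>n x. c ^ n * exp (c * x)"]) (auto intro!: derivative_eq_intros)

lemma poly_times_exp_tendsto_0:
  fixes p :: "real poly"
  shows "((\<lambda>u. u ^ k * poly p u * exp (- u)) \<longlongrightarrow> 0) at_top"
proof (induction p arbitrary: k)
  case 0
  then show ?case by simp
next
  case (pCons a p)
  have "((\<lambda>u. a * (u ^ k / exp u) + u ^ Suc k * poly p u * exp (- u)) \<longlongrightarrow> a * 0 + 0) at_top"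
    by (intro tendsto_intros tendsto_power_div_exp_0 pCons)
  then show ?case
    by (simp add: exp_minus field_simps)
qed

text \<open>The functions \<open>p(1 / x) exp (- 1 / x)\<close> for \<open>x > 0\<close>, continued by zero.
  Admitting a polynomial factor makes the family closed under differentiation.\<close>

definition flat :: "real poly \<Rightarrow> real \<Rightarrow> real" where
  "flat p x = (if x > 0 then poly p (1 / x) * exp (- (1 / x)) else 0)"

text \<open>The derivative of \<open>p(1 / x) exp (- 1 / x)\<close> is \<open>(p - p')(1 / x) exp (- 1 / x)
  / x\<^sup>2\<close>, again of the same form; at zero the exponential beats every power of
  \<open>1 / x\<close>.\<close>

lemma flat_has_deriv: "(flat p has_real_derivative flat ([:0, 0, 1:] * (p - pderiv p)) x) (at x)"
proof -
  consider "x > 0" | "x < 0" | "x = 0" by linarith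
  then show ?thesis
  proof cases
    case 1
    have "((\<lambda>x. poly p (1 / x) * exp (- (1 / x))) has_real_derivative
        flat ([:0, 0, 1:] * (p - pderiv p)) x) (at x)"
      using 1 by (auto intro!: derivative_eq_intros DERIV_chain2[OF poly_DERIV]
          simp: flat_def field_simps power2_eq_square)
    then show ?thesis
      by (rule has_field_derivative_transform_within_open[of _ _ _ "{0<..}"])
        (use 1 in \<open>auto simp: flat_def\<close>)
  next
    case 2
    have "((\<lambda>x. 0) has_real_derivative 0) (at x)" by simp
    then have "(flat p has_real_derivative 0) (at x)"
      by (rule has_field_derivative_transform_within_open[of _ _ _ "{..<0}"])
        (use 2 in \<open>auto simp: flat_def\<close>)
    then show ?thesis using 2 by (simp add: flat_def)
  next
    case 3
    have "((\<lambda>u. u ^ 1 * poly p u * exp (- u)) \<longlongrightarrow> 0) at_top"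
      by (rule poly_times_exp_tendsto_0)
    then have "((\<lambda>h. inverse h ^ 1 * poly p (inverse h) * exp (- inverse h)) \<longlongrightarrow> 0) (at_right 0)"
      by (rule filterlim_compose[OF _ filterlim_inverse_at_top_right])
    then have right: "((\<lambda>h. (flat p (0 + h) - flat p 0) / h) \<longlongrightarrow> 0) (at_right 0)"
      by (rule Lim_transform_eventually)
        (auto simp: flat_def eventually_at_right_less field_simps intro!: eventually_at_rightI[of 0 1])
    have left: "((\<lambda>h. (flat p (0 + h) - flat p 0) / h) \<longlongrightarrow> 0) (at_left 0)"
      by (rule Lim_transform_eventually[OF tendsto_const])
        (auto simp: flat_def intro!: eventually_at_leftI[of "-1" 0])
    from left right have "((\<lambda>h. (flat p (0 + h) - flat p 0) / h) \<longlongrightarrow> 0) (at 0)"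
      by (rule filterlim_split_at)
    then show ?thesis using 3
      by (simp add: DERIV_def flat_def)
  qed
qed

lemma smooth_line_flat: "smooth_line (flat p)"
  by (rule smooth_line_family[of "range flat"]) (use flat_has_deriv in auto)

definition bump_on :: "real \<Rightarrow> real \<Rightarrow> (real \<Rightarrow> real) set" where
  "bump_on l u = {f. smooth_line f \<and> (\<forall>x. x \<notin> {l..u} \<longrightarrow> f x = 0)}"

lemma bump_on_smooth: "f \<in> bump_on l u \<Longrightarrow> smooth_line f"
  by (simp add: bump_on_def)

lemma bump_on_zero: "f \<in> bump_on l u \<Longrightarrow> x \<notin> {l..u} \<Longrightarrow> f x = 0"
  by (simp add: bump_on_def)

lemmas bump_on_has_deriv = smooth_line_has_deriv[OF bump_on_smooth]
lemmas bump_on_continuous = smooth_line_continuous[OF bump_on_smooth]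

lemma bump_on_mono: "f \<in> bump_on l u \<Longrightarrow> l' \<le> l \<Longrightarrow> u \<le> u' \<Longrightarrow> f \<in> bump_on l' u'"
  by (auto simp: bump_on_def)

lemma bump_on_deriv:
  assumes "f \<in> bump_on l u"
  shows "deriv f \<in> bump_on l u"
proof -
  have "deriv f x = 0" if "x \<notin> {l..u}" for x
  proof -
    have "((\<lambda>x. 0) has_real_derivative 0) (at x)" by simp
    then have "(f has_real_derivative 0) (at x)"
      by (rule has_field_derivative_transform_within_open[of _ _ _ "- {l..u}"])
        (use that bump_on_zero[OF assms] in auto)
    then show ?thesis by (rule DERIV_imp_deriv)
  qed
  then show ?thesis using assms by (auto simp: bump_on_def smooth_line_deriv)
qed

lemma bump_on_bounded:
  assumes "f \<in> bump_on l u"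
  obtains C where "C \<ge> 0" "\<And>x. \<bar>f x\<bar> \<le> C"
proof -
  have "bounded (f ` {l..u})"
    by (intro compact_imp_bounded compact_continuous_image bump_on_continuous[OF assms]) auto
  then obtain C where C: "\<And>x. x \<in> {l..u} \<Longrightarrow> \<bar>f x\<bar> \<le> C"
    unfolding bounded_real by force
  have "\<bar>f x\<bar> \<le> max C 0" for x
    using C[of x] bump_on_zero[OF assms, of x] by (cases "x \<in> {l..u}") auto
  then show ?thesis using that[of "max C 0"] by auto
qed

lemma bump_on_mult:
  assumes "f \<in> bump_on l u" "smooth_line g"
  shows "(\<lambda>x. g x * f x) \<in> bump_on l u"
  using assms by (auto simp: bump_on_def intro: smooth_line_mult)

lemma bump_on_reflect:
  assumes "f \<in> bump_on (-\<delta>) \<delta>"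
  shows "(\<lambda>w. f (x - w)) \<in> bump_on (x - \<delta>) (x + \<delta>)"
  using assms smooth_line_affine[of f x "-1"] by (auto simp: bump_on_def)

lemma deriv_reflect:
  assumes "f \<in> bump_on l u"
  shows "deriv (\<lambda>w. f (x - w)) w = - deriv f (x - w)"
proof (rule DERIV_imp_deriv)
  have "((\<lambda>w. x - w) has_real_derivative -1) (at w)"
    by (auto intro!: derivative_eq_intros)
  from DERIV_chain2[OF bump_on_has_deriv[OF assms] this]
  show "((\<lambda>w. f (x - w)) has_real_derivative - deriv f (x - w)) (at w)" by simp
qed

subsection \<open>Passing to logarithmic coordinates\<close>

text \<open>The function \<open>\<beta>\<close> of the logarithmic variable, read as a function of the
  price. If \<open>\<beta>\<close> has compact support, the support of the pullback stays away
  from \<open>0\<close>, so the continuation by zero is smooth.\<close>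

definition log_pullback :: "(real \<Rightarrow> real) \<Rightarrow> real \<Rightarrow> real" where
  "log_pullback \<beta> x = (if x > 0 then \<beta> (ln x) else 0)"

lemma log_pullback_has_deriv:
  assumes \<beta>: "\<beta> \<in> bump_on l u"
  shows "(log_pullback \<beta> has_real_derivative log_pullback (\<lambda>y. exp (- 1 * y) * deriv \<beta> y) x) (at x)"
proof (cases "x > 0")
  case True
  have "((\<lambda>x. \<beta> (ln x)) has_real_derivative log_pullback (\<lambda>y. exp (- 1 * y) * deriv \<beta> y) x) (at x)"
    using True DERIV_chain2[OF bump_on_has_deriv[OF \<beta>] DERIV_ln_divide[OF True]]
    by (simp add: log_pullback_def exp_minus field_simps)
  then show ?thesis
    by (rule has_field_derivative_transform_within_open[of _ _ _ "{0<..}"])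
      (use True in \<open>auto simp: log_pullback_def\<close>)
next
  case False
  have "((\<lambda>x. 0) has_real_derivative 0) (at x)" by simp
  then have "(log_pullback \<beta> has_real_derivative 0) (at x)"
  proof (rule has_field_derivative_transform_within_open[of _ _ _ "{..<exp l}"])
    show "x \<in> {..<exp l}" using False le_less_trans[of x 0 "exp l"] by simp
    show "0 = log_pullback \<beta> y" if "y \<in> {..<exp l}" for y
      using that bump_on_zero[OF \<beta>, of "ln y"] by (auto simp: log_pullback_def ln_ge_iff)
  qed auto
  then show ?thesis using False by (simp add: log_pullback_def)
qed

lemma log_pullback_bump:
  assumes \<beta>: "\<beta> \<in> bump_on l u"
  shows "log_pullback \<beta> \<in> bump_on (exp l) (exp u)"
proof -
  have "smooth_line (log_pullback \<beta>)"
  proof (rule smooth_line_family)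
    show "log_pullback \<beta> \<in> log_pullback ` bump_on l u" using \<beta> by auto
    fix f assume "f \<in> log_pullback ` bump_on l u"
    then obtain \<beta> where \<beta>: "f = log_pullback \<beta>" "\<beta> \<in> bump_on l u" by auto
    then show "\<exists>g\<in>log_pullback ` bump_on l u. \<forall>x. (f has_real_derivative g x) (at x)"
      using log_pullback_has_deriv[of \<beta>] bump_on_mult[OF bump_on_deriv[of \<beta>] smooth_line_exp_cmult, of l u "-1"]
      by blast
  qed
  moreover have "log_pullback \<beta> x = 0" if "x \<notin> {exp l..exp u}" for x
  proof (cases "x > 0")
    case True
    then have "ln x \<notin> {l..u}"
      using that by (auto simp: ln_ge_iff) (metis exp_le_cancel_iff exp_ln)
    then show ?thesis using bump_on_zero[OF \<beta>] by (simp add: log_pullback_def)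
  qed (simp add: log_pullback_def)
  ultimately show ?thesis by (simp add: bump_on_def)
qed

section \<open>Product test functions\<close>

lemma smooth_plane_product:
  assumes "smooth_line f" "smooth_line g"
  shows "smooth_plane (\<lambda>z. f (fst z) * g (snd z))"
proof -
  obtain F G where F: "F (0::nat) = f" "\<And>n x. (F n has_real_derivative F (Suc n) x) (at x)"
    and G: "G (0::nat) = g" "\<And>n x. (G n has_real_derivative G (Suc n) x) (at x)"
    using assms unfolding smooth_line_def by auto
  have cF: "continuous_on UNIV (F n)" and cG: "continuous_on UNIV (G n)" for n
    using F G by (meson DERIV_continuous_on has_field_derivative_at_within)+
  have "continuous_on UNIV (\<lambda>z. F i (fst z) * G j (snd z))" for i j
    by (intro continuous_intros continuous_on_compose2[OF cF] continuous_on_compose2[OF cG]) auto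
  then show ?thesis unfolding smooth_plane_def
    by (intro exI[of _ "\<lambda>i j z. F i (fst z) * G j (snd z)"])
      (use F G in \<open>auto intro!: derivative_eq_intros\<close>)
qed

text \<open>Products suffice as test functions, since the mollification kernels are products.\<close>

lemma product_test_function:
  assumes f: "f \<in> bump_on l1 u1" and g: "g \<in> bump_on l2 u2" and D: "{l1..u1} \<times> {l2..u2} \<subseteq> D"
  shows "(\<lambda>z. f (fst z) * g (snd z)) \<in> test_functions D"
proof -
  let ?\<phi> = "\<lambda>z. f (fst z) * g (snd z)"
  have "{z. ?\<phi> z \<noteq> 0} \<subseteq> {l1..u1} \<times> {l2..u2}"
    using bump_on_zero[OF f] bump_on_zero[OF g] by fastforce
  moreover have "compact ({l1..u1} \<times> {l2..u2})" by (intro compact_Times) auto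
  ultimately have "closure {z. ?\<phi> z \<noteq> 0} \<subseteq> {l1..u1} \<times> {l2..u2}"
    by (intro closure_minimal compact_imp_closed)
  moreover have "compact (closure {z. ?\<phi> z \<noteq> 0})"
    using \<open>{z. ?\<phi> z \<noteq> 0} \<subseteq> {l1..u1} \<times> {l2..u2}\<close> \<open>compact ({l1..u1} \<times> {l2..u2})\<close>
    by (metis bounded_subset compact_closure compact_imp_bounded)
  ultimately show ?thesis
    using D smooth_plane_product[OF bump_on_smooth[OF f] bump_on_smooth[OF g]]
    by (auto simp: test_functions_def)
qed

lemma weak_dx_product:
  assumes "weak_dx D f g" and a: "a \<in> bump_on l1 u1" and b: "b \<in> bump_on l2 u2"
    and D: "{l1..u1} \<times> {l2..u2} \<subseteq> D"
  shows "(LINT z:D|lebesgue. f z * (deriv a (fst z) * b (snd z))) =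
         - (LINT z:D|lebesgue. g z * (a (fst z) * b (snd z)))"
proof -
  have "deriv (\<lambda>y. a y * b t) x = deriv a x * b t" for x t
    by (rule DERIV_imp_deriv) (auto intro!: derivative_eq_intros bump_on_has_deriv[OF a])
  then show ?thesis
    using assms(1) product_test_function[OF a b D] unfolding weak_dx_def by fastforce
qed

lemma weak_dt_product:
  assumes "weak_dt D f g" and a: "a \<in> bump_on l1 u1" and b: "b \<in> bump_on l2 u2"
    and D: "{l1..u1} \<times> {l2..u2} \<subseteq> D"
  shows "(LINT z:D|lebesgue. f z * (a (fst z) * deriv b (snd z))) =
         - (LINT z:D|lebesgue. g z * (a (fst z) * b (snd z)))"
proof -
  have "deriv (\<lambda>s. a x * b s) t = a x * deriv b t" for x t
    by (rule DERIV_imp_deriv) (auto intro!: derivative_eq_intros bump_on_has_deriv[OF b])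
  then show ?thesis
    using assms(1) product_test_function[OF a b D] unfolding weak_dt_def by fastforce
qed

section \<open>Mollification in the plane\<close>

text \<open>A bump that is positive exactly on \<open>(-1, 1)\<close>.\<close>

definition bump0 :: "real \<Rightarrow> real" where
  "bump0 x = flat 1 (1 + x) * flat 1 (1 - x)"

lemma bump0_nonneg: "bump0 x \<ge> 0"
  by (simp add: bump0_def flat_def)

lemma bump0_bump: "bump0 \<in> bump_on (-1) 1"
  using smooth_line_mult[OF smooth_line_affine[OF smooth_line_flat[of 1], of 1 1]
      smooth_line_affine[OF smooth_line_flat[of 1], of 1 "-1"]]
  by (auto simp: bump_on_def bump0_def[abs_def] flat_def)

lemma bump_on_integrable:
  assumes "f \<in> bump_on l u"
  shows "integrable lborel f"
proof -
  have "integrable lborel (\<lambda>x. indicator {l..u} x *\<^sub>R f x)"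
    by (intro borel_integrable_compact bump_on_continuous[OF assms]) auto
  moreover have "(\<lambda>x. indicator {l..u} x *\<^sub>R f x) = f"
    using bump_on_zero[OF assms] by (intro ext) (auto simp: indicator_def)
  ultimately show ?thesis by simp
qed

lemma bump0_integral_pos: "(LINT x|lborel. bump0 x) > 0"
proof -
  have "(LINT x|lborel. bump0 x) \<noteq> 0"
  proof
    assume "(LINT x|lborel. bump0 x) = 0"
    then have "AE x in lborel. bump0 x = 0"
      using integral_nonneg_eq_0_iff_AE[OF bump_on_integrable[OF bump0_bump]] bump0_nonneg by auto
    then have "AE x::real in lborel. x \<notin> {-1<..<1}"
      by eventually_elim (auto simp: bump0_def flat_def)
    then have "{-1<..<1::real} \<in> null_sets lborel"
      by (subst (asm) AE_iff_null_sets[symmetric]) auto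
    then show False by (auto simp: null_sets_def)
  qed
  moreover have "(LINT x|lborel. bump0 x) \<ge> 0" by (simp add: bump0_nonneg)
  ultimately show ?thesis by linarith
qed

definition moll :: "real \<Rightarrow> real \<Rightarrow> real" where
  "moll \<delta> x = bump0 (x / \<delta>) / (\<delta> * (LINT x|lborel. bump0 x))"

lemma moll_nonneg: "\<delta> > 0 \<Longrightarrow> moll \<delta> x \<ge> 0"
  using bump0_integral_pos bump0_nonneg by (simp add: moll_def)

lemma moll_bump:
  assumes "\<delta> > 0"
  shows "moll \<delta> \<in> bump_on (-\<delta>) \<delta>"
proof -
  have "smooth_line (\<lambda>x. (1 / (\<delta> * (LINT x|lborel. bump0 x))) * bump0 (0 + (1 / \<delta>) * x))"
    by (intro smooth_line_cmult smooth_line_affine bump_on_smooth[OF bump0_bump])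
  moreover have "moll \<delta> x = 0" if "x \<notin> {-\<delta>..\<delta>}" for x
    using that assms bump_on_zero[OF bump0_bump, of "x / \<delta>"] by (auto simp: moll_def field_simps)
  ultimately show ?thesis by (simp add: bump_on_def moll_def[abs_def])
qed

lemma moll_integral:
  assumes "\<delta> > 0"
  shows "(LINT x|lborel. moll \<delta> x) = 1"
proof -
  have "(LINT x|lborel. bump0 x) = \<bar>1 / \<delta>\<bar> *\<^sub>R (LINT x|lborel. bump0 (0 + (1 / \<delta>) * x))"
    by (rule lborel_integral_real_affine) (use assms in simp)
  then have "(LINT x|lborel. bump0 (x / \<delta>)) = \<delta> * (LINT x|lborel. bump0 x)"
    using assms by (simp add: field_simps)
  then show ?thesis
    using assms bump0_integral_pos by (simp add: moll_def)
qed

lemma integrable_swap_lborel: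
  fixes f :: "real \<times> real \<Rightarrow> real"
  assumes "integrable lborel f"
  shows "integrable lborel (\<lambda>w. f (prod.swap w))"
  using lborel_pair.integrable_product_swap[of f] assms
  by (simp add: lborel_prod prod.swap_def case_prod_unfold)

lemma integral_swap_lborel:
  fixes f :: "real \<times> real \<Rightarrow> real"
  assumes "integrable lborel f"
  shows "(LINT w|lborel. f (prod.swap w)) = (LINT w|lborel. f w)"
  using lborel_pair.integral_product_swap[of f] borel_measurable_integrable[OF assms]
  by (simp add: lborel_prod prod.swap_def case_prod_unfold)

text \<open>Convolution of \<open>u\<close> with the product kernel \<open>k(y) l(s)\<close>. Keeping the
  two factors apart lets a derivative fall on either of them.\<close>

definition conv :: "(real \<Rightarrow> real) \<Rightarrow> (real \<Rightarrow> real) \<Rightarrow> (real \<times> real \<Rightarrow> real) \<Rightarrow> real \<times> real \<Rightarrow> real" where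
  "conv k l u z = (LINT w|lborel. k (fst z - fst w) * l (snd z - snd w) * u w)"

lemma conv_integrable:
  assumes u: "integrable lborel u" and k: "k \<in> bump_on a b" and l: "l \<in> bump_on c d"
  shows "integrable lborel (\<lambda>w. k (fst z - fst w) * l (snd z - snd w) * u w)"
proof -
  obtain C where C: "C \<ge> 0" "\<And>x. \<bar>k x\<bar> \<le> C" using bump_on_bounded[OF k] by blast
  obtain D where D: "D \<ge> 0" "\<And>x. \<bar>l x\<bar> \<le> D" using bump_on_bounded[OF l] by blast
  note [measurable] = borel_measurable_integrable[OF u]
  have "continuous_on UNIV (\<lambda>w::real \<times> real. k (fst z - fst w) * l (snd z - snd w))"
    by (intro continuous_intros continuous_on_compose2[OF bump_on_continuous[OF k, of UNIV]]
        continuous_on_compose2[OF bump_on_continuous[OF l, of UNIV]]) auto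
  then have [measurable]: "(\<lambda>w::real \<times> real. k (fst z - fst w) * l (snd z - snd w)) \<in> borel_measurable lborel"
    using borel_measurable_continuous_onI by simp
  have "integrable lborel (\<lambda>w. C * D * u w)" using u by simp
  then show ?thesis
  proof (rule Bochner_Integration.integrable_bound)
    show "(\<lambda>w. k (fst z - fst w) * l (snd z - snd w) * u w) \<in> borel_measurable lborel"
      by measurable
    have "\<bar>k x * l y * t\<bar> \<le> \<bar>C * D * t\<bar>" for x y t
      using C D by (auto simp: abs_mult intro!: mult_mono)
    then show "AE w in lborel. norm (k (fst z - fst w) * l (snd z - snd w) * u w) \<le> norm (C * D * u w)"
      by simp
  qed
qed

lemma conv_swap:
  assumes u: "integrable lborel u" and k: "k \<in> bump_on a b" and l: "l \<in> bump_on c d"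
  shows "conv k l u (y, s) = conv l k (\<lambda>w. u (prod.swap w)) (s, y)"
proof -
  have "conv l k (\<lambda>w. u (prod.swap w)) (s, y) =
      (LINT w|lborel. k (fst (y, s) - fst (prod.swap w)) * l (snd (y, s) - snd (prod.swap w)) * u (prod.swap w))"
    unfolding conv_def by (rule Bochner_Integration.integral_cong) (simp_all add: mult.commute)
  also have "\<dots> = conv k l u (y, s)"
    unfolding conv_def by (rule integral_swap_lborel[OF conv_integrable[OF u k l, of "(y, s)"]])
  finally show ?thesis by simp
qed

lemma bump_on_deriv_lipschitz:
  assumes "k \<in> bump_on a b"
  obtains C where "C \<ge> 0" "\<And>x y. \<bar>k x - k y\<bar> \<le> C * \<bar>x - y\<bar>"
proof -
  obtain C where C: "C \<ge> 0" "\<And>x. \<bar>deriv k x\<bar> \<le> C"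
    using bump_on_bounded[OF bump_on_deriv[OF assms]] by blast
  have "norm (k x - k y) \<le> C * norm (x - y)" for x y
    by (rule field_differentiable_bound[where S = UNIV and f' = "deriv k"])
      (use bump_on_has_deriv[OF assms] C in auto)
  then show ?thesis using that C by auto
qed

lemma bump_on_taylor:
  assumes "k \<in> bump_on a b"
  obtains C where "C \<ge> 0" "\<And>x h. \<bar>k (x + h) - k x - h * deriv k x\<bar> \<le> C * h\<^sup>2"
proof -
  obtain C where C: "C \<ge> 0" "\<And>x y. \<bar>deriv k x - deriv k y\<bar> \<le> C * \<bar>x - y\<bar>"
    using bump_on_deriv_lipschitz[OF bump_on_deriv[OF assms]] by blast
  have "\<bar>k (x + h) - k x - h * deriv k x\<bar> \<le> C * h\<^sup>2" for x h
  proof -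
    have "norm ((k (x + h) - deriv k x * (x + h)) - (k x - deriv k x * x)) \<le> (C * \<bar>h\<bar>) * norm ((x + h) - x)"
    proof (rule field_differentiable_bound[where S = "closed_segment x (x + h)" and f' = "\<lambda>y. deriv k y - deriv k x"])
      fix y assume y: "y \<in> closed_segment x (x + h)"
      show "((\<lambda>y. k y - deriv k x * y) has_field_derivative deriv k y - deriv k x) (at y within closed_segment x (x + h))"
        by (auto intro!: derivative_eq_intros bump_on_has_deriv[OF assms, THEN has_field_derivative_at_within])
      have "\<bar>y - x\<bar> \<le> \<bar>h\<bar>" using y by (auto simp: closed_segment_eq_real_ivl split: if_splits)
      then show "norm (deriv k y - deriv k x) \<le> C * \<bar>h\<bar>"
        using order_trans[OF C(2)[of y x] mult_left_mono[OF _ C(1)]] by simp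
    qed auto
    moreover have "(k (x + h) - deriv k x * (x + h)) - (k x - deriv k x * x) = k (x + h) - k x - h * deriv k x"
      by (simp add: algebra_simps)
    moreover have "(C * \<bar>h\<bar>) * norm ((x + h) - x) = C * h\<^sup>2"
      by (simp add: power2_eq_square)
    ultimately show ?thesis by (metis real_norm_def)
  qed
  then show ?thesis using that C by blast
qed

lemma has_deriv_of_quadratic_error:
  fixes f :: "real \<Rightarrow> real"
  assumes "\<And>h. \<bar>f (x + h) - f x - h * d\<bar> \<le> C * h\<^sup>2"
  shows "(f has_real_derivative d) (at x)"
  unfolding DERIV_def
proof (rule LIM_zero_cancel, rule Lim_null_comparison)
  show "((\<lambda>h. C * \<bar>h\<bar>) \<longlongrightarrow> 0) (at 0)" by (auto intro!: tendsto_eq_intros)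
  have "\<bar>(f (x + h) - f x) / h - d\<bar> \<le> C * \<bar>h\<bar>" if "h \<noteq> 0" for h
  proof -
    have "\<bar>(f (x + h) - f x) / h - d\<bar> = \<bar>f (x + h) - f x - h * d\<bar> / \<bar>h\<bar>"
      unfolding abs_divide[symmetric] using that by (intro arg_cong[of _ _ abs]) (simp add: diff_divide_distrib)
    also have "\<dots> \<le> C * h\<^sup>2 / \<bar>h\<bar>" by (intro divide_right_mono assms) auto
    also have "\<dots> = C * \<bar>h\<bar>" using that by (cases "h > 0") (auto simp: power2_eq_square)
    finally show ?thesis .
  qed
  then show "\<forall>\<^sub>F h in at 0. norm ((f (x + h) - f x) / h - d) \<le> C * \<bar>h\<bar>"
    by (auto simp: eventually_at intro!: exI[of _ 1])
qed

text \<open>Differentiation under the integral holds for merely integrable \<open>u\<close>, because the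
  remainder in the Taylor expansion of the kernel is uniform.\<close>

lemma conv_has_deriv_fst:
  assumes u: "integrable lborel u" and k: "k \<in> bump_on a b" and l: "l \<in> bump_on c d"
  shows "((\<lambda>y. conv k l u (y, s)) has_real_derivative conv (deriv k) l u (y, s)) (at y)"
proof -
  obtain C where C: "C \<ge> 0" "\<And>x h. \<bar>k (x + h) - k x - h * deriv k x\<bar> \<le> C * h\<^sup>2"
    using bump_on_taylor[OF k] by blast
  obtain D where D: "D \<ge> 0" "\<And>x. \<bar>l x\<bar> \<le> D" using bump_on_bounded[OF l] by blast
  note int = conv_integrable[OF u k l] conv_integrable[OF u bump_on_deriv[OF k] l]
  show ?thesis
  proof (rule has_deriv_of_quadratic_error)
    fix h :: real
    let ?e = "\<lambda>w. (k (y + h - fst w) - k (y - fst w) - h * deriv k (y - fst w)) * l (s - snd w) * u w"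
    let ?A = "\<lambda>w. k (y + h - fst w) * l (s - snd w) * u w" and ?B = "\<lambda>w. k (y - fst w) * l (s - snd w) * u w"
      and ?D = "\<lambda>w. deriv k (y - fst w) * l (s - snd w) * u w"
    have iA: "integrable lborel ?A" and iB: "integrable lborel ?B" and iD: "integrable lborel ?D"
      using int(1)[of "(y + h, s)"] int(1)[of "(y, s)"] int(2)[of "(y, s)"] by simp_all
    have eq: "?e = (\<lambda>w. ?A w - ?B w - h * ?D w)"
      by (rule ext) (simp only: left_diff_distrib mult.assoc)
    have iAB: "integrable lborel (\<lambda>w. ?A w - ?B w)" and ihD: "integrable lborel (\<lambda>w. h * ?D w)"
      by (rule Bochner_Integration.integrable_diff[OF iA iB], rule integrable_mult_right[OF iD])
    have ie: "integrable lborel ?e"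
      unfolding eq by (rule Bochner_Integration.integrable_diff[OF iAB ihD])
    have "(LINT w|lborel. ?e w) = (LINT w|lborel. ?A w) - (LINT w|lborel. ?B w) - h * (LINT w|lborel. ?D w)"
      unfolding eq Bochner_Integration.integral_diff[OF iAB ihD] Bochner_Integration.integral_diff[OF iA iB]
        Bochner_Integration.integral_mult_right_zero ..
    then have "\<bar>conv k l u (y + h, s) - conv k l u (y, s) - h * conv (deriv k) l u (y, s)\<bar> = \<bar>LINT w|lborel. ?e w\<bar>"
      by (simp add: conv_def)
    also have "\<dots> \<le> (LINT w|lborel. \<bar>?e w\<bar>)" by (rule integral_abs_bound)
    also have "\<dots> \<le> (LINT w|lborel. C * h\<^sup>2 * D * \<bar>u w\<bar>)"
    proof (rule integral_mono)
      show "integrable lborel (\<lambda>w. \<bar>?e w\<bar>)" by (rule integrable_abs[OF ie])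
      show "integrable lborel (\<lambda>w. C * h\<^sup>2 * D * \<bar>u w\<bar>)" by (intro integrable_mult_right integrable_abs u)
      fix w :: "real \<times> real"
      have "\<bar>k (y + h - fst w) - k (y - fst w) - h * deriv k (y - fst w)\<bar> \<le> C * h\<^sup>2"
        using C(2)[of "y - fst w" h] by (simp add: algebra_simps)
      then show "\<bar>?e w\<bar> \<le> C * h\<^sup>2 * D * \<bar>u w\<bar>"
        unfolding abs_mult by (intro mult_mono D) (use C D in auto)
    qed
    also have "\<dots> = (C * D * (LINT w|lborel. \<bar>u w\<bar>)) * h\<^sup>2"
      unfolding Bochner_Integration.integral_mult_right_zero by (simp only: mult_ac)
    finally show "\<bar>conv k l u (y + h, s) - conv k l u (y, s) - h * conv (deriv k) l u (y, s)\<bar>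
        \<le> (C * D * (LINT w|lborel. \<bar>u w\<bar>)) * h\<^sup>2" .
  qed
qed

lemma conv_has_deriv_snd:
  assumes u: "integrable lborel u" and k: "k \<in> bump_on a b" and l: "l \<in> bump_on c d"
  shows "((\<lambda>s. conv k l u (y, s)) has_real_derivative conv k (deriv l) u (y, s)) (at s)"
  using conv_has_deriv_fst[OF integrable_swap_lborel[OF u] l k]
  by (simp add: conv_swap[OF u k l] conv_swap[OF u k bump_on_deriv[OF l]])

lemma conv_continuous:
  assumes u: "integrable lborel u" and k: "k \<in> bump_on a b" and l: "l \<in> bump_on c d"
  shows "continuous_on A (conv k l u)"
proof -
  obtain C where C: "C \<ge> 0" "\<And>x. \<bar>k x\<bar> \<le> C" using bump_on_bounded[OF k] by blast
  obtain D where D: "D \<ge> 0" "\<And>x. \<bar>l x\<bar> \<le> D" using bump_on_bounded[OF l] by blast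
  have "continuous (at z) (conv k l u)" for z
    unfolding continuous_at_sequentially
  proof (intro allI impI)
    fix x :: "nat \<Rightarrow> real \<times> real" assume x: "x \<longlonglongrightarrow> z"
    show "(conv k l u \<circ> x) \<longlonglongrightarrow> conv k l u z"
      unfolding conv_def comp_def
    proof (rule integral_dominated_convergence[where w = "\<lambda>w. C * D * \<bar>u w\<bar>"])
      show "AE w in lborel. (\<lambda>n. k (fst (x n) - fst w) * l (snd (x n) - snd w) * u w) \<longlonglongrightarrow>
          k (fst z - fst w) * l (snd z - snd w) * u w"
        using x by (auto intro!: tendsto_intros isCont_tendsto_compose[of _ k] isCont_tendsto_compose[of _ l]
            DERIV_isCont[OF bump_on_has_deriv[OF k]] DERIV_isCont[OF bump_on_has_deriv[OF l]])
      show "AE w in lborel. norm (k (fst (x n) - fst w) * l (snd (x n) - snd w) * u w) \<le> C * D * \<bar>u w\<bar>" for n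
        using C D by (auto simp: abs_mult intro!: mult_mono)
    qed (use u conv_integrable[OF u k l] in \<open>auto intro!: borel_measurable_integrable\<close>)
  qed
  then show ?thesis by (intro continuous_at_imp_continuous_on) auto
qed

subsection \<open>Mollifying functions that are continuous near a square\<close>

text \<open>The square that carries the kernel when both factors are supported in \<open>[-\<delta>,
  \<delta>]\<close>.\<close>

definition sq :: "real \<times> real \<Rightarrow> real \<Rightarrow> (real \<times> real) set" where
  "sq z \<delta> = {fst z - \<delta>..fst z + \<delta>} \<times> {snd z - \<delta>..snd z + \<delta>}"

lemma sq_iff: "w \<in> sq z \<delta> \<longleftrightarrow> \<bar>fst w - fst z\<bar> \<le> \<delta> \<and> \<bar>snd w - snd z\<bar> \<le> \<delta>"
  by (cases w) (auto simp: sq_def)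

lemma compact_sq: "compact (sq z \<delta>)"
  by (simp add: sq_def compact_Times)

lemma sq_shift: "w + h \<in> sq (z + h) \<delta> \<longleftrightarrow> w \<in> sq z \<delta>"
  by (simp add: sq_iff)

lemma dist_pair_le: "dist z w \<le> \<bar>fst z - fst w\<bar> + \<bar>snd z - snd w\<bar>" for z w :: "real \<times> real"
  by (simp add: dist_prod_def dist_real_def sqrt_sum_squares_le_sum_abs)

lemma compact_open_sq:
  assumes "compact C" "open A" "C \<subseteq> A"
  obtains e where "e > 0" "\<And>z. z \<in> C \<Longrightarrow> sq z e \<subseteq> A"
proof -
  obtain e where e: "e > 0" "(\<Union>x\<in>C. cball x e) \<subseteq> A"
    using compact_subset_open_imp_cball_epsilon_subset[OF assms] by blast
  show ?thesis
  proof
    show "e / 2 > 0" using e by simp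
    show "sq z (e / 2) \<subseteq> A" if "z \<in> C" for z
    proof
      fix w assume "w \<in> sq z (e / 2)"
      then have "dist z w \<le> e" using dist_pair_le[of z w]
        by (simp add: sq_iff abs_minus_commute[of "fst w"] abs_minus_commute[of "snd w"])
      then show "w \<in> A" using that by (intro subsetD[OF e(2)] UN_I[of z]) auto
    qed
  qed
qed

lemma open_contains_sq:
  assumes "open A" "z \<in> A"
  obtains e where "e > 0" "sq z e \<subseteq> A"
proof -
  have "compact {z}" "{z} \<subseteq> A" using assms(2) by auto
  then obtain e where "e > 0" "\<And>w. w \<in> {z} \<Longrightarrow> sq w e \<subseteq> A"
    using compact_open_sq[OF _ assms(1), of "{z}"] by metis
  then show ?thesis using that[of e] by simp
qed

lemma sq_enlarge:
  assumes "open A" "sq z \<delta> \<subseteq> A"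
  obtains e where "e > 0" "sq z (\<delta> + e) \<subseteq> A"
proof (cases "\<delta> \<ge> 0")
  case True
  obtain e where e: "e > 0" "\<And>w. w \<in> sq z \<delta> \<Longrightarrow> sq w e \<subseteq> A"
    using compact_open_sq[OF compact_sq assms] by blast
  have "sq z (\<delta> + e) \<subseteq> A"
  proof
    fix w assume w: "w \<in> sq z (\<delta> + e)"
    define w' where "w' = (max (fst z - \<delta>) (min (fst w) (fst z + \<delta>)), max (snd z - \<delta>) (min (snd w) (snd z + \<delta>)))"
    have "w' \<in> sq z \<delta>" using True by (auto simp: w'_def sq_iff)
    moreover have "w \<in> sq w' e" using w True e(1) by (auto simp: w'_def sq_iff max_def min_def)
    ultimately show "w \<in> A" using e(2) by blast
  qed
  then show ?thesis using that e by blast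
next
  case False
  then have "sq z (\<delta> + (- \<delta> / 2)) \<subseteq> A" by (auto simp: sq_def)
  then show ?thesis using that[of "- \<delta> / 2"] False by simp
qed

lemma kernel_zero_outside_sq:
  assumes k: "k \<in> bump_on (-\<delta>) \<delta>" and l: "l \<in> bump_on (-\<delta>) \<delta>" and w: "w \<notin> sq z \<delta>"
  shows "k (fst z - fst w) * l (snd z - snd w) = 0"
proof -
  have "fst z - fst w \<notin> {-\<delta>..\<delta>} \<or> snd z - snd w \<notin> {-\<delta>..\<delta>}"
    using w by (simp add: sq_iff) linarith
  then show ?thesis using bump_on_zero[OF k] bump_on_zero[OF l] by auto
qed

text \<open>The values of \<open>u\<close> outside the square do not matter, so a function that is only
  defined on an open set can be mollified wherever the square fits into the set.\<close>

lemma conv_localize: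
  assumes k: "k \<in> bump_on (-\<delta>) \<delta>" and l: "l \<in> bump_on (-\<delta>) \<delta>" and B: "sq z \<delta> \<subseteq> B"
  shows "conv k l u z = conv k l (\<lambda>w. indicator B w * u w) z"
  unfolding conv_def
proof (rule Bochner_Integration.integral_cong[OF refl])
  fix w
  show "k (fst z - fst w) * l (snd z - snd w) * u w = k (fst z - fst w) * l (snd z - snd w) * (indicator B w * u w)"
  proof (cases "w \<in> sq z \<delta>")
    case True
    then show ?thesis using B by auto
  next
    case False
    then show ?thesis using kernel_zero_outside_sq[OF k l] by simp
  qed
qed

lemma integrable_indicator_continuous:
  fixes u :: "real \<times> real \<Rightarrow> real"
  assumes "compact B" "continuous_on B u"
  shows "integrable lborel (\<lambda>w. indicator B w * u w)"
  using borel_integrable_compact[OF assms] by simp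

context
  fixes k l :: "real \<Rightarrow> real" and \<delta> :: real and A and u :: "real \<times> real \<Rightarrow> real" and z
  assumes k: "k \<in> bump_on (-\<delta>) \<delta>" and l: "l \<in> bump_on (-\<delta>) \<delta>"
    and A: "open A" and u: "continuous_on A u" and z: "sq z \<delta> \<subseteq> A"
begin

lemma conv_near:
  obtains u' e where "integrable lborel u'" "e > 0"
    "\<And>z' k l. z' \<in> sq z e \<Longrightarrow> k \<in> bump_on (-\<delta>) \<delta> \<Longrightarrow> l \<in> bump_on (-\<delta>) \<delta> \<Longrightarrow> conv k l u z' = conv k l u' z'"
proof -
  obtain e where e: "e > 0" "sq z (\<delta> + e) \<subseteq> A" using sq_enlarge[OF A z] by blast
  show ?thesis
  proof
    show "integrable lborel (\<lambda>w. indicator (sq z (\<delta> + e)) w * u w)"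
      by (intro integrable_indicator_continuous compact_sq continuous_on_subset[OF u] e)
    show "e > 0" by fact
    fix z' k l assume "z' \<in> sq z e" "k \<in> bump_on (-\<delta>) \<delta>" "l \<in> bump_on (-\<delta>) \<delta>"
    moreover from this have "sq z' \<delta> \<subseteq> sq z (\<delta> + e)" by (auto simp: sq_iff)
    ultimately show "conv k l u z' = conv k l (\<lambda>w. indicator (sq z (\<delta> + e)) w * u w) z'"
      by (intro conv_localize)
  qed
qed

lemma conv_local_deriv_fst:
  "((\<lambda>y. conv k l u (y, snd z)) has_real_derivative conv (deriv k) l u z) (at (fst z))"
proof -
  obtain u' e where u': "integrable lborel u'" "e > 0" and
    eq: "\<And>z' k l. z' \<in> sq z e \<Longrightarrow> k \<in> bump_on (-\<delta>) \<delta> \<Longrightarrow> l \<in> bump_on (-\<delta>) \<delta> \<Longrightarrow> conv k l u z' = conv k l u' z'"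
    using conv_near by blast
  have "((\<lambda>y. conv k l u' (y, snd z)) has_real_derivative conv (deriv k) l u' (fst z, snd z)) (at (fst z))"
    by (rule conv_has_deriv_fst[OF u'(1) k l])
  moreover have "conv (deriv k) l u' (fst z, snd z) = conv (deriv k) l u z"
    using eq[of z, OF _ bump_on_deriv[OF k] l] u' by (simp add: sq_iff)
  ultimately have "((\<lambda>y. conv k l u' (y, snd z)) has_real_derivative conv (deriv k) l u z) (at (fst z))" by simp
  then show ?thesis
    by (rule has_field_derivative_transform_within_open[of _ _ _ "{fst z - e<..<fst z + e}"])
      (use u' in \<open>auto simp: eq[OF _ k l] sq_iff\<close>)
qed

lemma conv_local_deriv_snd:
  "((\<lambda>s. conv k l u (fst z, s)) has_real_derivative conv k (deriv l) u z) (at (snd z))"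
proof -
  obtain u' e where u': "integrable lborel u'" "e > 0" and
    eq: "\<And>z' k l. z' \<in> sq z e \<Longrightarrow> k \<in> bump_on (-\<delta>) \<delta> \<Longrightarrow> l \<in> bump_on (-\<delta>) \<delta> \<Longrightarrow> conv k l u z' = conv k l u' z'"
    using conv_near by blast
  have "((\<lambda>s. conv k l u' (fst z, s)) has_real_derivative conv k (deriv l) u' (fst z, snd z)) (at (snd z))"
    by (rule conv_has_deriv_snd[OF u'(1) k l])
  moreover have "conv k (deriv l) u' (fst z, snd z) = conv k (deriv l) u z"
    using eq[of z, OF _ k bump_on_deriv[OF l]] u' by (simp add: sq_iff)
  ultimately have "((\<lambda>s. conv k l u' (fst z, s)) has_real_derivative conv k (deriv l) u z) (at (snd z))" by simp
  then show ?thesis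
    by (rule has_field_derivative_transform_within_open[of _ _ _ "{snd z - e<..<snd z + e}"])
      (use u' in \<open>auto simp: eq[OF _ k l] sq_iff\<close>)
qed

lemma conv_local_continuous: "continuous (at z) (conv k l u)"
proof -
  obtain u' e where u': "integrable lborel u'" "e > 0" and
    eq: "\<And>z' k l. z' \<in> sq z e \<Longrightarrow> k \<in> bump_on (-\<delta>) \<delta> \<Longrightarrow> l \<in> bump_on (-\<delta>) \<delta> \<Longrightarrow> conv k l u z' = conv k l u' z'"
    using conv_near by blast
  have "continuous (at z) (conv k l u')"
    using conv_continuous[OF u'(1) k l, of UNIV] by (simp only: continuous_on_eq_continuous_at[OF open_UNIV] UNIV_I simp_thms)
  moreover have "\<forall>\<^sub>F z' in nhds z. conv k l u' z' = conv k l u z'"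
    unfolding eventually_nhds
  proof (intro exI[of _ "{fst z - e<..<fst z + e} \<times> {snd z - e<..<snd z + e}"] conjI ballI)
    fix z' assume "z' \<in> {fst z - e<..<fst z + e} \<times> {snd z - e<..<snd z + e}"
    then have "z' \<in> sq z e" by (auto simp: sq_iff)
    then show "conv k l u' z' = conv k l u z'" using eq[OF _ k l] by simp
  qed (use u' in \<open>auto simp: open_Times mem_Times_iff\<close>)
  ultimately show ?thesis by (simp add: isCont_cong)
qed

end

lemma conv_local_integrable:
  assumes k: "k \<in> bump_on (-\<delta>) \<delta>" and l: "l \<in> bump_on (-\<delta>) \<delta>" and u: "continuous_on (sq z \<delta>) u"
  shows "integrable lborel (\<lambda>w. k (fst z - fst w) * l (snd z - snd w) * u w)"
proof -
  have "integrable lborel (\<lambda>w. k (fst z - fst w) * l (snd z - snd w) * (indicator (sq z \<delta>) w * u w))"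
    by (intro conv_integrable[OF _ k l] integrable_indicator_continuous compact_sq u)
  moreover have "k (fst z - fst w) * l (snd z - snd w) * (indicator (sq z \<delta>) w * u w) =
      k (fst z - fst w) * l (snd z - snd w) * u w" for w
    using kernel_zero_outside_sq[OF k l, of w z] by (cases "w \<in> sq z \<delta>") auto
  ultimately show ?thesis by simp
qed

lemma conv_diff:
  assumes k: "k \<in> bump_on (-\<delta>) \<delta>" and l: "l \<in> bump_on (-\<delta>) \<delta>"
    and u: "continuous_on (sq z \<delta>) u" "continuous_on (sq z \<delta>) v"
  shows "conv k l (\<lambda>w. u w - v w) z = conv k l u z - conv k l v z"
  unfolding conv_def using conv_local_integrable[OF k l u(1)] conv_local_integrable[OF k l u(2)]
  by (simp add: right_diff_distrib)

lemma conv_minus: "conv k l (\<lambda>w. - u w) z = - conv k l u z"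
  by (simp add: conv_def)

lemma conv_shift:
  assumes k: "k \<in> bump_on (-\<delta>) \<delta>" and l: "l \<in> bump_on (-\<delta>) \<delta>"
    and u: "continuous_on (sq (z + h) \<delta>) u"
  shows "conv k l (\<lambda>w. u (w + h)) z = conv k l u (z + h)"
proof -
  let ?f = "\<lambda>w. k (fst (z + h) - fst w) * l (snd (z + h) - snd w) * u w"
  have m: "?f \<in> borel_measurable borel"
    using borel_measurable_integrable[OF conv_local_integrable[OF k l u]] by (simp only: measurable_lborel2)
  have "(LINT w|lborel. ?f w) = (LINT w|distr lborel borel ((+) h). ?f w)"
    by (simp add: lborel_distr_plus)
  also have "\<dots> = (LINT w|lborel. ?f (h + w))"
    by (rule integral_distr[OF _ m]) simp
  finally show ?thesis
    by (simp add: conv_def algebra_simps)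
qed

lemma integral_product_lborel:
  fixes f g :: "real \<Rightarrow> real"
  assumes "integrable lborel (\<lambda>w. f (fst w) * g (snd w))"
  shows "(LINT w|lborel. f (fst w) * g (snd w)) = (LINT x|lborel. f x) * (LINT y|lborel. g y)"
proof -
  have "integrable (lborel \<Otimes>\<^sub>M lborel) (\<lambda>w. f (fst w) * g (snd w))"
    using assms by (simp add: lborel_prod)
  from lborel_pair.integral_fst'[OF this] show ?thesis
    by (simp add: lborel_prod)
qed

lemma moll_reflect_integral:
  assumes "\<delta> > 0"
  shows "(LINT x|lborel. moll \<delta> (y - x)) = 1"
proof -
  have "(LINT x|lborel. moll \<delta> x) = \<bar>-1\<bar> *\<^sub>R (LINT x|lborel. moll \<delta> (y + -1 * x))"
    by (rule lborel_integral_real_affine) simp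
  then show ?thesis using moll_integral[OF assms] by simp
qed

lemma conv_moll_const:
  assumes "\<delta> > 0"
  shows "conv (moll \<delta>) (moll \<delta>) (\<lambda>w. c) z = c"
proof -
  have "integrable lborel (\<lambda>w. moll \<delta> (fst z - fst w) * moll \<delta> (snd z - snd w))"
    using conv_local_integrable[OF moll_bump moll_bump, of \<delta> z "\<lambda>w. 1"] assms by simp
  from integral_product_lborel[OF this] show ?thesis
    using moll_reflect_integral[OF assms] by (simp add: conv_def)
qed

lemma conv_moll_mono:
  assumes \<delta>: "\<delta> > 0" and u: "continuous_on (sq z \<delta>) u" "continuous_on (sq z \<delta>) v"
    and le: "\<And>w. w \<in> sq z \<delta> \<Longrightarrow> u w \<le> v w"
  shows "conv (moll \<delta>) (moll \<delta>) u z \<le> conv (moll \<delta>) (moll \<delta>) v z"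
  unfolding conv_def
proof (rule integral_mono)
  fix w
  show "moll \<delta> (fst z - fst w) * moll \<delta> (snd z - snd w) * u w \<le> moll \<delta> (fst z - fst w) * moll \<delta> (snd z - snd w) * v w"
  proof (cases "w \<in> sq z \<delta>")
    case True
    then show ?thesis using le moll_nonneg[OF \<delta>] by (intro mult_left_mono) auto
  next
    case False
    then show ?thesis
      unfolding kernel_zero_outside_sq[OF moll_bump[OF \<delta>] moll_bump[OF \<delta>] False] by simp
  qed
qed (use conv_local_integrable[OF moll_bump moll_bump] u \<delta> in auto)

section \<open>The maximum principle\<close>

text \<open>The operator \<open>- \<partial>\<^sub>s - a \<partial>\<^sub>y\<^sub>y - b \<partial>\<^sub>y +
  r\<close> applied to the mollification of \<open>u\<close>, with all derivatives moved to the
  kernel.\<close>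

definition conv_op :: "real \<Rightarrow> real \<Rightarrow> real \<Rightarrow> real \<Rightarrow> (real \<times> real \<Rightarrow> real) \<Rightarrow> real \<times> real \<Rightarrow> real" where
  "conv_op a b r \<delta> u z =
     - conv (moll \<delta>) (deriv (moll \<delta>)) u z - a * conv (deriv (deriv (moll \<delta>))) (moll \<delta>) u z
     - b * conv (deriv (moll \<delta>)) (moll \<delta>) u z + r * conv (moll \<delta>) (moll \<delta>) u z"

lemma conv_op_diff:
  assumes "\<delta> > 0" "continuous_on (sq z \<delta>) u" "continuous_on (sq z \<delta>) v"
  shows "conv_op a b r \<delta> (\<lambda>w. u w - v w) z = conv_op a b r \<delta> u z - conv_op a b r \<delta> v z"
proof -
  note m = moll_bump[OF assms(1)]
  show ?thesis
    unfolding conv_op_def conv_diff[OF m bump_on_deriv[OF m] assms(2,3)] conv_diff[OF bump_on_deriv[OF bump_on_deriv[OF m]] m assms(2,3)]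
      conv_diff[OF bump_on_deriv[OF m] m assms(2,3)] conv_diff[OF m m assms(2,3)]
    by (simp add: algebra_simps)
qed

lemma conv_op_minus: "conv_op a b r \<delta> (\<lambda>w. - u w) z = - conv_op a b r \<delta> u z"
  by (simp add: conv_op_def conv_minus)

lemma conv_op_shift:
  assumes "\<delta> > 0" "continuous_on (sq (z + h) \<delta>) u"
  shows "conv_op a b r \<delta> (\<lambda>w. u (w + h)) z = conv_op a b r \<delta> u (z + h)"
proof -
  note m = moll_bump[OF assms(1)]
  show ?thesis
    unfolding conv_op_def conv_shift[OF m bump_on_deriv[OF m] assms(2)] conv_shift[OF bump_on_deriv[OF bump_on_deriv[OF m]] m assms(2)]
      conv_shift[OF bump_on_deriv[OF m] m assms(2)] conv_shift[OF m m assms(2)] ..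
qed

text \<open>The inequality \<open>Lu \<ge> k\<close> in the sense of distributions on \<open>A\<close>. It
  is stated for mollifications only, which is the form that the maximum principle uses and that is
  inherited by translates and differences.\<close>

definition weak_super :: "real \<Rightarrow> real \<Rightarrow> real \<Rightarrow> (real \<times> real) set \<Rightarrow> (real \<times> real \<Rightarrow> real) \<Rightarrow> real \<Rightarrow> bool" where
  "weak_super a b r A u k \<longleftrightarrow> (\<forall>z \<delta>. \<delta> > 0 \<longrightarrow> sq z \<delta> \<subseteq> A \<longrightarrow> conv_op a b r \<delta> u z \<ge> k)"

text \<open>The inequality \<open>L\<psi> \<ge> k\<close> for barriers, in the classical sense.\<close>

definition classical_super :: "real \<Rightarrow> real \<Rightarrow> real \<Rightarrow> (real \<times> real) set \<Rightarrow> (real \<times> real \<Rightarrow> real) \<Rightarrow> real \<Rightarrow> bool" where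
  "classical_super a b r A \<psi> k \<longleftrightarrow> (\<exists>\<psi>y \<psi>yy \<psi>s. \<forall>y s. (y, s) \<in> A \<longrightarrow>
     ((\<lambda>y. \<psi> (y, s)) has_real_derivative \<psi>y (y, s)) (at y) \<and>
     ((\<lambda>y. \<psi>y (y, s)) has_real_derivative \<psi>yy (y, s)) (at y) \<and>
     ((\<lambda>s. \<psi> (y, s)) has_real_derivative \<psi>s (y, s)) (at s) \<and>
     - \<psi>s (y, s) - a * \<psi>yy (y, s) - b * \<psi>y (y, s) + r * \<psi> (y, s) \<ge> k)"

lemma classical_superI:
  fixes \<psi> \<psi>y \<psi>yy \<psi>s :: "real \<Rightarrow> real \<Rightarrow> real"
  assumes "\<And>y s. (y, s) \<in> A \<Longrightarrow> ((\<lambda>y. \<psi> y s) has_real_derivative \<psi>y y s) (at y)"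
    "\<And>y s. (y, s) \<in> A \<Longrightarrow> ((\<lambda>y. \<psi>y y s) has_real_derivative \<psi>yy y s) (at y)"
    "\<And>y s. (y, s) \<in> A \<Longrightarrow> ((\<lambda>s. \<psi> y s) has_real_derivative \<psi>s y s) (at s)"
    "\<And>y s. (y, s) \<in> A \<Longrightarrow> - \<psi>s y s - a * \<psi>yy y s - b * \<psi>y y s + r * \<psi> y s \<ge> k"
  shows "classical_super a b r A (\<lambda>z. \<psi> (fst z) (snd z)) k"
  unfolding classical_super_def
  by (rule exI[of _ "\<lambda>z. \<psi>y (fst z) (snd z)"], rule exI[of _ "\<lambda>z. \<psi>yy (fst z) (snd z)"],
      rule exI[of _ "\<lambda>z. \<psi>s (fst z) (snd z)"]) (use assms in simp)

lemma classical_super_add: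
  assumes "classical_super a b r A f k" "classical_super a b r A g l"
  shows "classical_super a b r A (\<lambda>z. f z + g z) (k + l)"
proof -
  obtain fy fyy fs where f: "\<And>y s. (y, s) \<in> A \<Longrightarrow>
     ((\<lambda>y. f (y, s)) has_real_derivative fy (y, s)) (at y) \<and>
     ((\<lambda>y. fy (y, s)) has_real_derivative fyy (y, s)) (at y) \<and>
     ((\<lambda>s. f (y, s)) has_real_derivative fs (y, s)) (at s) \<and>
     - fs (y, s) - a * fyy (y, s) - b * fy (y, s) + r * f (y, s) \<ge> k"
    using assms(1) unfolding classical_super_def by blast
  obtain gy gyy gs where g: "\<And>y s. (y, s) \<in> A \<Longrightarrow>
     ((\<lambda>y. g (y, s)) has_real_derivative gy (y, s)) (at y) \<and>
     ((\<lambda>y. gy (y, s)) has_real_derivative gyy (y, s)) (at y) \<and>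
     ((\<lambda>s. g (y, s)) has_real_derivative gs (y, s)) (at s) \<and>
     - gs (y, s) - a * gyy (y, s) - b * gy (y, s) + r * g (y, s) \<ge> l"
    using assms(2) unfolding classical_super_def by blast
  have "- (fs z + gs z) - a * (fyy z + gyy z) - b * (fy z + gy z) + r * (f z + g z) \<ge> k + l"
    if "z \<in> A" for z
    using f[of "fst z" "snd z"] g[of "fst z" "snd z"] that by (simp add: algebra_simps)
  then show ?thesis
    unfolding classical_super_def
    by (intro exI[of _ "\<lambda>z. fy z + gy z"] exI[of _ "\<lambda>z. fyy z + gyy z"] exI[of _ "\<lambda>z. fs z + gs z"] allI impI conjI)
      (use f g in \<open>auto intro!: DERIV_add\<close>)
qed

lemma second_derivative_nonneg_at_min:
  fixes f :: "real \<Rightarrow> real"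
  assumes d: "d > 0" and f: "\<And>y. \<bar>y - x\<bar> < d \<Longrightarrow> (f has_real_derivative f' y) (at y)"
    and f': "(f' has_real_derivative f'') (at x)"
    and min: "\<And>y. \<bar>y - x\<bar> < d \<Longrightarrow> f x \<le> f y"
  shows "f' x = 0" "f'' \<ge> 0"
proof -
  show 0: "f' x = 0"
    by (rule DERIV_local_min[OF f d]) (use d min in \<open>auto simp: abs_minus_commute\<close>)
  show "f'' \<ge> 0"
  proof (rule ccontr)
    assume "\<not> f'' \<ge> 0"
    then obtain e where e: "e > 0" "\<And>h. 0 < h \<Longrightarrow> h < e \<Longrightarrow> f' (x + h) < f' x"
      using DERIV_neg_dec_right[OF f'] by auto
    define h where "h = min d e / 2"
    have h: "0 < h" "h < d" "h < e" using d e by (auto simp: h_def min_def)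
    have "\<exists>z>x. z < x + h \<and> f (x + h) - f x = (x + h - x) * f' z"
      by (rule MVT2) (use h in \<open>auto intro!: f\<close>)
    then obtain z where z: "x < z" "z < x + h" "f (x + h) - f x = h * f' z" by auto
    then have "f' z < 0" using e(2)[of "z - x"] h 0 by simp
    then have "f (x + h) < f x" using z h by (simp add: mult_pos_neg algebra_simps)
    moreover have "f x \<le> f (x + h)" using min[of "x + h"] h by simp
    ultimately show False by simp
  qed
qed

text \<open>Suppose that the sum is negative somewhere. On the compact sublevel set the mollification of
  \<open>u\<close> is uniformly close to \<open>u\<close>, so its sum with \<open>\<psi>\<close>
  has a negative minimum in the interior of that set. There the first derivatives vanish and the
  second derivative is nonnegative, so \<open>L\<close> of the sum is at most \<open>r\<close>
  times a negative number, contradicting \<open>L \<ge> k - k\<close>.\<close>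

lemma weak_maximum_principle:
  assumes r: "r > 0" and a: "a \<ge> 0" and A: "open A" and u: "continuous_on A u"
    and sup: "weak_super a b r A u k"
    and \<psi>: "continuous_on A \<psi>" "classical_super a b r A \<psi> (- k)"
    and compact: "\<And>\<eta>. \<eta> > 0 \<Longrightarrow> compact {z \<in> A. u z + \<psi> z \<le> - \<eta>}"
    and z: "z \<in> A"
  shows "u z + \<psi> z \<ge> 0"
proof (rule ccontr)
  assume "\<not> u z + \<psi> z \<ge> 0"
  define \<eta> where "\<eta> = - (u z + \<psi> z) / 3"
  have \<eta>: "\<eta> > 0" "u z + \<psi> z = - 3 * \<eta>" using \<open>\<not> u z + \<psi> z \<ge> 0\<close> by (auto simp: \<eta>_def)
  define C where "C = {z \<in> A. u z + \<psi> z \<le> - \<eta>}"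
  have C: "compact C" "C \<subseteq> A" "z \<in> C" using compact[OF \<eta>(1)] z \<eta> by (auto simp: C_def)
  obtain \<psi>y \<psi>yy \<psi>s where D: "\<And>y s. (y, s) \<in> A \<Longrightarrow>
     ((\<lambda>y. \<psi> (y, s)) has_real_derivative \<psi>y (y, s)) (at y) \<and>
     ((\<lambda>y. \<psi>y (y, s)) has_real_derivative \<psi>yy (y, s)) (at y) \<and>
     ((\<lambda>s. \<psi> (y, s)) has_real_derivative \<psi>s (y, s)) (at s) \<and>
     - \<psi>s (y, s) - a * \<psi>yy (y, s) - b * \<psi>y (y, s) + r * \<psi> (y, s) \<ge> - k"
    using \<psi>(2) unfolding classical_super_def by blast
  obtain e where e: "e > 0" "\<And>z. z \<in> C \<Longrightarrow> sq z e \<subseteq> A"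
    using compact_open_sq[OF C(1) A C(2)] by blast
  \<comment> \<open>Uniform continuity of \<open>u\<close> near \<open>C\<close>, which bounds the mollification error on \<open>C\<close> by \<open>\<eta> / 2\<close>.\<close>
  have "\<exists>d>0. \<forall>x\<in>C. \<forall>w\<in>A. dist w x < d \<longrightarrow> dist (u w) (u x) < \<eta> / 2"
  proof -
    have "\<exists>d>0. \<forall>w. dist w x < d \<longrightarrow> w \<in> A \<and> dist (u w) (u x) < \<eta> / 4" if xC: "x \<in> C" for x
    proof -
      have "continuous (at x) u" using u A C xC continuous_on_eq_continuous_at by blast
      then obtain d1 where "d1 > 0" "\<forall>w. dist w x < d1 \<longrightarrow> dist (u w) (u x) < \<eta> / 4"
        unfolding continuous_at_eps_delta using \<eta>(1) by (metis zero_less_divide_iff zero_less_numeral)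
      moreover obtain d2 where "d2 > 0" "\<forall>w. dist w x < d2 \<longrightarrow> w \<in> A"
        using A C(2) xC unfolding open_dist by blast
      ultimately show ?thesis by (intro exI[of _ "min d1 d2"]) auto
    qed
    then obtain d where d: "\<And>x. x \<in> C \<Longrightarrow> d x > 0" "\<And>x w. x \<in> C \<Longrightarrow> dist w x < d x \<Longrightarrow> w \<in> A \<and> dist (u w) (u x) < \<eta> / 4"
      by metis
    have "C \<subseteq> (\<Union>x\<in>C. ball x (d x))" using d(1) by auto
    then obtain e where e: "e > 0" "\<And>x. x \<in> C \<Longrightarrow> \<exists>G\<in>(\<lambda>x. ball x (d x)) ` C. ball x e \<subseteq> G"
      using Heine_Borel_lemma[OF C(1), of "(\<lambda>x. ball x (d x)) ` C"] by blast
    show ?thesis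
    proof (intro exI[of _ e] conjI ballI impI e(1))
      fix x w assume xw: "x \<in> C" "w \<in> A" "dist w x < e"
      obtain x' where x': "x' \<in> C" "ball x e \<subseteq> ball x' (d x')" using e(2)[OF xw(1)] by auto
      have "w \<in> ball x e" "x \<in> ball x e"
        using xw e(1) by (auto simp: dist_commute)
      then have "w \<in> ball x' (d x')" "x \<in> ball x' (d x')"
        using x'(2) by blast+
      then have "dist (u w) (u x') < \<eta> / 4" "dist (u x) (u x') < \<eta> / 4"
        using d(2)[OF x'(1), of w] d(2)[OF x'(1), of x] by (simp_all add: dist_commute)
      then show "dist (u w) (u x) < \<eta> / 2"
        using dist_triangle2[of "u w" "u x" "u x'"] by linarith
    qed
  qed
  then obtain d where d: "d > 0" "\<And>x w. x \<in> C \<Longrightarrow> w \<in> A \<Longrightarrow> dist w x < d \<Longrightarrow> dist (u w) (u x) < \<eta> / 2"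
    by blast
  define \<delta> where "\<delta> = min (e / 2) (d / 4)"
  have \<delta>: "\<delta> > 0" "2 * \<delta> \<le> e" "4 * \<delta> \<le> d" using e d by (auto simp: \<delta>_def)
  define m where "m = conv (moll \<delta>) (moll \<delta>) u"
  note mb = moll_bump[OF \<delta>(1)]
  have sqA: "sq w \<delta> \<subseteq> A" if "x \<in> C" "w \<in> sq x \<delta>" for x w
  proof -
    have "sq w \<delta> \<subseteq> sq x e" using that(2) \<delta> by (fastforce simp: sq_iff)
    then show ?thesis using e(2)[OF that(1)] by blast
  qed
  have sqC: "sq w \<delta> \<subseteq> A" if "w \<in> C" for w using sqA[OF that, of w] \<delta> by (simp add: sq_iff)
  have close: "\<bar>m w - u w\<bar> \<le> \<eta> / 2" if w: "w \<in> C" for w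
  proof -
    have cont: "continuous_on (sq w \<delta>) u" using u sqC[OF w] by (rule continuous_on_subset)
    have near: "u x \<le> u w + \<eta> / 2 \<and> u w - \<eta> / 2 \<le> u x" if "x \<in> sq w \<delta>" for x
    proof -
      have "dist x w \<le> 2 * \<delta>" using that dist_pair_le[of x w] by (simp add: sq_iff)
      then have "dist (u x) (u w) < \<eta> / 2" using that sqC[OF w] \<delta> by (intro d(2)[OF w]) auto
      then show ?thesis unfolding dist_real_def by linarith
    qed
    have "m w \<le> u w + \<eta> / 2"
    proof -
      have "m w \<le> conv (moll \<delta>) (moll \<delta>) (\<lambda>x. u w + \<eta> / 2) w"
        unfolding m_def by (rule conv_moll_mono[OF \<delta>(1) cont continuous_on_const]) (use near in blast)
      then show ?thesis by (simp only: conv_moll_const[OF \<delta>(1)])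
    qed
    moreover have "u w - \<eta> / 2 \<le> m w"
    proof -
      have "conv (moll \<delta>) (moll \<delta>) (\<lambda>x. u w - \<eta> / 2) w \<le> m w"
        unfolding m_def by (rule conv_moll_mono[OF \<delta>(1) continuous_on_const cont]) (use near in blast)
      then show ?thesis by (simp only: conv_moll_const[OF \<delta>(1)])
    qed
    ultimately show ?thesis by linarith
  qed
  have "continuous_on C m"
    unfolding m_def using conv_local_continuous[OF mb mb A u sqC]
    by (intro continuous_at_imp_continuous_on) auto
  then have "continuous_on C (\<lambda>w. m w + \<psi> w)"
    by (intro continuous_on_add continuous_on_subset[OF \<psi>(1) C(2)])
  then obtain z0 where z0: "z0 \<in> C" "\<And>w. w \<in> C \<Longrightarrow> m z0 + \<psi> z0 \<le> m w + \<psi> w"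
    using continuous_attains_inf[OF C(1), of "\<lambda>w. m w + \<psi> w"] C(3) by blast
  have neg: "m z0 + \<psi> z0 \<le> - 5 / 2 * \<eta>"
    using z0(2)[OF C(3)] close[OF C(3)] \<eta>(2) by linarith
  then have "u z0 + \<psi> z0 < - \<eta>" using close[OF z0(1)] \<eta>(1) by linarith
  moreover have "open {w \<in> A. u w + \<psi> w < - \<eta>}"
  proof -
    have "open (A \<inter> (\<lambda>w. u w + \<psi> w) -` {..< - \<eta>})"
      by (rule continuous_open_preimage[OF _ A]) (auto intro!: continuous_on_add u \<psi>(1))
    then show ?thesis by (simp add: vimage_def Int_def lessThan_def)
  qed
  ultimately obtain d0 where d0: "d0 > 0" "sq z0 d0 \<subseteq> {w \<in> A. u w + \<psi> w < - \<eta>}"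
    using compact_open_sq[of "{z0}" "{w \<in> A. u w + \<psi> w < - \<eta>}"] z0(1) C(2) by auto
  define d1 where "d1 = min d0 \<delta>"
  have d1: "d1 > 0" "d1 \<le> d0" "d1 \<le> \<delta>" using d0 \<delta> by (auto simp: d1_def)
  obtain y0 s0 where z0': "z0 = (y0, s0)" by (cases z0)
  have inC: "w \<in> C" if "w \<in> sq z0 d1" for w
  proof -
    have "w \<in> sq z0 d0" using that d1 by (auto simp: sq_iff)
    then show ?thesis using d0 by (force simp: C_def)
  qed
  have ysl: "(y, s0) \<in> C" if "\<bar>y - y0\<bar> < d1" for y
    using that d1 by (intro inC) (auto simp: sq_iff z0')
  have ssl: "(y0, s) \<in> C" if "\<bar>s - s0\<bar> < d1" for s
    using that d1 by (intro inC) (auto simp: sq_iff z0')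
  have Dy: "((\<lambda>y. m (y, s0) + \<psi> (y, s0)) has_real_derivative
      conv (deriv (moll \<delta>)) (moll \<delta>) u (y, s0) + \<psi>y (y, s0)) (at y)" if "\<bar>y - y0\<bar> < d1" for y
    using conv_local_deriv_fst[OF mb mb A u sqC[OF ysl[OF that]]] D[of y s0] ysl[OF that] C(2)
    unfolding m_def by (intro DERIV_add) auto
  have Dyy: "((\<lambda>y. conv (deriv (moll \<delta>)) (moll \<delta>) u (y, s0) + \<psi>y (y, s0)) has_real_derivative
      conv (deriv (deriv (moll \<delta>))) (moll \<delta>) u (y0, s0) + \<psi>yy (y0, s0)) (at y0)"
    using conv_local_deriv_fst[OF bump_on_deriv[OF mb] mb A u sqC[OF z0(1)]] D[of y0 s0] z0(1) C(2)
    unfolding z0' by (intro DERIV_add) auto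
  have Ds: "((\<lambda>s. m (y0, s) + \<psi> (y0, s)) has_real_derivative
      conv (moll \<delta>) (deriv (moll \<delta>)) u (y0, s0) + \<psi>s (y0, s0)) (at s0)"
    using conv_local_deriv_snd[OF mb mb A u sqC[OF z0(1)]] D[of y0 s0] z0(1) C(2)
    unfolding m_def z0' by (intro DERIV_add) auto
  have 1: "conv (deriv (moll \<delta>)) (moll \<delta>) u (y0, s0) + \<psi>y (y0, s0) = 0"
    and 2: "conv (deriv (deriv (moll \<delta>))) (moll \<delta>) u (y0, s0) + \<psi>yy (y0, s0) \<ge> 0"
    using second_derivative_nonneg_at_min[OF d1(1) Dy Dyy] z0(2)[OF ysl] unfolding z0' by auto
  have 3: "conv (moll \<delta>) (deriv (moll \<delta>)) u (y0, s0) + \<psi>s (y0, s0) = 0"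
    by (rule DERIV_local_min[OF Ds d1(1)]) (use z0(2)[OF ssl] in \<open>auto simp: z0' abs_minus_commute\<close>)
  have "conv_op a b r \<delta> u z0 \<ge> k"
    using sup sqC[OF z0(1)] \<delta>(1) unfolding weak_super_def by blast
  moreover have "- \<psi>s (y0, s0) - a * \<psi>yy (y0, s0) - b * \<psi>y (y0, s0) + r * \<psi> (y0, s0) \<ge> - k"
    using D[of y0 s0] z0(1) C(2) unfolding z0' by blast
  ultimately have "0 \<le> - (conv (moll \<delta>) (deriv (moll \<delta>)) u (y0, s0) + \<psi>s (y0, s0))
      - a * (conv (deriv (deriv (moll \<delta>))) (moll \<delta>) u (y0, s0) + \<psi>yy (y0, s0))
      - b * (conv (deriv (moll \<delta>)) (moll \<delta>) u (y0, s0) + \<psi>y (y0, s0)) + r * (m z0 + \<psi> z0)"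
    unfolding conv_op_def m_def z0' by (simp add: algebra_simps)
  also have "\<dots> \<le> r * (m z0 + \<psi> z0)" using 1 2 3 a by simp
  also have "\<dots> < 0" using neg r \<eta>(1) by (intro mult_pos_neg) auto
  finally show False by simp
qed

text \<open>The maximum principle on a region that is unbounded as \<open>y\<close> tends to
  \<open>-\<infinity>\<close> and has no data at its lower time \<open>s0\<close>: time runs
  backwards, so \<open>s0\<close> is the end of the evolution. The terms \<open>\<epsilon> / (s -
  s0)\<close> and \<open>\<epsilon> exp (\<Lambda> (s1 - s) - y)\<close> are supersolutions that
  blow up at these two ends and make the sublevel sets compact.\<close>

lemma comparison:
  assumes r: "r > 0" and a: "a \<ge> 0" and A: "open A" "A \<subseteq> R"
    and R: "\<And>z. z \<in> R \<Longrightarrow> s0 < snd z \<and> snd z \<le> s1"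
    and Rc: "\<And>e N. e > 0 \<Longrightarrow> compact (R \<inter> {z. s0 + e \<le> snd z \<and> - N \<le> fst z})"
    and u: "continuous_on R u" and sup: "weak_super a b r A u k"
    and \<psi>: "continuous_on R \<psi>" "classical_super a b r A \<psi> (- k)"
    and bd: "\<And>z. z \<in> R - A \<Longrightarrow> u z + \<psi> z \<ge> 0"
    and lower: "\<And>z. z \<in> R \<Longrightarrow> u z + \<psi> z \<ge> - M"
    and z: "z \<in> R"
  shows "u z + \<psi> z \<ge> 0"
proof (cases "z \<in> A")
  case zA: True
  define \<Lambda> where "\<Lambda> = max 0 (a - b - r)"
  define E where "E y s = 1 / (s - s0) + exp (\<Lambda> * (s1 - s) - y)" for y s
  have ineq: "u z + \<psi> z + \<epsilon> * E (fst z) (snd z) \<ge> 0" if \<epsilon>: "\<epsilon> > 0" for \<epsilon>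
  proof -
    define B where "B z = \<epsilon> * E (fst z) (snd z)" for z
    have Bpos: "B z \<ge> 0" if "z \<in> R" for z using R[OF that] \<epsilon> by (auto simp: B_def E_def)
    have "classical_super a b r A (\<lambda>z. \<epsilon> * E (fst z) (snd z)) 0"
    proof (rule classical_superI[where \<psi> = "\<lambda>y s. \<epsilon> * E y s"])
      fix y s assume ys: "(y, s) \<in> A"
      then have s: "s > s0" using A(2) R by force
      show "((\<lambda>y. \<epsilon> * E y s) has_real_derivative \<epsilon> * - exp (\<Lambda> * (s1 - s) - y)) (at y)"
        "((\<lambda>y. \<epsilon> * - exp (\<Lambda> * (s1 - s) - y)) has_real_derivative \<epsilon> * exp (\<Lambda> * (s1 - s) - y)) (at y)"
        unfolding E_def by (auto intro!: derivative_eq_intros)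
      show "((\<lambda>s. \<epsilon> * E y s) has_real_derivative \<epsilon> * (- 1 / (s - s0)\<^sup>2 - \<Lambda> * exp (\<Lambda> * (s1 - s) - y))) (at s)"
        unfolding E_def using s by (auto intro!: derivative_eq_intros simp: power2_eq_square)
      have "(\<Lambda> - a + b + r) * exp (\<Lambda> * (s1 - s) - y) \<ge> 0" by (auto simp: \<Lambda>_def)
      then have "0 \<le> \<epsilon> * (1 / (s - s0)\<^sup>2 + r / (s - s0) + (\<Lambda> - a + b + r) * exp (\<Lambda> * (s1 - s) - y))"
        using \<epsilon> s r by simp
      also have "\<dots> = - (\<epsilon> * (- 1 / (s - s0)\<^sup>2 - \<Lambda> * exp (\<Lambda> * (s1 - s) - y)))
          - a * (\<epsilon> * exp (\<Lambda> * (s1 - s) - y)) - b * (\<epsilon> * - exp (\<Lambda> * (s1 - s) - y)) + r * (\<epsilon> * E y s)"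
        by (simp add: E_def algebra_simps)
      finally show "0 \<le> - (\<epsilon> * (- 1 / (s - s0)\<^sup>2 - \<Lambda> * exp (\<Lambda> * (s1 - s) - y)))
          - a * (\<epsilon> * exp (\<Lambda> * (s1 - s) - y)) - b * (\<epsilon> * - exp (\<Lambda> * (s1 - s) - y)) + r * (\<epsilon> * E y s)" .
    qed
    from classical_super_add[OF \<psi>(2) this]
    have cl: "classical_super a b r A (\<lambda>z. \<psi> z + B z) (- k)" by (simp add: B_def)
    have "continuous_on R B"
      unfolding B_def E_def using R by (intro continuous_intros) force
    then have cont: "continuous_on R (\<lambda>z. \<psi> z + B z)" by (intro continuous_on_add \<psi>(1))
    have "u z + (\<psi> z + B z) \<ge> 0"
    proof (rule weak_maximum_principle[OF r a A(1) _ sup _ cl _ zA])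
      show "continuous_on A u" "continuous_on A (\<lambda>z. \<psi> z + B z)"
        using A(2) u cont continuous_on_subset by blast+
      fix \<eta> :: real assume \<eta>: "\<eta> > 0"
      define M' where "M' = max M 1"
      have M': "M' > 0" "M \<le> M'" by (auto simp: M'_def)
      let ?K = "R \<inter> {z. s0 + \<epsilon> / M' \<le> snd z \<and> - ln (M' / \<epsilon>) \<le> fst z}"
      have K: "compact ?K" using \<epsilon> M' by (intro Rc) auto
      have "{z \<in> A. u z + (\<psi> z + B z) \<le> - \<eta>} = {z \<in> ?K. u z + (\<psi> z + B z) \<le> - \<eta>}" (is "?L = ?S")
      proof (intro equalityI subsetI)
        fix w assume w: "w \<in> ?L"
        then have wR: "w \<in> R" using A(2) by auto
        have "B w \<le> M'" using w lower[OF wR] \<eta> M' by auto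
        moreover have s: "snd w > s0" "snd w \<le> s1" using R[OF wR] by auto
        moreover have "B w = \<epsilon> / (snd w - s0) + \<epsilon> * exp (\<Lambda> * (s1 - snd w) - fst w)"
          by (simp add: B_def E_def algebra_simps)
        moreover have "\<epsilon> / (snd w - s0) > 0" "\<epsilon> * exp (\<Lambda> * (s1 - snd w) - fst w) > 0" using s \<epsilon> by auto
        ultimately have 1: "\<epsilon> / (snd w - s0) \<le> M'" and 2: "\<epsilon> * exp (\<Lambda> * (s1 - snd w) - fst w) \<le> M'" by linarith+
        have "\<epsilon> / M' \<le> snd w - s0" using 1 s M' by (simp add: field_simps)
        moreover have "- ln (M' / \<epsilon>) \<le> fst w"
        proof -
          have "\<Lambda> * (s1 - snd w) \<ge> 0" using s by (simp add: \<Lambda>_def)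
          then have "exp (- fst w) \<le> exp (\<Lambda> * (s1 - snd w) - fst w)" by simp
          also have "\<dots> \<le> M' / \<epsilon>" using 2 \<epsilon> by (simp add: field_simps)
          finally have "- fst w \<le> ln (M' / \<epsilon>)" using M' \<epsilon> by (simp add: ln_ge_iff)
          then show ?thesis by simp
        qed
        ultimately show "w \<in> ?S" using w wR by auto
      next
        fix w assume w: "w \<in> ?S"
        then have "w \<in> A" using bd[of w] Bpos[of w] \<eta> by (cases "w \<in> A") auto
        then show "w \<in> ?L" using w by auto
      qed
      moreover have "compact ?S"
      proof -
        have "closed ?S"
          by (rule continuous_on_closed_Collect_le)
            (auto intro!: continuous_on_add continuous_on_subset[OF u] continuous_on_subset[OF \<psi>(1)]
              continuous_on_subset[OF \<open>continuous_on R B\<close>] continuous_on_const compact_imp_closed[OF K])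
        then have "compact (?K \<inter> ?S)" by (rule compact_Int_closed[OF K])
        moreover have "?K \<inter> ?S = ?S" by auto
        ultimately show ?thesis by simp
      qed
      ultimately show "compact {z \<in> A. u z + (\<psi> z + B z) \<le> - \<eta>}" by simp
    qed
    then show ?thesis by (simp add: B_def)
  qed
  show ?thesis
  proof (rule ccontr)
    assume neg: "\<not> u z + \<psi> z \<ge> 0"
    define e where "e = E (fst z) (snd z)"
    have "e > 0" using R[OF z] by (auto simp: e_def E_def add_pos_pos)
    define x where "x = - (u z + \<psi> z) / (2 * e)"
    have "x * e = - (u z + \<psi> z) / 2" using \<open>e > 0\<close> by (simp add: x_def)
    moreover have "x > 0" using neg \<open>e > 0\<close> by (simp add: x_def)
    ultimately show False using ineq[of x] neg by (simp add: e_def[symmetric])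
  qed
qed (use bd z in blast)

section \<open>Weak derivatives on level sets\<close>

subsection \<open>Mollification converges in the mean\<close>

text \<open>Fubini's theorem on the product of two copies of the plane.\<close>

lemma conv_moll_integral:
  assumes \<delta>: "\<delta> > 0" and f: "integrable lborel f"
  shows "integrable lborel (conv (moll \<delta>) (moll \<delta>) f)"
    and "(LINT z|lborel. conv (moll \<delta>) (moll \<delta>) f z) = (LINT z|lborel. f z)"
proof -
  note mb = moll_bump[OF \<delta>]
  define \<kappa> where "\<kappa> z w = moll \<delta> (fst z - fst w) * moll \<delta> (snd z - snd w)" for z w :: "real \<times> real"
  have \<kappa>0: "\<kappa> z w \<ge> 0" for z w using moll_nonneg[OF \<delta>] by (simp add: \<kappa>_def)
  have even: "moll \<delta> (- x) = moll \<delta> x" for x by (simp add: moll_def bump0_def mult.commute)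
  have sym: "\<kappa> z w = \<kappa> w z" for z w
    using even[of "fst z - fst w"] even[of "snd z - snd w"] by (simp add: \<kappa>_def)
  have i\<kappa>: "integrable lborel (\<kappa> w)" for w
    using conv_local_integrable[OF mb mb, of w "\<lambda>x. 1"] by (simp add: \<kappa>_def[abs_def])
  have one: "(LINT z|lborel. \<kappa> z w) = 1" for w
    using conv_moll_const[OF \<delta>, of 1 w] by (simp add: sym[of _ w]) (simp add: \<kappa>_def conv_def)
  have i\<kappa>': "integrable lborel (\<lambda>z. \<kappa> z w)" for w
    using i\<kappa>[of w] by (simp add: sym[of _ w])
  note [measurable] = borel_measurable_integrable[OF f]
  have "continuous_on UNIV (\<lambda>p. \<kappa> (snd p) (fst p))"
    unfolding \<kappa>_def
    by (intro continuous_intros continuous_on_compose2[OF bump_on_continuous[OF mb, of UNIV]]) auto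
  then have m\<kappa>: "(\<lambda>p. \<kappa> (snd p) (fst p)) \<in> borel_measurable (lborel \<Otimes>\<^sub>M lborel)"
    using borel_measurable_continuous_onI by (simp add: lborel_prod)
  have int: "integrable (lborel \<Otimes>\<^sub>M lborel) (\<lambda>p. \<kappa> (snd p) (fst p) * f (fst p))"
  proof (rule lborel_pair.Fubini_integrable)
    show "(\<lambda>p. \<kappa> (snd p) (fst p) * f (fst p)) \<in> borel_measurable (lborel \<Otimes>\<^sub>M lborel)"
      using m\<kappa> by measurable
    show "integrable lborel (\<lambda>x. LBINT y. norm (\<kappa> (snd (x, y)) (fst (x, y)) * f (fst (x, y))))"
      using f by (simp add: abs_mult \<kappa>0 one)
    show "AE x in lborel. integrable lborel (\<lambda>y. \<kappa> (snd (x, y)) (fst (x, y)) * f (fst (x, y)))"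
      using i\<kappa>' by simp
  qed
  have int': "integrable (lborel \<Otimes>\<^sub>M lborel) (case_prod (\<lambda>w z. \<kappa> z w * f w))"
    using int by (simp add: case_prod_unfold)
  have c: "conv (moll \<delta>) (moll \<delta>) f = (\<lambda>z. LBINT w. \<kappa> z w * f w)"
    by (simp add: conv_def[abs_def] \<kappa>_def)
  show "integrable lborel (conv (moll \<delta>) (moll \<delta>) f)"
    unfolding c by (rule lborel_pair.integrable_snd[OF int'])
  have "(LINT z|lborel. conv (moll \<delta>) (moll \<delta>) f z) = (LBINT w. LBINT z. \<kappa> z w * f w)"
    unfolding c lborel_pair.integral_snd[OF int'] lborel_pair.integral_fst[OF int', symmetric] ..
  also have "\<dots> = (LINT w|lborel. f w)" by (simp add: one)
  finally show "(LINT z|lborel. conv (moll \<delta>) (moll \<delta>) f z) = (LINT z|lborel. f z)" .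
qed

lemma conv_moll_abs_le:
  assumes \<delta>: "\<delta> > 0" and f: "integrable lborel f"
  shows "\<bar>conv (moll \<delta>) (moll \<delta>) f z\<bar> \<le> conv (moll \<delta>) (moll \<delta>) (\<lambda>w. \<bar>f w\<bar>) z"
  unfolding conv_def
  by (rule order_trans[OF integral_abs_bound])
    (simp add: abs_mult moll_nonneg[OF \<delta>])

lemma conv_moll_contraction:
  assumes \<delta>: "\<delta> > 0" and f: "integrable lborel f"
  shows "(LINT z|lborel. \<bar>conv (moll \<delta>) (moll \<delta>) f z\<bar>) \<le> (LINT z|lborel. \<bar>f z\<bar>)"
proof -
  have "(LINT z|lborel. \<bar>conv (moll \<delta>) (moll \<delta>) f z\<bar>) \<le>
      (LINT z|lborel. conv (moll \<delta>) (moll \<delta>) (\<lambda>w. \<bar>f w\<bar>) z)"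
    by (intro integral_mono integrable_abs conv_moll_integral conv_moll_abs_le \<delta> f)
  then show ?thesis using conv_moll_integral(2)[OF \<delta> integrable_abs[OF f]] by simp
qed

definition moll_seq :: "nat \<Rightarrow> (real \<times> real \<Rightarrow> real) \<Rightarrow> real \<times> real \<Rightarrow> real" where
  "moll_seq n f = conv (moll (1 / Suc n)) (moll (1 / Suc n)) f"

lemma moll_seq_diff:
  assumes "integrable lborel f" "integrable lborel g"
  shows "moll_seq n (\<lambda>w. f w - g w) z = moll_seq n f z - moll_seq n g z"
  unfolding moll_seq_def conv_def
  using conv_integrable[OF assms(1) moll_bump moll_bump, of "1 / Suc n" "1 / Suc n" z]
    conv_integrable[OF assms(2) moll_bump moll_bump, of "1 / Suc n" "1 / Suc n" z]
  by (simp add: right_diff_distrib)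

lemma moll_seq_add:
  assumes "integrable lborel f" "integrable lborel g"
  shows "moll_seq n (\<lambda>w. f w + g w) z = moll_seq n f z + moll_seq n g z"
  unfolding moll_seq_def conv_def
  using conv_integrable[OF assms(1) moll_bump moll_bump, of "1 / Suc n" "1 / Suc n" z]
    conv_integrable[OF assms(2) moll_bump moll_bump, of "1 / Suc n" "1 / Suc n" z]
  by (simp add: distrib_left)

lemma moll_seq_integrable: "integrable lborel f \<Longrightarrow> integrable lborel (moll_seq n f)"
  unfolding moll_seq_def by (intro conv_moll_integral) auto

text \<open>Convergence of the mollifications in the mean, as a predicate so that it can be proved by
  induction on integrable functions.\<close>

definition moll_L1 :: "(real \<times> real \<Rightarrow> real) \<Rightarrow> bool" where
  "moll_L1 f \<longleftrightarrow> (\<lambda>n. LINT z|lborel. \<bar>moll_seq n f z - f z\<bar>) \<longlonglongrightarrow> 0"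

lemma moll_L1_approx:
  assumes f: "integrable lborel f"
    and approx: "\<And>e. e > 0 \<Longrightarrow> \<exists>g. integrable lborel g \<and> moll_L1 g \<and> (LINT z|lborel. \<bar>f z - g z\<bar>) < e"
  shows "moll_L1 f"
  unfolding moll_L1_def
proof (rule LIMSEQ_I)
  fix e :: real assume e: "e > 0"
  then obtain g where g: "integrable lborel g" "moll_L1 g" "(LINT z|lborel. \<bar>f z - g z\<bar>) < e / 3"
    using approx[of "e / 3"] by auto
  then obtain N where N: "\<And>n. n \<ge> N \<Longrightarrow> (LINT z|lborel. \<bar>moll_seq n g z - g z\<bar>) < e / 3"
    unfolding moll_L1_def using LIMSEQ_D[of _ 0 "e / 3"] e by fastforce
  have "(LINT z|lborel. \<bar>moll_seq n f z - f z\<bar>) < e" if "n \<ge> N" for n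
  proof -
    have ifg: "integrable lborel (\<lambda>w. f w - g w)" using f g by simp
    note ints = moll_seq_integrable[OF f, of n] moll_seq_integrable[OF g(1), of n] moll_seq_integrable[OF ifg, of n] f g(1)
    have "(LINT z|lborel. \<bar>moll_seq n f z - f z\<bar>) \<le>
        (LINT z|lborel. \<bar>moll_seq n (\<lambda>w. f w - g w) z\<bar> + (\<bar>moll_seq n g z - g z\<bar> + \<bar>f z - g z\<bar>))"
      using ints by (intro integral_mono integrable_abs Bochner_Integration.integrable_diff Bochner_Integration.integrable_add)
        (simp_all add: moll_seq_diff[OF f g(1)])
    also have "\<dots> = (LINT z|lborel. \<bar>moll_seq n (\<lambda>w. f w - g w) z\<bar>) +
        ((LINT z|lborel. \<bar>moll_seq n g z - g z\<bar>) + (LINT z|lborel. \<bar>f z - g z\<bar>))"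
      using ints by simp
    also have "(LINT z|lborel. \<bar>moll_seq n (\<lambda>w. f w - g w) z\<bar>) \<le> (LINT z|lborel. \<bar>f z - g z\<bar>)"
      unfolding moll_seq_def by (rule conv_moll_contraction[OF _ ifg]) simp
    finally show ?thesis using N[OF that] g(3) by linarith
  qed
  then show "\<exists>N. \<forall>n\<ge>N. norm ((LINT z|lborel. \<bar>moll_seq n f z - f z\<bar>) - 0) < e"
    by (intro exI[of _ N]) simp
qed

text \<open>For an open set the mollified indicator tends to the indicator at every point of the set, and
  both have the same integral. Hence the positive part of the difference, which is dominated by
  the indicator, determines the distance in the mean (Scheffe's argument).\<close>

lemma moll_L1_open:
  fixes U :: "(real \<times> real) set"
  assumes U: "open U" "emeasure lborel U < \<infinity>"
  shows "moll_L1 (indicator U)"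
proof -
  let ?f = "indicator U :: real \<times> real \<Rightarrow> real"
  have f: "integrable lborel ?f" using U by (intro integrable_real_indicator) auto
  have pos: "moll_seq n ?f z \<ge> 0" for n z
    unfolding moll_seq_def conv_def by (intro Bochner_Integration.integral_nonneg) (simp add: moll_nonneg)
  define d where "d n z = max 0 (?f z - moll_seq n ?f z)" for n z
  have id: "integrable lborel (d n)" for n
    unfolding d_def using f moll_seq_integrable[OF f] by (intro integrable_max) auto
  have "(\<lambda>n. LINT z|lborel. d n z) \<longlonglongrightarrow> (LINT z::real \<times> real|lborel. 0)"
  proof (rule integral_dominated_convergence[where w = ?f])
    show "AE z in lborel. (\<lambda>n. d n z) \<longlonglongrightarrow> 0"
    proof (rule AE_I2)
      fix z
      show "(\<lambda>n. d n z) \<longlonglongrightarrow> 0"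
      proof (cases "z \<in> U")
        case True
        then obtain e where e: "e > 0" "sq z e \<subseteq> U" using compact_open_sq[of "{z}" U] U by auto
        have "\<forall>\<^sub>F n in sequentially. 1 / real (Suc n) < e"
          using order_tendstoD(2)[OF LIMSEQ_Suc[OF lim_1_over_n] e(1)] by simp
        then have "\<forall>\<^sub>F n in sequentially. d n z = 0"
        proof eventually_elim
          case (elim n)
          then have "sq z (1 / Suc n) \<subseteq> U" using e(2) by (fastforce simp: sq_iff)
          then have "moll_seq n (\<lambda>w. 1) z = moll_seq n (\<lambda>w. indicator U w * 1) z"
            unfolding moll_seq_def by (intro conv_localize[OF moll_bump moll_bump]) auto
          then have "moll_seq n ?f z = 1"
            by (simp add: moll_seq_def conv_moll_const)
          then show ?case using True by (simp add: d_def)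
        qed
        then show ?thesis by (rule tendsto_eventually)
      next
        case False
        then have "d n z = 0" for n using pos[of n z] by (simp add: d_def)
        then show ?thesis by simp
      qed
    qed
    show "AE z in lborel. norm (d n z) \<le> ?f z" for n
      using pos[of n] by (auto simp: d_def max_def)
  qed (use f id in \<open>auto intro: borel_measurable_integrable\<close>)
  moreover have "(LINT z|lborel. \<bar>moll_seq n ?f z - ?f z\<bar>) = 2 * (LINT z|lborel. d n z)" for n
  proof -
    have "(LINT z|lborel. \<bar>moll_seq n ?f z - ?f z\<bar>) = (LINT z|lborel. 2 * d n z + (moll_seq n ?f z - ?f z))"
      by (intro Bochner_Integration.integral_cong) (auto simp: d_def max_def abs_if)
    also have "\<dots> = 2 * (LINT z|lborel. d n z) + ((LINT z|lborel. moll_seq n ?f z) - (LINT z|lborel. ?f z))"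
      using f id[of n] moll_seq_integrable[OF f, of n] by simp
    also have "(LINT z|lborel. moll_seq n ?f z) = (LINT z|lborel. ?f z)"
      unfolding moll_seq_def by (rule conv_moll_integral[OF _ f]) simp
    finally show ?thesis by simp
  qed
  ultimately show ?thesis
    unfolding moll_L1_def using tendsto_mult_left[of "\<lambda>n. LINT z|lborel. d n z" 0 sequentially 2] by simp
qed

text \<open>Indicators of open sets approximate indicators of measurable sets by outer regularity, and the
  contraction property carries the convergence to limits in the mean.\<close>

lemma moll_L1_integrable:
  assumes "integrable lborel f"
  shows "moll_L1 f"
  using assms
proof (induction rule: integrable_induct)
  case (base A c)
  have iA: "integrable lborel (indicator A :: real \<times> real \<Rightarrow> real)" using base by simp
  have "moll_L1 (indicator A)"
  proof (rule moll_L1_approx[OF iA])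
    fix e :: real assume e: "e > 0"
    obtain U where U: "open U" "A \<subseteq> U" "U - A \<in> lmeasurable" "emeasure lebesgue (U - A) < ennreal e"
      using sets_lebesgue_outer_open[of A e] base(1) e by auto
    have UA: "U - A \<in> sets lborel" using U(1) base(1) by auto
    then have lt: "emeasure lborel (U - A) < ennreal e" using U(4) by simp
    have "emeasure lborel U = emeasure lborel A + emeasure lborel (U - A)"
      using UA base(1) U(2) by (subst plus_emeasure) (auto intro!: arg_cong[of _ _ "emeasure lborel"])
    also have "\<dots> < \<infinity>" using base(2) lt less_trans[OF lt] by (simp add: ennreal_add_less_top)
    finally have fin: "emeasure lborel U < \<infinity>" .
    have "(LINT z|lborel. \<bar>indicator A z - indicator U z :: real\<bar>) = (LINT z|lborel. indicator (U - A) z)"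
      using U(2) by (intro Bochner_Integration.integral_cong) (auto simp: indicator_def)
    also have "\<dots> = measure lborel (U - A)" using UA by simp
    also have "\<dots> < e"
    proof -
      have "emeasure lborel (U - A) \<noteq> \<infinity>" using lt by auto
      then have "ennreal (measure lborel (U - A)) < ennreal e"
        using lt emeasure_eq_ennreal_measure[of lborel "U - A"] by (simp add: infinity_ennreal_def)
      then show ?thesis by (simp add: ennreal_less_iff)
    qed
    finally show "\<exists>g. integrable lborel g \<and> moll_L1 g \<and> (LINT z|lborel. \<bar>indicator A z - g z\<bar>) < e"
      using moll_L1_open[OF U(1) fin] U(1) fin by (intro exI[of _ "indicator U"]) auto
  qed
  then have "(\<lambda>n. \<bar>c\<bar> * (LINT z|lborel. \<bar>moll_seq n (indicator A) z - indicator A z\<bar>)) \<longlonglongrightarrow> \<bar>c\<bar> * 0"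
    unfolding moll_L1_def by (intro tendsto_intros)
  moreover have "moll_seq n (\<lambda>x. indicator A x *\<^sub>R c) z = c * moll_seq n (indicator A) z" for n z
    unfolding moll_seq_def conv_def
    by (subst Bochner_Integration.integral_mult_right_zero[symmetric]) (simp add: mult_ac)
  ultimately show ?case
    unfolding moll_L1_def
    by (simp only: Bochner_Integration.integral_mult_right_zero[symmetric] abs_mult[symmetric])
      (simp add: right_diff_distrib mult.commute)
next
  case (add f g)
  note ints = add moll_seq_integrable[OF add(1)] moll_seq_integrable[OF add(2)]
  show ?case unfolding moll_L1_def
  proof (rule Lim_null_comparison)
    show "(\<lambda>n. (LINT z|lborel. \<bar>moll_seq n f z - f z\<bar>) + (LINT z|lborel. \<bar>moll_seq n g z - g z\<bar>)) \<longlonglongrightarrow> 0"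
      using tendsto_add[of _ 0 _ _ 0] add(3,4) unfolding moll_L1_def by fastforce
    have "(LINT z|lborel. \<bar>moll_seq n (\<lambda>x. f x + g x) z - (f z + g z)\<bar>) \<le>
        (LINT z|lborel. \<bar>moll_seq n f z - f z\<bar> + \<bar>moll_seq n g z - g z\<bar>)" for n
      unfolding moll_seq_add[OF add(1,2)] using ints
      by (intro integral_mono integrable_abs Bochner_Integration.integrable_diff Bochner_Integration.integrable_add) auto
    then show "\<forall>\<^sub>F n in sequentially. norm (LINT z|lborel. \<bar>moll_seq n (\<lambda>x. f x + g x) z - (f z + g z)\<bar>) \<le>
        (LINT z|lborel. \<bar>moll_seq n f z - f z\<bar>) + (LINT z|lborel. \<bar>moll_seq n g z - g z\<bar>)"
      using ints by (intro always_eventually allI) simp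
  qed
next
  case (lim f s)
  show ?case
  proof (rule moll_L1_approx[OF lim(4)])
    fix e :: real assume e: "e > 0"
    have "(\<lambda>i. LINT z|lborel. \<bar>f z - s i z\<bar>) \<longlonglongrightarrow> (LINT z::real \<times> real|lborel. 0)"
    proof (rule integral_dominated_convergence[where w = "\<lambda>z. 3 * \<bar>f z\<bar>"])
      show "AE z in lborel. (\<lambda>i. \<bar>f z - s i z\<bar>) \<longlonglongrightarrow> 0"
        using tendsto_rabs_zero[OF LIM_zero[OF lim(2)]] by (intro AE_I2) (simp add: abs_minus_commute)
      have "\<bar>f z - s i z\<bar> \<le> 3 * \<bar>f z\<bar>" for i z
        using lim(3)[of z i] by simp
      then show "AE z in lborel. norm \<bar>f z - s i z\<bar> \<le> 3 * \<bar>f z\<bar>" for i by simp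
    qed (use lim(1,4) in \<open>auto intro: borel_measurable_integrable\<close>)
    then have "\<forall>\<^sub>F i in sequentially. (LINT z|lborel. \<bar>f z - s i z\<bar>) < e"
      using e by (intro order_tendstoD(2)) auto
    then obtain i where "(LINT z|lborel. \<bar>f z - s i z\<bar>) < e"
      by (auto simp: eventually_sequentially)
    then show "\<exists>g. integrable lborel g \<and> moll_L1 g \<and> (LINT z|lborel. \<bar>f z - g z\<bar>) < e"
      using lim(1,5) by blast
  qed
qed

subsection \<open>The chain rule argument\<close>

lemma bump_product_continuous:
  assumes "A \<in> bump_on a1 b1" "B \<in> bump_on a2 b2"
  shows "continuous_on S (\<lambda>w::real \<times> real. A (fst w) * B (snd w))"
  by (intro continuous_intros continuous_on_compose2[OF bump_on_continuous[OF assms(1), of UNIV]]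
      continuous_on_compose2[OF bump_on_continuous[OF assms(2), of UNIV]]) auto

lemma bump_product_integrable:
  assumes "A \<in> bump_on a1 b1" "B \<in> bump_on a2 b2"
  shows "integrable lborel (\<lambda>w::real \<times> real. A (fst w) * B (snd w))"
proof -
  have "integrable lborel (\<lambda>w. indicator ({a1..b1} \<times> {a2..b2}) w * (A (fst w) * B (snd w)))"
    by (intro integrable_indicator_continuous compact_Times bump_product_continuous[OF assms]) auto
  moreover have "indicator ({a1..b1} \<times> {a2..b2}) w * (A (fst w) * B (snd w)) = A (fst w) * B (snd w)" for w
    using bump_on_zero[OF assms(1), of "fst w"] bump_on_zero[OF assms(2), of "snd w"]
    by (cases "fst w \<in> {a1..b1}"; cases "snd w \<in> {a2..b2}") (auto simp: mem_Times_iff indicator_def)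
  ultimately show ?thesis by simp
qed

lemma integral_deriv_fst_eq_0:
  fixes H Hx :: "real \<times> real \<Rightarrow> real"
  assumes D: "\<And>x t. ((\<lambda>x. H (x, t)) has_real_derivative Hx (x, t)) (at x)"
    and cont: "continuous_on UNIV Hx"
    and zero: "\<And>x t. (x, t) \<notin> {a1..b1} \<times> {a2..b2} \<Longrightarrow> H (x, t) = 0"
    and zero': "\<And>x t. (x, t) \<notin> {a1..b1} \<times> {a2..b2} \<Longrightarrow> Hx (x, t) = 0"
  shows "(LINT z|lborel. Hx z) = 0"
proof -
  have "integrable lborel (\<lambda>w. indicator ({a1..b1} \<times> {a2..b2}) w * Hx w)"
    by (intro integrable_indicator_continuous compact_Times continuous_on_subset[OF cont]) auto
  moreover have "(\<lambda>w. indicator ({a1..b1} \<times> {a2..b2}) w * Hx w) = Hx"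
    using zero' by (fastforce simp: indicator_def)
  ultimately have "integrable (lborel \<Otimes>\<^sub>M lborel) (case_prod (\<lambda>x t. Hx (x, t)))"
    by (simp add: lborel_prod)
  from lborel_pair.integral_snd[OF this]
  have "(LINT z|lborel. Hx z) = (LINT t|lborel. LINT x|lborel. Hx (x, t))"
    by (simp add: lborel_prod)
  also have "\<dots> = (LINT t|(lborel::real measure). 0)"
  proof (intro Bochner_Integration.integral_cong refl)
    fix t :: real
    define c d where "c = min a1 b1 - 1" and "d = max a1 b1 + 1"
    have "(LINT x|lborel. Hx (x, t)) = (LINT x|lborel. Hx (x, t) * indicator {c..d} x)"
    proof (intro Bochner_Integration.integral_cong refl)
      fix x
      show "Hx (x, t) = Hx (x, t) * indicator {c..d} x"
        using zero'[of x t] by (cases "x \<in> {a1..b1}") (auto simp: indicator_def c_def d_def)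
    qed
    also have "\<dots> = H (d, t) - H (c, t)"
    proof (rule integral_FTC_Icc_real)
      show "c \<le> d" by (auto simp: c_def d_def)
      show "isCont (\<lambda>x. Hx (x, t)) x" for x
        using continuous_on_compose2[OF cont, of UNIV "\<lambda>x. (x, t)"]
        by (auto simp: continuous_on_eq_continuous_at intro!: continuous_intros)
    qed (use D in auto)
    also have "\<dots> = 0"
    proof -
      have "d \<notin> {a1..b1}" "c \<notin> {a1..b1}" by (auto simp: c_def d_def)
      then show ?thesis using zero[of d t] zero[of c t] by auto
    qed
    finally show "(LINT x|lborel. Hx (x, t)) = 0" .
  qed
  finally show ?thesis by simp
qed

text \<open>With \<open>G(s) = \<epsilon> arctan (s / \<epsilon>)\<close> the chain rule reads
  \<open>\<partial>\<^sub>x G(f - ell) = G'(f - ell) (g - \<beta>)\<close>, where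
  \<open>ell\<close> is the affine function with slopes \<open>\<beta>\<close> and
  \<open>\<gamma>\<close>. As \<open>\<epsilon>\<close> tends to zero, \<open>G\<close> tends to
  zero uniformly, whereas \<open>G'(f - ell)\<close> tends to the indicator of the level set. So
  \<open>g - \<beta>\<close> is orthogonal to all test functions on the level set.\<close>

lemma level_set_deriv_tested:
  fixes f g :: "real \<times> real \<Rightarrow> real"
  assumes f: "integrable lborel f" and g: "integrable lborel g" and e: "e > 0"
    and weak: "\<And>A B. A \<in> bump_on (a1 - e) (b1 + e) \<Longrightarrow> B \<in> bump_on (a2 - e) (b2 + e) \<Longrightarrow>
      (LINT w|lborel. f w * (deriv A (fst w) * B (snd w))) = - (LINT w|lborel. g w * (A (fst w) * B (snd w)))"
    and A: "A \<in> bump_on a1 b1" and B: "B \<in> bump_on a2 b2"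
  shows "(LINT z|lborel. (if f z = \<alpha> + \<beta> * fst z + \<gamma> * snd z then (g z - \<beta>) * (A (fst z) * B (snd z)) else 0)) = 0"
proof -
  define ell where "ell z = \<alpha> + \<beta> * fst z + \<gamma> * snd z" for z :: "real \<times> real"
  define P where "P z = A (fst z) * B (snd z)" for z :: "real \<times> real"
  define G' where "G' \<epsilon> s = 1 / (1 + (s / \<epsilon>)\<^sup>2)" for \<epsilon> s :: real
  have G'_bound: "0 \<le> G' \<epsilon> s" "G' \<epsilon> s \<le> 1" for \<epsilon> s
    using frac_le[of 1 1 1 "1 + (s / \<epsilon>)\<^sup>2"] by (auto simp: G'_def)
  have Pc: "continuous_on S P" for S unfolding P_def by (rule bump_product_continuous[OF A B])
  have iP: "integrable lborel P" unfolding P_def by (rule bump_product_integrable[OF A B])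
  obtain C where C: "C \<ge> 0" "\<And>z. \<bar>P z\<bar> \<le> C"
  proof -
    obtain CA CB where "CA \<ge> 0" "\<And>x. \<bar>A x\<bar> \<le> CA" "CB \<ge> 0" "\<And>x. \<bar>B x\<bar> \<le> CB"
      using bump_on_bounded[OF A] bump_on_bounded[OF B] by metis
    then have "CA * CB \<ge> 0" "\<And>z. \<bar>P z\<bar> \<le> CA * CB"
      by (auto simp: P_def abs_mult intro!: mult_mono)
    then show ?thesis using that by blast
  qed
  have ellc: "continuous_on S ell" for S unfolding ell_def by (intro continuous_intros)
  have ellm: "ell \<in> borel_measurable borel" by (intro borel_measurable_continuous_onI ellc)
  have Pm: "P \<in> borel_measurable borel" by (intro borel_measurable_continuous_onI Pc)
  note [measurable] = ellm Pm borel_measurable_integrable[OF f, simplified measurable_lborel2]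
    borel_measurable_integrable[OF g, simplified measurable_lborel2]
  have G'm[measurable]: "G' \<epsilon> \<in> borel_measurable borel" for \<epsilon> unfolding G'_def by measurable
  define Q where "Q = (LINT z|lborel. \<bar>deriv A (fst z) * B (snd z)\<bar>)"
  have igP: "integrable lborel (\<lambda>z. (g z - \<beta>) * P z)"
  proof -
    have "integrable lborel (\<lambda>z. g z * P z)"
      by (rule Bochner_Integration.integrable_bound[OF integrable_mult_right[OF g, of C]])
        (use C in \<open>auto simp: abs_mult mult.commute intro!: mult_right_mono\<close>)
    then have "integrable lborel (\<lambda>z. g z * P z - \<beta> * P z)" using iP by simp
    then show ?thesis by (simp add: left_diff_distrib)
  qed
  \<comment> \<open>After mollification everything is smooth, and the integral of \<open>\<partial>\<^sub>x (G(f - ell) P)\<close> vanishes.\<close>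
  have step: "\<bar>LINT z|lborel. G' \<epsilon> (moll_seq n f z - ell z) * (moll_seq n g z - \<beta>) * P z\<bar> \<le> \<epsilon> * pi / 2 * Q"
    if \<epsilon>: "\<epsilon> > 0" and n: "1 / real (Suc n) < e" for \<epsilon> n
  proof -
    define \<delta> where "\<delta> = 1 / real (Suc n)"
    have \<delta>: "\<delta> > 0" "\<delta> < e" using n by (auto simp: \<delta>_def)
    note mb = moll_bump[OF \<delta>(1)]
    define F where "F = moll_seq n f"
    have F: "F = conv (moll \<delta>) (moll \<delta>) f" by (simp add: F_def moll_seq_def \<delta>_def)
    have mg: "moll_seq n g = conv (moll \<delta>) (moll \<delta>) g" by (simp add: moll_seq_def \<delta>_def)
    define F' where "F' = conv (deriv (moll \<delta>)) (moll \<delta>) f"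
    have F'g: "F' z = moll_seq n g z" if z: "z \<in> {a1..b1} \<times> {a2..b2}" for z
    proof -
      have 1: "(\<lambda>w. moll \<delta> (fst z - w)) \<in> bump_on (a1 - e) (b1 + e)"
        by (rule bump_on_mono[OF bump_on_reflect[OF mb]]) (use z \<delta> in auto)
      have 2: "(\<lambda>w. moll \<delta> (snd z - w)) \<in> bump_on (a2 - e) (b2 + e)"
        by (rule bump_on_mono[OF bump_on_reflect[OF mb]]) (use z \<delta> in auto)
      from weak[OF 1 2] show ?thesis
        unfolding deriv_reflect[OF mb] by (simp add: F'_def mg conv_def mult.commute mult.left_commute)
    qed
    have Fc: "continuous_on S F" "continuous_on S F'" for S
      unfolding F F'_def by (rule conv_continuous[OF f mb mb], rule conv_continuous[OF f bump_on_deriv[OF mb] mb])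
    define G where "G s = \<epsilon> * arctan (s / \<epsilon>)" for s
    have Gb: "\<bar>G s\<bar> \<le> \<epsilon> * pi / 2" for s
      using \<epsilon> arctan_bounded[of "s / \<epsilon>"] by (auto simp: G_def abs_mult abs_le_iff)
    have Gd: "(G has_real_derivative G' \<epsilon> s) (at s)" for s
      unfolding G_def using \<epsilon> by (auto intro!: derivative_eq_intros simp: G'_def field_simps power2_eq_square)
    have Gc: "continuous_on S G" for S
      unfolding G_def using \<epsilon> by (intro continuous_intros) auto
    have G'c: "continuous_on S (G' \<epsilon>)" for S
      unfolding G'_def using \<epsilon> by (intro continuous_intros) (auto simp: add_nonneg_eq_0_iff)
    define X where "X z = G' \<epsilon> (F z - ell z) * (F' z - \<beta>) * P z" for z
    define Y where "Y z = G (F z - ell z) * (deriv A (fst z) * B (snd z))" for z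
    have "(LINT z|lborel. X z + Y z) = 0"
    proof (rule integral_deriv_fst_eq_0[where H = "\<lambda>z. G (F z - ell z) * P z"])
      fix x t :: real
      have "((\<lambda>x. F (x, t) - ell (x, t)) has_real_derivative F' (x, t) - \<beta>) (at x)"
        unfolding F F'_def ell_def
        by (auto intro!: derivative_eq_intros conv_has_deriv_fst[OF f mb mb])
      note DERIV_mult[OF DERIV_chain2[OF Gd this] DERIV_cmult_right[OF bump_on_has_deriv[OF A], of "B t"]]
      then show "((\<lambda>x. G (F (x, t) - ell (x, t)) * P (x, t)) has_real_derivative X (x, t) + Y (x, t)) (at x)"
        by (simp add: P_def X_def Y_def mult_ac)
    next
      show "continuous_on UNIV (\<lambda>z. X z + Y z)"
        unfolding X_def Y_def
        by (intro continuous_intros Pc bump_product_continuous[OF bump_on_deriv[OF A] B] Fc ellc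
            continuous_on_compose2[OF G'c[of UNIV]] continuous_on_compose2[OF Gc[of UNIV]]) auto
    next
      fix x t :: real assume out: "(x, t) \<notin> {a1..b1} \<times> {a2..b2}"
      then have "P (x, t) = 0" "deriv A x * B t = 0"
        using bump_on_zero[OF A, of x] bump_on_zero[OF B, of t] bump_on_zero[OF bump_on_deriv[OF A], of x]
        by (auto simp: P_def)
      then show "G (F (x, t) - ell (x, t)) * P (x, t) = 0" "X (x, t) + Y (x, t) = 0"
        by (auto simp: X_def Y_def)
    qed
    moreover have iY: "integrable lborel Y"
    proof (rule Bochner_Integration.integrable_bound)
      show "integrable lborel (\<lambda>z. \<epsilon> * pi / 2 * (deriv A (fst z) * B (snd z)))"
        by (intro integrable_mult_right bump_product_integrable[OF bump_on_deriv[OF A] B])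
      have "continuous_on UNIV Y" unfolding Y_def
        by (intro continuous_intros bump_product_continuous[OF bump_on_deriv[OF A] B] Fc ellc
            continuous_on_compose2[OF Gc[of UNIV]]) auto
      then show "Y \<in> borel_measurable lborel" using borel_measurable_continuous_onI by simp
      show "AE z in lborel. norm (Y z) \<le> norm (\<epsilon> * pi / 2 * (deriv A (fst z) * B (snd z)))"
      proof (rule AE_I2)
        fix z
        have "\<bar>Y z\<bar> \<le> \<epsilon> * pi / 2 * \<bar>deriv A (fst z) * B (snd z)\<bar>"
          unfolding Y_def abs_mult[of "G _"] by (rule mult_right_mono[OF Gb]) simp
        then show "norm (Y z) \<le> norm (\<epsilon> * pi / 2 * (deriv A (fst z) * B (snd z)))"
          using \<epsilon> by (simp add: abs_mult)
      qed
    qed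
    moreover have iX: "integrable lborel X"
    proof -
      have "continuous_on UNIV X" unfolding X_def
        by (intro continuous_intros Pc Fc ellc continuous_on_compose2[OF G'c[of UNIV]]) auto
      then have "integrable lborel (\<lambda>w. indicator ({a1..b1} \<times> {a2..b2}) w * X w)"
        by (intro integrable_indicator_continuous compact_Times) (auto intro: continuous_on_subset)
      moreover have "indicator ({a1..b1} \<times> {a2..b2}) w * X w = X w" for w
        using bump_on_zero[OF A, of "fst w"] bump_on_zero[OF B, of "snd w"]
        by (cases "fst w \<in> {a1..b1}"; cases "snd w \<in> {a2..b2}") (auto simp: mem_Times_iff indicator_def X_def P_def)
      ultimately show ?thesis by simp
    qed
    ultimately have "(LINT z|lborel. X z) = - (LINT z|lborel. Y z)" by simp
    then have "\<bar>LINT z|lborel. X z\<bar> = \<bar>LINT z|lborel. Y z\<bar>" by simp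
    also have "\<dots> \<le> (LINT z|lborel. \<bar>Y z\<bar>)" by (rule integral_abs_bound)
    also have "\<dots> \<le> (LINT z|lborel. \<epsilon> * pi / 2 * \<bar>deriv A (fst z) * B (snd z)\<bar>)"
    proof (rule integral_mono)
      show "integrable lborel (\<lambda>z. \<epsilon> * pi / 2 * \<bar>deriv A (fst z) * B (snd z)\<bar>)"
        by (intro integrable_mult_right integrable_abs bump_product_integrable[OF bump_on_deriv[OF A] B])
      show "\<bar>Y z\<bar> \<le> \<epsilon> * pi / 2 * \<bar>deriv A (fst z) * B (snd z)\<bar>" for z
        unfolding Y_def abs_mult[of "G _"] by (rule mult_right_mono[OF Gb]) simp
    qed (use iY in simp)
    also have "\<dots> = \<epsilon> * pi / 2 * Q" unfolding Q_def by (rule Bochner_Integration.integral_mult_right_zero)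
    finally have "\<bar>LINT z|lborel. X z\<bar> \<le> \<epsilon> * pi / 2 * Q" .
    moreover have "X z = G' \<epsilon> (moll_seq n f z - ell z) * (moll_seq n g z - \<beta>) * P z" for z
    proof (cases "z \<in> {a1..b1} \<times> {a2..b2}")
      case True
      then show ?thesis using F'g by (simp add: X_def F_def)
    next
      case False
      then have "P z = 0"
        using bump_on_zero[OF A, of "fst z"] bump_on_zero[OF B, of "snd z"] by (auto simp: P_def mem_Times_iff)
      then show ?thesis by (simp add: X_def)
    qed
    ultimately show ?thesis by simp
  qed
  \<comment> \<open>The mollifications of \<open>g\<close> converge in the mean, those of \<open>f\<close> almost everywhere along a
    subsequence, which is enough because \<open>G'\<close> is bounded and continuous.\<close>
  have lim1: "\<bar>LINT z|lborel. G' \<epsilon> (f z - ell z) * ((g z - \<beta>) * P z)\<bar> \<le> \<epsilon> * pi / 2 * Q" if \<epsilon>: "\<epsilon> > 0" for \<epsilon>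
  proof -
    have "(\<lambda>n. LINT z|lborel. norm (moll_seq n f z - f z)) \<longlonglongrightarrow> 0"
      using moll_L1_integrable[OF f] by (simp add: moll_L1_def)
    then obtain \<rho> :: "nat \<Rightarrow> nat" where \<rho>: "strict_mono \<rho>" "AE z in lborel. (\<lambda>n. moll_seq (\<rho> n) f z - f z) \<longlonglongrightarrow> 0"
      using tendsto_L1_AE_subseq[of lborel "\<lambda>n z. moll_seq n f z - f z"] f moll_seq_integrable[OF f] by auto
    have ms[measurable]: "moll_seq n f \<in> borel_measurable borel" "moll_seq n g \<in> borel_measurable borel" for n
      using borel_measurable_integrable[OF moll_seq_integrable[OF f]] borel_measurable_integrable[OF moll_seq_integrable[OF g]]
      by simp_all
    define S where "S n = (LINT z|lborel. G' \<epsilon> (moll_seq (\<rho> n) f z - ell z) * (moll_seq (\<rho> n) g z - \<beta>) * P z)" for n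
    define T where "T n = (LINT z|lborel. G' \<epsilon> (moll_seq (\<rho> n) f z - ell z) * ((g z - \<beta>) * P z))" for n
    have T: "T \<longlonglongrightarrow> (LINT z|lborel. G' \<epsilon> (f z - ell z) * ((g z - \<beta>) * P z))"
      unfolding T_def
    proof (rule integral_dominated_convergence[where w = "\<lambda>z. \<bar>(g z - \<beta>) * P z\<bar>"])
      show "AE z in lborel. (\<lambda>n. G' \<epsilon> (moll_seq (\<rho> n) f z - ell z) * ((g z - \<beta>) * P z)) \<longlonglongrightarrow>
          G' \<epsilon> (f z - ell z) * ((g z - \<beta>) * P z)"
        using \<rho>(2)
      proof eventually_elim
        case (elim z)
        then have "(\<lambda>n. moll_seq (\<rho> n) f z) \<longlonglongrightarrow> f z" by (rule LIM_zero_cancel)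
        then show ?case unfolding G'_def
          using \<epsilon> by (intro tendsto_intros) (auto simp: add_nonneg_eq_0_iff)
      qed
      show "AE z in lborel. norm (G' \<epsilon> (moll_seq (\<rho> n) f z - ell z) * ((g z - \<beta>) * P z)) \<le> \<bar>(g z - \<beta>) * P z\<bar>" for n
        using G'_bound by (intro AE_I2) (auto simp: abs_mult intro!: mult_left_le_one_le)
    qed (use igP in auto)
    have diff: "\<bar>S n - T n\<bar> \<le> C * (LINT z|lborel. \<bar>moll_seq (\<rho> n) g z - g z\<bar>)" for n
    proof -
      have i1: "integrable lborel (\<lambda>z. \<bar>moll_seq (\<rho> n) g z - g z\<bar>)"
        using moll_seq_integrable[OF g] g by auto
      let ?d = "\<lambda>z. G' \<epsilon> (moll_seq (\<rho> n) f z - ell z) * ((moll_seq (\<rho> n) g z - g z) * P z)"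
      have le: "\<bar>?d z\<bar> \<le> C * \<bar>moll_seq (\<rho> n) g z - g z\<bar>" for z
      proof -
        have "\<bar>?d z\<bar> \<le> 1 * (\<bar>moll_seq (\<rho> n) g z - g z\<bar> * C)"
          unfolding abs_mult using G'_bound C by (intro mult_mono) auto
        then show ?thesis by (simp add: mult.commute)
      qed
      have i2: "integrable lborel ?d"
        by (rule Bochner_Integration.integrable_bound[OF integrable_mult_right[OF i1, of C]])
          (use le C in auto)
      have i3: "integrable lborel (\<lambda>z. G' \<epsilon> (moll_seq (\<rho> n) f z - ell z) * ((g z - \<beta>) * P z))"
        by (rule Bochner_Integration.integrable_bound[OF integrable_abs[OF igP]])
          (use G'_bound in \<open>auto simp: abs_mult intro!: mult_left_le_one_le\<close>)
      have "S n = (LINT z|lborel. ?d z + G' \<epsilon> (moll_seq (\<rho> n) f z - ell z) * ((g z - \<beta>) * P z))"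
        unfolding S_def by (intro Bochner_Integration.integral_cong) (auto simp: algebra_simps)
      also have "\<dots> = (LINT z|lborel. ?d z) + T n"
        unfolding T_def by (rule Bochner_Integration.integral_add[OF i2 i3])
      finally have "\<bar>S n - T n\<bar> = \<bar>LINT z|lborel. ?d z\<bar>" by simp
      also have "\<dots> \<le> (LINT z|lborel. \<bar>?d z\<bar>)" by (rule integral_abs_bound)
      also have "\<dots> \<le> (LINT z|lborel. C * \<bar>moll_seq (\<rho> n) g z - g z\<bar>)"
        by (intro integral_mono integrable_abs i2 integrable_mult_right i1 le)
      finally show ?thesis by simp
    qed
    have "(\<lambda>n. LINT z|lborel. \<bar>moll_seq (\<rho> n) g z - g z\<bar>) \<longlonglongrightarrow> 0"
      using LIMSEQ_subseq_LIMSEQ[OF moll_L1_integrable[OF g, unfolded moll_L1_def] \<rho>(1)] by (simp add: o_def)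
    then have "(\<lambda>n. C * (LINT z|lborel. \<bar>moll_seq (\<rho> n) g z - g z\<bar>)) \<longlonglongrightarrow> 0"
      using tendsto_mult_right_zero by blast
    then have "(\<lambda>n. S n - T n) \<longlonglongrightarrow> 0"
      by (rule Lim_null_comparison[rotated]) (use diff in auto)
    from tendsto_add[OF this T] have "S \<longlonglongrightarrow> (LINT z|lborel. G' \<epsilon> (f z - ell z) * ((g z - \<beta>) * P z))" by simp
    then have "(\<lambda>n. \<bar>S n\<bar>) \<longlonglongrightarrow> \<bar>LINT z|lborel. G' \<epsilon> (f z - ell z) * ((g z - \<beta>) * P z)\<bar>"
      by (rule tendsto_rabs)
    moreover have "\<forall>\<^sub>F n in sequentially. \<bar>S n\<bar> \<le> \<epsilon> * pi / 2 * Q"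
    proof -
      have "(\<lambda>n. 1 / real (Suc (\<rho> n))) \<longlonglongrightarrow> 0"
        using LIMSEQ_subseq_LIMSEQ[OF LIMSEQ_Suc[OF lim_1_over_n] \<rho>(1)] by (simp add: o_def)
      then have "\<forall>\<^sub>F n in sequentially. 1 / real (Suc (\<rho> n)) < e" using e by (intro order_tendstoD(2))
      then show ?thesis by eventually_elim (use step[OF \<epsilon>] in \<open>simp add: S_def\<close>)
    qed
    ultimately show ?thesis by (rule tendsto_upperbound) simp
  qed
  \<comment> \<open>With \<open>\<epsilon> = 1 / (n + 1)\<close> the factor \<open>G'\<close> tends to the indicator of the level set.\<close>
  have "(\<lambda>n. LINT z|lborel. G' (1 / Suc n) (f z - ell z) * ((g z - \<beta>) * P z)) \<longlonglongrightarrow>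
      (LINT z|lborel. (if f z = ell z then (g z - \<beta>) * P z else 0))"
  proof (rule integral_dominated_convergence[where w = "\<lambda>z. \<bar>(g z - \<beta>) * P z\<bar>"])
    show "AE z in lborel. (\<lambda>n. G' (1 / Suc n) (f z - ell z) * ((g z - \<beta>) * P z)) \<longlonglongrightarrow>
        (if f z = ell z then (g z - \<beta>) * P z else 0)"
    proof (rule AE_I2)
      fix z
      show "(\<lambda>n. G' (1 / Suc n) (f z - ell z) * ((g z - \<beta>) * P z)) \<longlonglongrightarrow>
        (if f z = ell z then (g z - \<beta>) * P z else 0)"
      proof (cases "f z = ell z")
        case False
        define c where "c = (f z - ell z)\<^sup>2"
        have c: "c > 0" using False by (simp add: c_def)
        have "filterlim (\<lambda>n. 1 + c * (real (Suc n))\<^sup>2) at_top sequentially"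
          using c by (intro filterlim_tendsto_add_at_top[OF tendsto_const] filterlim_tendsto_pos_mult_at_top[OF tendsto_const]
              filterlim_pow_at_top filterlim_compose[OF filterlim_real_sequentially filterlim_Suc]) auto
        then have "(\<lambda>n. 1 / (1 + c * (real (Suc n))\<^sup>2)) \<longlonglongrightarrow> 0"
          by (intro tendsto_divide_0[OF tendsto_const] filterlim_at_top_imp_at_infinity)
        then have "(\<lambda>n. G' (1 / Suc n) (f z - ell z)) \<longlonglongrightarrow> 0"
          by (simp add: G'_def c_def power_mult_distrib)
        from tendsto_mult_left_zero[OF this] show ?thesis using False by simp
      qed (simp add: G'_def)
    qed
    show "AE z in lborel. norm (G' (1 / Suc n) (f z - ell z) * ((g z - \<beta>) * P z)) \<le> \<bar>(g z - \<beta>) * P z\<bar>" for n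
      using G'_bound by (intro AE_I2) (auto simp: abs_mult intro!: mult_left_le_one_le)
  qed (use igP in auto)
  moreover have "(\<lambda>n. LINT z|lborel. G' (1 / Suc n) (f z - ell z) * ((g z - \<beta>) * P z)) \<longlonglongrightarrow> 0"
  proof (rule Lim_null_comparison)
    show "\<forall>\<^sub>F n in sequentially. norm (LINT z|lborel. G' (1 / Suc n) (f z - ell z) * ((g z - \<beta>) * P z)) \<le>
        (1 / real (Suc n)) * (pi / 2 * Q)"
      using lim1[of "1 / real (Suc _)"] by (intro always_eventually allI) simp
    show "(\<lambda>n. (1 / real (Suc n)) * (pi / 2 * Q)) \<longlonglongrightarrow> 0"
      by (rule tendsto_mult_left_zero[OF LIMSEQ_Suc[OF lim_1_over_n]])
  qed
  ultimately have "(LINT z|lborel. (if f z = ell z then (g z - \<beta>) * P z else 0)) = 0"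
    by (rule LIMSEQ_unique)
  then show ?thesis unfolding ell_def P_def .
qed

text \<open>Mollification kernels are test functions, so the mollifications of \<open>g - \<beta>\<close>,
  restricted to the level set, vanish. They converge to it in the mean.\<close>

lemma level_set_deriv_box:
  fixes f g :: "real \<times> real \<Rightarrow> real"
  assumes f: "integrable lborel f" and g: "integrable lborel g" and e: "e > 0"
    and weak: "\<And>A B. A \<in> bump_on (a1 - e) (b1 + e) \<Longrightarrow> B \<in> bump_on (a2 - e) (b2 + e) \<Longrightarrow>
      (LINT w|lborel. f w * (deriv A (fst w) * B (snd w))) = - (LINT w|lborel. g w * (A (fst w) * B (snd w)))"
  shows "AE z in lborel. z \<in> {a1<..<b1} \<times> {a2<..<b2} \<longrightarrow> f z = \<alpha> + \<beta> * fst z + \<gamma> * snd z \<longrightarrow> g z = \<beta>"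
proof -
  define Q where "Q = {a1..b1} \<times> {a2..b2}"
  define h where "h z = (if f z = \<alpha> + \<beta> * fst z + \<gamma> * snd z then indicator Q z * (g z - \<beta>) else 0)" for z
  note [measurable] = borel_measurable_integrable[OF f, simplified measurable_lborel2]
    borel_measurable_integrable[OF g, simplified measurable_lborel2]
  have Qm[measurable]: "Q \<in> sets borel" unfolding Q_def by (intro borel_closed closed_Times) auto
  have aff: "(\<lambda>z::real \<times> real. \<alpha> + \<beta> * fst z + \<gamma> * snd z) \<in> borel_measurable borel"
    by (intro borel_measurable_continuous_onI continuous_intros)
  note [measurable] = aff
  have ih: "integrable lborel h"
  proof (rule Bochner_Integration.integrable_bound)
    have "integrable lborel (\<lambda>z. indicator Q z * (1::real))"
      unfolding Q_def by (intro integrable_indicator_continuous compact_Times continuous_intros) auto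
    then show "integrable lborel (\<lambda>z. \<bar>g z\<bar> + \<bar>\<beta>\<bar> * (indicator Q z * 1))" using g by simp
    show "h \<in> borel_measurable lborel" unfolding h_def by measurable
    show "AE z in lborel. norm (h z) \<le> norm (\<bar>g z\<bar> + \<bar>\<beta>\<bar> * (indicator Q z * 1))"
      by (intro AE_I2) (auto simp: h_def indicator_def)
  qed
  obtain \<rho> :: "nat \<Rightarrow> nat" where \<rho>: "strict_mono \<rho>" "AE z in lborel. (\<lambda>n. moll_seq (\<rho> n) h z - h z) \<longlonglongrightarrow> 0"
    using tendsto_L1_AE_subseq[of lborel "\<lambda>n z. moll_seq n h z - h z"] ih moll_seq_integrable[OF ih]
      moll_L1_integrable[OF ih] by (auto simp: moll_L1_def)
  have zero: "moll_seq n h z = 0" if sub: "sq z (1 / Suc n) \<subseteq> Q" for n z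
  proof -
    define \<delta> where "\<delta> = 1 / real (Suc n)"
    have \<delta>: "\<delta> > 0" by (simp add: \<delta>_def)
    note mb = moll_bump[OF \<delta>]
    have c: "{fst z - \<delta>..fst z + \<delta>} \<times> {snd z - \<delta>..snd z + \<delta>} \<subseteq> {a1..b1} \<times> {a2..b2}"
      using sub by (simp add: \<delta>_def Q_def sq_def)
    then have box: "a1 \<le> fst z - \<delta>" "fst z + \<delta> \<le> b1" "a2 \<le> snd z - \<delta>" "snd z + \<delta> \<le> b2"
      using \<delta> by (auto simp: Sigma_mono times_subset_iff)
    have A: "(\<lambda>w. moll \<delta> (fst z - w)) \<in> bump_on a1 b1"
      by (rule bump_on_mono[OF bump_on_reflect[OF mb]]) (use box in auto)
    have B: "(\<lambda>w. moll \<delta> (snd z - w)) \<in> bump_on a2 b2"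
      by (rule bump_on_mono[OF bump_on_reflect[OF mb]]) (use box in auto)
    have "moll_seq n h z = (LINT w|lborel. (if f w = \<alpha> + \<beta> * fst w + \<gamma> * snd w
        then (g w - \<beta>) * (moll \<delta> (fst z - fst w) * moll \<delta> (snd z - snd w)) else 0))"
      unfolding moll_seq_def conv_def \<delta>_def[symmetric]
    proof (intro Bochner_Integration.integral_cong refl)
      fix w
      show "moll \<delta> (fst z - fst w) * moll \<delta> (snd z - snd w) * h w = (if f w = \<alpha> + \<beta> * fst w + \<gamma> * snd w
        then (g w - \<beta>) * (moll \<delta> (fst z - fst w) * moll \<delta> (snd z - snd w)) else 0)"
      proof (cases "w \<in> Q")
        case False
        then have "w \<notin> sq z \<delta>" using sub by (auto simp: \<delta>_def)
        then show ?thesis using kernel_zero_outside_sq[OF mb mb, of w z] by (auto simp del: mult_eq_0_iff)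
      qed (simp add: h_def)
    qed
    then show ?thesis using level_set_deriv_tested[OF f g e weak A B, of \<alpha> \<beta> \<gamma>] by simp
  qed
  show ?thesis using \<rho>(2)
  proof eventually_elim
    case (elim z)
    show ?case
    proof (intro impI)
      assume z: "z \<in> {a1<..<b1} \<times> {a2<..<b2}" and lev: "f z = \<alpha> + \<beta> * fst z + \<gamma> * snd z"
      have "open ({a1<..<b1} \<times> {a2<..<b2})" by (intro open_Times) auto
      then obtain e where e: "e > 0" "sq z e \<subseteq> {a1<..<b1} \<times> {a2<..<b2}"
        using compact_open_sq[of "{z}"] z by auto
      have "(\<lambda>n. 1 / real (Suc (\<rho> n))) \<longlonglongrightarrow> 0"
        using LIMSEQ_subseq_LIMSEQ[OF LIMSEQ_Suc[OF lim_1_over_n] \<rho>(1)] by (simp add: o_def)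
      then have "\<forall>\<^sub>F n in sequentially. 1 / real (Suc (\<rho> n)) < e" using e by (intro order_tendstoD(2))
      then have "\<forall>\<^sub>F n in sequentially. moll_seq (\<rho> n) h z - h z = - h z"
      proof eventually_elim
        case (elim n)
        have "sq z (1 / Suc (\<rho> n)) \<subseteq> sq z e" using elim by (auto simp: sq_iff)
        also have "\<dots> \<subseteq> Q" using e(2) by (force simp: Q_def)
        finally show ?case using zero by simp
      qed
      then have "(\<lambda>n. moll_seq (\<rho> n) h z - h z) \<longlonglongrightarrow> - h z" by (rule tendsto_eventually)
      from LIMSEQ_unique[OF this elim] have "h z = 0" by simp
      moreover have "z \<in> Q" using z by (auto simp: Q_def)
      ultimately show "g z = \<beta>" using lev by (simp add: h_def)
    qed
  qed
qed

subsection \<open>Level sets in an open set\<close>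

definition loc_integrable :: "(real \<times> real) set \<Rightarrow> (real \<times> real \<Rightarrow> real) \<Rightarrow> bool" where
  "loc_integrable D f \<longleftrightarrow> (\<forall>S. compact S \<and> S \<subseteq> D \<longrightarrow> set_integrable lebesgue S f)"

lemma Lp_loc_2_loc_integrable:
  assumes D: "D \<in> sets lebesgue" and f: "Lp_loc 2 D f"
  shows "loc_integrable D f"
  unfolding loc_integrable_def
proof (intro allI impI)
  fix S assume S: "compact S \<and> S \<subseteq> D"
  then have S': "S \<in> sets lebesgue" by (simp add: lmeasurable_compact fmeasurableD)
  have fm: "f \<in> borel_measurable (lebesgue_on D)" using f by (simp add: Lp_loc_def)
  have "(\<lambda>z. if z \<in> D then f z else 0) \<in> borel_measurable lebesgue"
    using borel_measurable_if_I[OF fm D] .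
  then have "(\<lambda>z. indicator S z * (if z \<in> D then f z else 0)) \<in> borel_measurable lebesgue"
    using S' by (intro borel_measurable_times borel_measurable_indicator)
  moreover have "(\<lambda>z. indicator S z * (if z \<in> D then f z else 0)) = (\<lambda>z. indicator S z *\<^sub>R f z)"
    using S by (intro ext) (auto simp: indicator_def)
  ultimately have m: "(\<lambda>z. indicator S z *\<^sub>R f z) \<in> borel_measurable lebesgue" by simp
  have "set_integrable lebesgue S (\<lambda>z. \<bar>f z\<bar> powr 2)"
    using f S by (simp add: Lp_loc_def)
  moreover have "integrable lebesgue (\<lambda>z. indicator S z * (1::real))"
    using lmeasurable_compact[of S] S by (simp add: lmeasurable_iff_integrable)
  ultimately have "integrable lebesgue (\<lambda>z. indicator S z * (\<bar>f z\<bar> powr 2) + indicator S z * 1)"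
    by (auto simp: set_integrable_def)
  then show "set_integrable lebesgue S f"
    unfolding set_integrable_def
  proof (rule Bochner_Integration.integrable_bound[OF _ m])
    have "\<bar>x\<bar> \<le> x\<^sup>2 + 1" for x :: real
    proof -
      have "0 \<le> (\<bar>x\<bar> - 1)\<^sup>2" by simp
      then show ?thesis by (simp add: power2_diff)
    qed
    then show "AE z in lebesgue. norm (indicator S z *\<^sub>R f z) \<le> norm (indicator S z * (\<bar>f z\<bar> powr 2) + indicator S z * 1)"
      by (intro AE_I2) (auto simp: indicator_def)
  qed
qed

text \<open>Convolutions are measured on a product space by Fubini's theorem, which asks for Borel
  functions; the weak derivatives are only Lebesgue measurable.\<close>

lemma borel_representative:
  assumes "loc_integrable D f" "compact S" "S \<subseteq> D"
  obtains f1 where "integrable lborel f1" "AE z in lebesgue. f1 z = indicator S z * f z"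
proof -
  have i: "integrable lebesgue (\<lambda>z. indicator S z * f z)"
    using assms by (auto simp: loc_integrable_def set_integrable_def)
  obtain f1 where f1: "f1 \<in> borel_measurable lborel" "AE z in lborel. indicator S z * f z = f1 z"
    using completion_ex_borel_measurable_real[OF borel_measurable_integrable[OF i]] by blast
  have ae: "AE z in lebesgue. f1 z = indicator S z * f z"
    using AE_completion[OF f1(2)] by eventually_elim simp
  have "integrable lebesgue f1"
    by (rule integrable_cong_AE_imp[OF i measurable_completion[OF f1(1)]])
      (use ae in \<open>auto simp: eq_commute\<close>)
  then show ?thesis using that ae integrable_completion[OF f1(1)] by blast
qed

lemma set_integral_representative:
  fixes f f1 \<phi> :: "real \<times> real \<Rightarrow> real"
  assumes f1: "integrable lborel f1" "AE z in lebesgue. f1 z = indicator S z * f z"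
    and int: "integrable lebesgue (\<lambda>z. indicator S z * f z)"
    and S: "S \<subseteq> D" and \<phi>: "\<phi> \<in> borel_measurable borel" "\<And>z. z \<notin> S \<Longrightarrow> \<phi> z = 0"
  shows "(LINT z:D|lebesgue. f z * \<phi> z) = (LINT z|lborel. f1 z * \<phi> z)"
proof -
  have fm: "(\<lambda>z. f1 z * \<phi> z) \<in> borel_measurable lborel"
    using borel_measurable_times[OF borel_measurable_integrable[OF f1(1)], of \<phi>] \<phi>(1) by simp
  have fm': "(\<lambda>z. f1 z * \<phi> z) \<in> borel_measurable lebesgue" using fm by (rule measurable_completion)
  have eq: "(\<lambda>z. indicator D z *\<^sub>R (f z * \<phi> z)) = (\<lambda>z. (indicator S z * f z) * \<phi> z)"
    using S \<phi>(2) by (intro ext) (auto simp: indicator_def)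
  have \<phi>m: "\<phi> \<in> borel_measurable lebesgue"
    using \<phi>(1) by (intro measurable_completion) simp
  have "(LINT z:D|lebesgue. f z * \<phi> z) = (LINT z|lebesgue. f1 z * \<phi> z)"
    unfolding set_lebesgue_integral_def eq
  proof (rule integral_cong_AE[OF _ fm'])
    show "(\<lambda>z. (indicator S z * f z) * \<phi> z) \<in> borel_measurable lebesgue"
      by (rule borel_measurable_times[OF borel_measurable_integrable[OF int] \<phi>m])
    show "AE z in lebesgue. (indicator S z * f z) * \<phi> z = f1 z * \<phi> z"
      using f1(2) by eventually_elim simp
  qed
  also have "\<dots> = (LINT z|lborel. f1 z * \<phi> z)" by (rule integral_completion[OF fm])
  finally show ?thesis .
qed

lemma enlarged_box:
  fixes p q :: "real \<times> real"
  assumes D: "open D" and X: "X = cbox p q" "X \<subseteq> D" "X \<noteq> {}"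
  obtains e a1 b1 a2 b2 where "e > 0" "X \<subseteq> {a1<..<b1} \<times> {a2<..<b2}" "{a1 - e..b1 + e} \<times> {a2 - e..b2 + e} \<subseteq> D"
proof -
  obtain p1 p2 q1 q2 where pq: "p = (p1, p2)" "q = (q1, q2)" by (cases p, cases q)
  have Xeq: "X = {p1..q1} \<times> {p2..q2}" using X(1) by (simp add: pq cbox_Pair_eq)
  have ne: "p1 \<le> q1" "p2 \<le> q2" using X(3) Xeq by auto
  obtain e where e: "e > 0" "\<And>z. z \<in> X \<Longrightarrow> sq z e \<subseteq> D"
    using compact_open_sq[of X D] D X by auto
  show ?thesis
  proof
    show "e / 2 > 0" using e by simp
    show "X \<subseteq> {p1 - e / 2<..<q1 + e / 2} \<times> {p2 - e / 2<..<q2 + e / 2}"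
      using e(1) by (auto simp: Xeq)
    show "{p1 - e / 2 - e / 2..q1 + e / 2 + e / 2} \<times> {p2 - e / 2 - e / 2..q2 + e / 2 + e / 2} \<subseteq> D"
    proof
      fix w assume w: "w \<in> {p1 - e / 2 - e / 2..q1 + e / 2 + e / 2} \<times> {p2 - e / 2 - e / 2..q2 + e / 2 + e / 2}"
      define w' where "w' = (max p1 (min (fst w) q1), max p2 (min (snd w) q2))"
      have "w' \<in> X" using ne by (auto simp: w'_def Xeq)
      moreover have "w \<in> sq w' e" using w ne e(1) by (auto simp: w'_def sq_iff max_def min_def)
      ultimately show "w \<in> D" using e(2) by blast
    qed
  qed
qed

lemma AE_open_by_boxes:
  fixes D :: "(real \<times> real) set"
  assumes D: "open D"
    and box: "\<And>e a1 b1 a2 b2. e > 0 \<Longrightarrow> {a1 - e..b1 + e} \<times> {a2 - e..b2 + e} \<subseteq> D \<Longrightarrow>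
      AE z in lebesgue. z \<in> {a1<..<b1} \<times> {a2<..<b2} \<longrightarrow> P z"
  shows "AE z in lebesgue. z \<in> D \<longrightarrow> P z"
proof -
  obtain \<D> where \<D>: "countable \<D>" "\<D> \<subseteq> Pow D" "\<And>X. X \<in> \<D> \<Longrightarrow> \<exists>a b. X = cbox a b" "\<Union>\<D> = D"
    using open_countable_Union_open_cbox[OF D] by metis
  have "AE z in lebesgue. z \<in> X \<longrightarrow> P z" if X: "X \<in> \<D>" for X
  proof (cases "X = {}")
    case False
    obtain p q where "X = cbox p q" using \<D>(3)[OF X] by auto
    then obtain e a1 b1 a2 b2 where e: "e > 0" "X \<subseteq> {a1<..<b1} \<times> {a2<..<b2}"
        "{a1 - e..b1 + e} \<times> {a2 - e..b2 + e} \<subseteq> D"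
      using enlarged_box[OF D, of X p q] False \<D>(2) X by blast
    show ?thesis using box[OF e(1,3)] by eventually_elim (use e(2) in auto)
  qed simp
  then have "AE z in lebesgue. \<forall>X\<in>\<D>. z \<in> X \<longrightarrow> P z"
    by (subst AE_ball_countable[OF \<D>(1)]) auto
  then show ?thesis by eventually_elim (use \<D>(4) in auto)
qed

lemma AE_lborel_swap:
  fixes P :: "real \<times> real \<Rightarrow> bool"
  assumes P: "{z. P z} \<in> sets borel" and ae: "AE z in lborel. P (prod.swap z)"
  shows "AE z in lborel. P z"
proof -
  have "lborel = distr (lborel \<Otimes>\<^sub>M lborel) (lborel \<Otimes>\<^sub>M lborel) (\<lambda>(x, y). (y, x) :: real \<times> real)"
    using lborel_pair.distr_pair_swap by (simp add: lborel_prod)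
  then have eq: "(lborel :: (real \<times> real) measure) = distr lborel lborel (\<lambda>(x, y). (y, x))"
    by (simp add: lborel_prod)
  have m: "(\<lambda>(x, y). (y, x) :: real \<times> real) \<in> measurable lborel lborel"
  proof -
    have "continuous_on UNIV (\<lambda>z::real \<times> real. (snd z, fst z))" by (intro continuous_intros)
    from borel_measurable_continuous_onI[OF this] show ?thesis by (simp add: case_prod_unfold)
  qed
  have "AE z in distr lborel lborel (\<lambda>(x, y). (y, x)). P z"
    by (subst AE_distr_iff[OF m]) (use P ae in \<open>auto simp: prod.swap_def case_prod_unfold\<close>)
  then show ?thesis by (simp only: eq[symmetric])
qed

lemma weak_dx_level_set:
  assumes D: "open D" and f: "loc_integrable D f" and g: "loc_integrable D g" and weak: "weak_dx D f g"
  shows "AE z in lebesgue. z \<in> D \<longrightarrow> f z = \<alpha> + \<beta> * fst z + \<gamma> * snd z \<longrightarrow> g z = \<beta>"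
proof (rule AE_open_by_boxes[OF D])
  fix e a1 b1 a2 b2 :: real
  assume e: "e > 0" and sub: "{a1 - e..b1 + e} \<times> {a2 - e..b2 + e} \<subseteq> D"
  let ?S = "{a1 - e..b1 + e} \<times> {a2 - e..b2 + e}"
  have S: "compact ?S" by (intro compact_Times) auto
  obtain f1 where f1: "integrable lborel f1" "AE z in lebesgue. f1 z = indicator ?S z * f z"
    using borel_representative[OF f S sub] by blast
  obtain g1 where g1: "integrable lborel g1" "AE z in lebesgue. g1 z = indicator ?S z * g z"
    using borel_representative[OF g S sub] by blast
  have fi: "integrable lebesgue (\<lambda>z. indicator ?S z * f z)" and gi: "integrable lebesgue (\<lambda>z. indicator ?S z * g z)"
    using f g S sub by (auto simp: loc_integrable_def set_integrable_def)
  have "AE z in lborel. z \<in> {a1<..<b1} \<times> {a2<..<b2} \<longrightarrow> f1 z = \<alpha> + \<beta> * fst z + \<gamma> * snd z \<longrightarrow> g1 z = \<beta>"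
  proof (rule level_set_deriv_box[OF f1(1) g1(1) e])
    fix A B assume A: "A \<in> bump_on (a1 - e) (b1 + e)" and B: "B \<in> bump_on (a2 - e) (b2 + e)"
    have zero: "A (fst z) * B (snd z) = 0" "deriv A (fst z) * B (snd z) = 0" if "z \<notin> ?S" for z
      using that bump_on_zero[OF A, of "fst z"] bump_on_zero[OF bump_on_deriv[OF A], of "fst z"]
        bump_on_zero[OF B, of "snd z"] by (auto simp: mem_Times_iff)
    show "(LINT w|lborel. f1 w * (deriv A (fst w) * B (snd w))) = - (LINT w|lborel. g1 w * (A (fst w) * B (snd w)))"
    proof -
      have "(LINT z:D|lebesgue. f z * (deriv A (fst z) * B (snd z))) = (LINT w|lborel. f1 w * (deriv A (fst w) * B (snd w)))"
        by (rule set_integral_representative[OF f1 fi sub])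
          (use zero in \<open>auto intro!: borel_measurable_continuous_onI bump_product_continuous[OF bump_on_deriv[OF A] B]\<close>)
      moreover have "(LINT z:D|lebesgue. g z * (A (fst z) * B (snd z))) = (LINT w|lborel. g1 w * (A (fst w) * B (snd w)))"
        by (rule set_integral_representative[OF g1 gi sub])
          (use zero in \<open>auto intro!: borel_measurable_continuous_onI bump_product_continuous[OF A B]\<close>)
      ultimately show ?thesis using weak_dx_product[OF weak A B sub] by simp
    qed
  qed
  from AE_completion[OF this] show "AE z in lebesgue. z \<in> {a1<..<b1} \<times> {a2<..<b2} \<longrightarrow> f z = \<alpha> + \<beta> * fst z + \<gamma> * snd z \<longrightarrow> g z = \<beta>"
    using f1(2) g1(2) by eventually_elim (use e in \<open>auto simp: indicator_def\<close>)
qed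

text \<open>Exchanging the two coordinates reduces this to the other direction.\<close>

lemma weak_dt_level_set:
  assumes D: "open D" and f: "loc_integrable D f" and g: "loc_integrable D g" and weak: "weak_dt D f g"
  shows "AE z in lebesgue. z \<in> D \<longrightarrow> f z = \<alpha> + \<beta> * fst z + \<gamma> * snd z \<longrightarrow> g z = \<gamma>"
proof (rule AE_open_by_boxes[OF D])
  fix e a1 b1 a2 b2 :: real
  assume e: "e > 0" and sub: "{a1 - e..b1 + e} \<times> {a2 - e..b2 + e} \<subseteq> D"
  let ?S = "{a1 - e..b1 + e} \<times> {a2 - e..b2 + e}"
  have S: "compact ?S" by (intro compact_Times) auto
  obtain f1 where f1: "integrable lborel f1" "AE z in lebesgue. f1 z = indicator ?S z * f z"
    using borel_representative[OF f S sub] by blast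
  obtain g1 where g1: "integrable lborel g1" "AE z in lebesgue. g1 z = indicator ?S z * g z"
    using borel_representative[OF g S sub] by blast
  have fi: "integrable lebesgue (\<lambda>z. indicator ?S z * f z)" and gi: "integrable lebesgue (\<lambda>z. indicator ?S z * g z)"
    using f g S sub by (auto simp: loc_integrable_def set_integrable_def)
  have "AE z in lborel. z \<in> {a2<..<b2} \<times> {a1<..<b1} \<longrightarrow>
      f1 (prod.swap z) = \<alpha> + \<gamma> * fst z + \<beta> * snd z \<longrightarrow> g1 (prod.swap z) = \<gamma>"
  proof (rule level_set_deriv_box[OF integrable_swap_lborel[OF f1(1)] integrable_swap_lborel[OF g1(1)] e])
    fix B A assume B: "B \<in> bump_on (a2 - e) (b2 + e)" and A: "A \<in> bump_on (a1 - e) (b1 + e)"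
    have zero: "A (fst z) * B (snd z) = 0" "A (fst z) * deriv B (snd z) = 0" if "z \<notin> ?S" for z
      using that bump_on_zero[OF A, of "fst z"] bump_on_zero[OF bump_on_deriv[OF B], of "snd z"]
        bump_on_zero[OF B, of "snd z"] by (auto simp: mem_Times_iff)
    have sw: "(LINT w|lborel. h (prod.swap w) * (B' (fst w) * A (snd w))) = (LINT w|lborel. h w * (A (fst w) * B' (snd w)))"
      if h: "integrable lborel h" and B': "B' \<in> bump_on (a2 - e) (b2 + e)" for h B'
    proof -
      obtain C where C: "C \<ge> 0" "\<And>z. \<bar>A (fst z) * B' (snd z)\<bar> \<le> C"
      proof -
        obtain CA CB where "CA \<ge> 0" "\<And>x. \<bar>A x\<bar> \<le> CA" "CB \<ge> 0" "\<And>x. \<bar>B' x\<bar> \<le> CB"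
          using bump_on_bounded[OF A] bump_on_bounded[OF B'] by metis
        then have "CA * CB \<ge> 0" "\<And>z. \<bar>A (fst z) * B' (snd z)\<bar> \<le> CA * CB"
          by (auto simp: abs_mult intro!: mult_mono)
        then show ?thesis using that by blast
      qed
      have "integrable lborel (\<lambda>w. h w * (A (fst w) * B' (snd w)))"
      proof (rule Bochner_Integration.integrable_bound[OF integrable_mult_right[OF h, of C]])
        have "(\<lambda>w. A (fst w) * B' (snd w)) \<in> borel_measurable lborel"
          using borel_measurable_continuous_onI[OF bump_product_continuous[OF A B']] by simp
        then show "(\<lambda>w. h w * (A (fst w) * B' (snd w))) \<in> borel_measurable lborel"
          by (rule borel_measurable_times[OF borel_measurable_integrable[OF h]])
        have "\<bar>h w * (A (fst w) * B' (snd w))\<bar> \<le> \<bar>C * h w\<bar>" for w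
          unfolding abs_mult[of "h w"] abs_mult[of C] using C
          by (subst mult.commute) (intro mult_right_mono, auto)
        then show "AE w in lborel. norm (h w * (A (fst w) * B' (snd w))) \<le> norm (C * h w)" by simp
      qed
      from integral_swap_lborel[OF this] show ?thesis by (simp add: mult.commute)
    qed
    show "(LINT w|lborel. f1 (prod.swap w) * (deriv B (fst w) * A (snd w))) = - (LINT w|lborel. g1 (prod.swap w) * (B (fst w) * A (snd w)))"
    proof -
      have "(LINT z:D|lebesgue. f z * (A (fst z) * deriv B (snd z))) = (LINT w|lborel. f1 w * (A (fst w) * deriv B (snd w)))"
        by (rule set_integral_representative[OF f1 fi sub])
          (use zero in \<open>auto intro!: borel_measurable_continuous_onI bump_product_continuous[OF A bump_on_deriv[OF B]]\<close>)
      moreover have "(LINT z:D|lebesgue. g z * (A (fst z) * B (snd z))) = (LINT w|lborel. g1 w * (A (fst w) * B (snd w)))"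
        by (rule set_integral_representative[OF g1 gi sub])
          (use zero in \<open>auto intro!: borel_measurable_continuous_onI bump_product_continuous[OF A B]\<close>)
      ultimately show ?thesis
        unfolding sw[OF f1(1) bump_on_deriv[OF B]] sw[OF g1(1) B]
        using weak_dt_product[OF weak A B sub] by simp
    qed
  qed
  then have sw: "AE z in lborel. prod.swap z \<in> {a1<..<b1} \<times> {a2<..<b2} \<longrightarrow>
      f1 (prod.swap z) = \<alpha> + \<beta> * fst (prod.swap z) + \<gamma> * snd (prod.swap z) \<longrightarrow> g1 (prod.swap z) = \<gamma>"
    by eventually_elim (auto simp: algebra_simps)
  have "AE z in lborel. z \<in> {a1<..<b1} \<times> {a2<..<b2} \<longrightarrow> f1 z = \<alpha> + \<beta> * fst z + \<gamma> * snd z \<longrightarrow> g1 z = \<gamma>"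
  proof (rule AE_lborel_swap[OF _ sw])
    have [measurable]: "f1 \<in> borel_measurable borel" "g1 \<in> borel_measurable borel"
      using borel_measurable_integrable[OF f1(1)] borel_measurable_integrable[OF g1(1)] by simp_all
    have [measurable]: "(\<lambda>z::real \<times> real. \<alpha> + \<beta> * fst z + \<gamma> * snd z) \<in> borel_measurable borel"
      by (intro borel_measurable_continuous_onI continuous_intros)
    have [measurable]: "{a1<..<b1} \<times> {a2<..<b2} \<in> sets borel"
      by (intro borel_open open_Times) auto
    show "{z. z \<in> {a1<..<b1} \<times> {a2<..<b2} \<longrightarrow> f1 z = \<alpha> + \<beta> * fst z + \<gamma> * snd z \<longrightarrow> g1 z = \<gamma>} \<in> sets borel"
      by measurable
  qed
  from AE_completion[OF this] show "AE z in lebesgue. z \<in> {a1<..<b1} \<times> {a2<..<b2} \<longrightarrow> f z = \<alpha> + \<beta> * fst z + \<gamma> * snd z \<longrightarrow> g z = \<gamma>"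
    using f1(2) g1(2) by eventually_elim (use e in \<open>auto simp: indicator_def\<close>)
qed

section \<open>The bond equation in logarithmic coordinates\<close>

lemma integral_exp_substitution:
  fixes h :: "real \<Rightarrow> real"
  assumes h: "continuous_on {exp c..exp d} h" and cd: "c \<le> d"
  shows "(LINT x|lborel. h x * indicator {exp c..exp d} x) = (LINT y|lborel. h (exp y) * exp y * indicator {c..d} y)"
proof (rule integral_substitution(2))
  show "set_integrable lborel {exp c..exp d} h"
    unfolding set_integrable_def by (intro borel_integrable_compact h) auto
qed (use cd in \<open>auto intro!: derivative_eq_intros continuous_intros\<close>)

text \<open>The kernel \<open>k (y - ln x) / x\<close> in the price variable; the factor \<open>1 /
  x\<close> is the Jacobian of \<open>x = exp y\<close>.\<close>

definition log_kernel :: "(real \<Rightarrow> real) \<Rightarrow> real \<Rightarrow> real \<Rightarrow> real" where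
  "log_kernel k y = log_pullback (\<lambda>\<eta>. exp (- 1 * \<eta>) * k (y - \<eta>))"

lemma log_kernel_bump:
  assumes "k \<in> bump_on (-\<delta>) \<delta>"
  shows "log_kernel k y \<in> bump_on (exp (y - \<delta>)) (exp (y + \<delta>))"
  unfolding log_kernel_def
  by (rule log_pullback_bump[OF bump_on_mult[OF bump_on_reflect[OF assms] smooth_line_exp_cmult]])

text \<open>The image of the square \<open>sq z \<delta>\<close> under the exponential map in the first coordinate.\<close>

definition exp_sq :: "real \<times> real \<Rightarrow> real \<Rightarrow> (real \<times> real) set" where
  "exp_sq z \<delta> = {exp (fst z - \<delta>)..exp (fst z + \<delta>)} \<times> {snd z - \<delta>..snd z + \<delta>}"

lemma compact_exp_sq: "compact (exp_sq z \<delta>)"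
  by (simp add: exp_sq_def compact_Times)

lemma exp_sq_sq: "(exp y, s) \<in> exp_sq z \<delta> \<longleftrightarrow> (y, s) \<in> sq z \<delta>"
  by (simp add: exp_sq_def sq_def)

lemma conv_log_lborel:
  fixes u :: "real \<times> real \<Rightarrow> real"
  assumes k: "k \<in> bump_on (-\<delta>) \<delta>" and l: "l \<in> bump_on (-\<delta>) \<delta>" and \<delta>: "\<delta> > 0"
    and u: "continuous_on (exp_sq z \<delta>) u"
  shows "conv k l (\<lambda>w. u (exp (fst w), snd w)) z =
    (LINT x|lborel. u x * (log_kernel k (fst z) (fst x) * l (snd z - snd x)))"
proof -
  let ?I = "\<lambda>w. k (fst z - fst w) * l (snd z - snd w) * u (exp (fst w), snd w)"
  let ?J = "\<lambda>x. u x * (log_kernel k (fst z) (fst x) * l (snd z - snd x))"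
  note lk = log_kernel_bump[OF k, of "fst z"]
  note lr = bump_on_reflect[OF l, of "snd z"]
  have uexp: "continuous_on (sq z \<delta>) (\<lambda>w. u (exp (fst w), snd w))"
    by (rule continuous_on_compose2[OF u]) (auto intro!: continuous_intros simp: exp_sq_sq)
  have I: "integrable lborel ?I" by (rule conv_local_integrable[OF k l uexp])
  have J: "integrable lborel ?J"
  proof -
    have "integrable lborel (\<lambda>x. indicator (exp_sq z \<delta>) x * ?J x)"
      by (intro integrable_indicator_continuous compact_exp_sq continuous_on_mult u
          bump_product_continuous[OF lk lr])
    moreover have "indicator (exp_sq z \<delta>) x * ?J x = ?J x" for x
      using bump_on_zero[OF lk, of "fst x"] bump_on_zero[OF lr, of "snd x"]
      by (cases "x \<in> exp_sq z \<delta>") (auto simp: exp_sq_def mem_Times_iff)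
    ultimately show ?thesis by simp
  qed
  have I': "integrable (lborel \<Otimes>\<^sub>M lborel) (case_prod (\<lambda>y s. ?I (y, s)))"
    and J': "integrable (lborel \<Otimes>\<^sub>M lborel) (case_prod (\<lambda>y s. ?J (y, s)))"
    using I J by (simp_all add: lborel_prod case_prod_unfold)
  have inner: "(LINT y|lborel. ?I (y, s)) = (LINT x|lborel. ?J (x, s))" for s
  proof (cases "s \<in> {snd z - \<delta>..snd z + \<delta>}")
    case False
    then have "l (snd z - s) = 0" using bump_on_zero[OF lr] by simp
    then show ?thesis by simp
  next
    case True
    let ?h = "\<lambda>x. u (x, s) * (k (fst z - ln x) / x * l (snd z - s))"
    let ?c = "fst z - \<delta>" and ?d = "fst z + \<delta>"
    have pos: "x > 0" if "x \<in> {exp ?c..exp ?d}" for x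
      using that less_le_trans[OF exp_gt_zero[of ?c]] by simp
    have cont: "continuous_on {exp ?c..exp ?d} ?h"
    proof (intro continuous_intros continuous_on_compose2[OF u] continuous_on_compose2[OF bump_on_continuous[OF k, of UNIV]])
      show "(\<lambda>x. (x, s)) ` {exp ?c..exp ?d} \<subseteq> exp_sq z \<delta>" using True by (auto simp: exp_sq_def)
    qed (use pos in \<open>force+\<close>)
    have "(LINT x|lborel. ?J (x, s)) = (LINT x|lborel. ?h x * indicator {exp ?c..exp ?d} x)"
    proof (intro Bochner_Integration.integral_cong refl)
      fix x
      show "?J (x, s) = ?h x * indicator {exp ?c..exp ?d} x"
      proof (cases "x \<in> {exp ?c..exp ?d}")
        case True
        then show ?thesis using pos[OF True]
          by (simp add: log_kernel_def log_pullback_def exp_minus field_simps)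
      next
        case False
        then show ?thesis using bump_on_zero[OF lk, of x] by (simp add: indicator_def)
      qed
    qed
    also have "\<dots> = (LINT y|lborel. ?h (exp y) * exp y * indicator {?c..?d} y)"
      by (rule integral_exp_substitution[OF cont]) (use \<delta> in simp)
    also have "\<dots> = (LINT y|lborel. ?I (y, s))"
    proof (intro Bochner_Integration.integral_cong refl)
      fix y
      show "?h (exp y) * exp y * indicator {?c..?d} y = ?I (y, s)"
        using bump_on_zero[OF k, of "fst z - y"] by (cases "y \<in> {?c..?d}") (auto simp: indicator_def)
    qed
    finally show ?thesis by simp
  qed
  have "conv k l (\<lambda>w. u (exp (fst w), snd w)) z = (LINT w|lborel. ?I w)" by (simp add: conv_def)
  also have "\<dots> = (LINT s|lborel. LINT y|lborel. ?I (y, s))"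
    using lborel_pair.integral_snd[OF I'] by (simp add: lborel_prod case_prod_unfold)
  also have "\<dots> = (LINT s|lborel. LINT x|lborel. ?J (x, s))" by (simp only: inner)
  also have "\<dots> = (LINT x|lborel. ?J x)"
    using lborel_pair.integral_snd[OF J'] by (simp add: lborel_prod case_prod_unfold)
  finally show ?thesis .
qed

lemma set_integrable_tested:
  fixes f \<phi> :: "real \<times> real \<Rightarrow> real"
  assumes f: "loc_integrable D f" and S: "compact S" "S \<subseteq> D"
    and \<phi>: "continuous_on UNIV \<phi>" "\<And>z. z \<notin> S \<Longrightarrow> \<phi> z = 0"
  shows "set_integrable lebesgue D (\<lambda>z. f z * \<phi> z)"
proof -
  have int: "integrable lebesgue (\<lambda>z. indicator S z * f z)"
    using f S by (auto simp: loc_integrable_def set_integrable_def)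
  have "bounded (\<phi> ` S)"
    by (intro compact_imp_bounded compact_continuous_image continuous_on_subset[OF \<phi>(1)] S) auto
  then obtain C where C: "\<And>z. z \<in> S \<Longrightarrow> \<bar>\<phi> z\<bar> \<le> C" unfolding bounded_real by auto
  have \<phi>m: "\<phi> \<in> borel_measurable lebesgue"
    using borel_measurable_continuous_onI[OF \<phi>(1)] by (intro measurable_completion) simp
  have "integrable lebesgue (\<lambda>z. (indicator S z * f z) * \<phi> z)"
  proof (rule Bochner_Integration.integrable_bound[OF integrable_mult_right[OF int, of C]])
    show "(\<lambda>z. (indicator S z * f z) * \<phi> z) \<in> borel_measurable lebesgue"
      by (rule borel_measurable_times[OF borel_measurable_integrable[OF int] \<phi>m])
    have "\<bar>(indicator S z * f z) * \<phi> z\<bar> \<le> \<bar>C * (indicator S z * f z)\<bar>" for z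
    proof (cases "z \<in> S")
      case True
      then have "\<bar>\<phi> z\<bar> \<le> \<bar>C\<bar>" using C[OF True] by linarith
      then show ?thesis using True by (simp add: abs_mult mult.commute[of "\<bar>f z\<bar>"] mult_right_mono)
    qed simp
    then show "AE z in lebesgue. norm ((indicator S z * f z) * \<phi> z) \<le> norm (C * (indicator S z * f z))"
      by simp
  qed
  moreover have "(\<lambda>z. (indicator S z * f z) * \<phi> z) = (\<lambda>z. indicator D z *\<^sub>R (f z * \<phi> z))"
    using S \<phi>(2) by (intro ext) (auto simp: indicator_def)
  ultimately show ?thesis by (simp add: set_integrable_def)
qed

lemma conv_log:
  fixes u :: "real \<times> real \<Rightarrow> real"
  assumes k: "k \<in> bump_on (-\<delta>) \<delta>" and l: "l \<in> bump_on (-\<delta>) \<delta>" and \<delta>: "\<delta> > 0"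
    and u: "continuous_on D u" and sub: "exp_sq z \<delta> \<subseteq> D"
  shows "conv k l (\<lambda>w. u (exp (fst w), snd w)) z =
    (LINT x:D|lebesgue. u x * (log_kernel k (fst z) (fst x) * l (snd z - snd x)))"
proof -
  let ?J = "\<lambda>x. u x * (log_kernel k (fst z) (fst x) * l (snd z - snd x))"
  note lk = log_kernel_bump[OF k, of "fst z"]
  note lr = bump_on_reflect[OF l, of "snd z"]
  have cont: "continuous_on (exp_sq z \<delta>) u" by (rule continuous_on_subset[OF u sub])
  have "integrable lborel (\<lambda>x. indicator (exp_sq z \<delta>) x * ?J x)"
    by (intro integrable_indicator_continuous compact_exp_sq continuous_on_mult cont
        bump_product_continuous[OF lk lr])
  moreover have J: "indicator (exp_sq z \<delta>) x * ?J x = ?J x" for x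
    using bump_on_zero[OF lk, of "fst x"] bump_on_zero[OF lr, of "snd x"]
    by (cases "x \<in> exp_sq z \<delta>") (auto simp: exp_sq_def mem_Times_iff)
  ultimately have m: "?J \<in> borel_measurable lborel" by (simp add: borel_measurable_integrable)
  have "(\<lambda>x. indicator D x *\<^sub>R ?J x) = ?J"
  proof
    show "indicator D x *\<^sub>R ?J x = ?J x" for x
      using J[of x] sub by (cases "x \<in> exp_sq z \<delta>") auto
  qed
  then have "(LINT x:D|lebesgue. ?J x) = (LINT x|lebesgue. ?J x)"
    unfolding set_lebesgue_integral_def by (rule arg_cong)
  also have "\<dots> = (LINT x|lborel. ?J x)" by (rule integral_completion[OF m])
  finally show ?thesis using conv_log_lborel[OF k l \<delta> cont] by simp
qed

lemma log_pullback_deriv: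
  assumes "\<beta> \<in> bump_on l u"
  shows "deriv (log_pullback \<beta>) = log_pullback (\<lambda>y. exp (- 1 * y) * deriv \<beta> y)"
  by (intro ext DERIV_imp_deriv log_pullback_has_deriv[OF assms])

text \<open>The mollified equation is the equation tested with the kernel in the price variable. With
  \<open>\<kappa>\<close> the kernel in logarithmic coordinates, the three test functions
  \<open>A0 = \<kappa> / x\<close>, \<open>A1 = x A0\<close> and \<open>A2 = x\<^sup>2 A0\<close>
  absorb the coefficients of the operator, and integrating \<open>V\<^sub>x\<^sub>x A2\<close> by
  parts twice produces the first order term that changes \<open>r - q\<close> to \<open>r - q -
  \<sigma>\<^sup>2 / 2\<close>.\<close>

lemma conv_op_eq_tested:
  assumes D: "open D" and V: "continuous_on D V" "loc_integrable D V"
    and li: "loc_integrable D Vx" "loc_integrable D Vxx" "loc_integrable D Vt"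
    and wx: "weak_dx D V Vx" and wxx: "weak_dx D Vx Vxx" and wt: "weak_dt D V Vt"
    and \<delta>: "\<delta> > 0" and sub: "exp_sq z \<delta> \<subseteq> D"
  shows "conv_op (\<sigma>\<^sup>2 / 2) (r - q - \<sigma>\<^sup>2 / 2) r \<delta> (\<lambda>w. V (exp (fst w), snd w)) z =
    (LINT x:D|lebesgue. cb_op \<sigma> r q V Vx Vxx Vt x * (log_kernel (moll \<delta>) (fst z) (fst x) * moll \<delta> (snd z - snd x)))"
proof -
  obtain y s where z: "z = (y, s)" by (cases z)
  define \<rho> where "\<rho> = moll \<delta>"
  note b0 = moll_bump[OF \<delta>, folded \<rho>_def]
  note b1 = bump_on_deriv[OF b0]
  note b2 = bump_on_deriv[OF b1]
  define A0 where "A0 = log_kernel \<rho> y"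
  define A1 where "A1 = log_pullback (\<lambda>\<eta>. \<rho> (y - \<eta>))"
  define A2 where "A2 = log_pullback (\<lambda>\<eta>. exp (1 * \<eta>) * \<rho> (y - \<eta>))"
  define B where "B = (\<lambda>t. \<rho> (s - t))"
  let ?l1 = "exp (y - \<delta>)" and ?u1 = "exp (y + \<delta>)"
  note r0 = bump_on_reflect[OF b0, of y]
  note r1 = bump_on_reflect[OF b1, of y]
  have A0: "A0 \<in> bump_on ?l1 ?u1" unfolding A0_def by (rule log_kernel_bump[OF b0])
  have A1: "A1 \<in> bump_on ?l1 ?u1" unfolding A1_def by (rule log_pullback_bump[OF r0])
  have A2: "A2 \<in> bump_on ?l1 ?u1"
    unfolding A2_def by (rule log_pullback_bump[OF bump_on_mult[OF r0 smooth_line_exp_cmult]])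
  have B: "B \<in> bump_on (s - \<delta>) (s + \<delta>)" unfolding B_def by (rule bump_on_reflect[OF b0])
  have sub': "{?l1..?u1} \<times> {s - \<delta>..s + \<delta>} \<subseteq> D" using sub by (simp add: exp_sq_def z)
  have dB: "deriv B t = - deriv \<rho> (s - t)" for t unfolding B_def by (rule deriv_reflect[OF b0])
  have dA1: "deriv A1 x = - log_kernel (deriv \<rho>) y x" for x
    unfolding A1_def log_pullback_deriv[OF r0] deriv_reflect[OF b0]
    by (simp add: log_kernel_def log_pullback_def)
  have d2: "deriv (\<lambda>\<eta>. exp (1 * \<eta>) * \<rho> (y - \<eta>)) \<eta> = exp (1 * \<eta>) * (\<rho> (y - \<eta>) - deriv \<rho> (y - \<eta>))" for \<eta>
  proof (rule DERIV_imp_deriv)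
    have "((\<lambda>\<eta>. \<rho> (y - \<eta>)) has_real_derivative - deriv \<rho> (y - \<eta>)) (at \<eta>)"
      using bump_on_has_deriv[OF r0, of \<eta>] by (simp add: deriv_reflect[OF b0])
    then show "((\<lambda>\<eta>. exp (1 * \<eta>) * \<rho> (y - \<eta>)) has_real_derivative exp (1 * \<eta>) * (\<rho> (y - \<eta>) - deriv \<rho> (y - \<eta>))) (at \<eta>)"
      by (auto intro!: derivative_eq_intros simp: algebra_simps)
  qed
  define A3 where "A3 = log_pullback (\<lambda>\<eta>. deriv \<rho> (y - \<eta>))"
  have A3: "A3 \<in> bump_on ?l1 ?u1" unfolding A3_def by (rule log_pullback_bump[OF r1])
  have dA2: "deriv A2 x = A1 x - A3 x" for x
    unfolding A2_def log_pullback_deriv[OF bump_on_mult[OF r0 smooth_line_exp_cmult]] d2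
    by (simp add: A1_def A3_def log_pullback_def exp_minus field_simps)
  have dA3: "deriv A3 x = - log_kernel (deriv (deriv \<rho>)) y x" for x
    unfolding A3_def log_pullback_deriv[OF r1] deriv_reflect[OF b1]
    by (simp add: log_kernel_def log_pullback_def)
  note cl = conv_log[OF _ _ \<delta> V(1) sub]
  let ?v = "\<lambda>w. V (exp (fst w), snd w)"
  have c0: "conv \<rho> \<rho> ?v z = (LINT x:D|lebesgue. V x * (A0 (fst x) * B (snd x)))"
    using cl[OF b0 b0] by (simp add: A0_def B_def z)
  have ct: "conv \<rho> (deriv \<rho>) ?v z = (LINT x:D|lebesgue. Vt x * (A0 (fst x) * B (snd x)))"
    using cl[OF b0 b1] weak_dt_product[OF wt A0 B sub']
    by (simp add: A0_def dB z set_lebesgue_integral_def)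
  have c1: "conv (deriv \<rho>) \<rho> ?v z = (LINT x:D|lebesgue. Vx x * (A1 (fst x) * B (snd x)))"
    using cl[OF b1 b0] weak_dx_product[OF wx A1 B sub']
    by (simp add: B_def dA1 z set_lebesgue_integral_def)
  have c2: "conv (deriv (deriv \<rho>)) \<rho> ?v z = (LINT x:D|lebesgue. Vx x * (A3 (fst x) * B (snd x)))"
    using cl[OF b2 b0] weak_dx_product[OF wx A3 B sub']
    by (simp add: B_def dA3 z set_lebesgue_integral_def)
  define S where "S = {?l1..?u1} \<times> {s - \<delta>..s + \<delta>}"
  have S: "compact S" "S \<subseteq> D" using sub' by (auto simp: S_def compact_Times)
  have tested: "set_integrable lebesgue D (\<lambda>x. f x * (A (fst x) * B (snd x)))"
    if f: "loc_integrable D f" and A: "A \<in> bump_on ?l1 ?u1" for f A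
  proof (rule set_integrable_tested[OF f S bump_product_continuous[OF A B]])
    show "A (fst x) * B (snd x) = 0" if "x \<notin> S" for x
      using that bump_on_zero[OF A, of "fst x"] bump_on_zero[OF B, of "snd x"] by (auto simp: S_def mem_Times_iff)
  qed
  have c2': "(LINT x:D|lebesgue. Vxx x * (A2 (fst x) * B (snd x))) =
      conv (deriv (deriv \<rho>)) \<rho> ?v z - conv (deriv \<rho>) \<rho> ?v z"
  proof -
    have "(LINT x:D|lebesgue. Vx x * (deriv A2 (fst x) * B (snd x))) =
        (LINT x:D|lebesgue. Vx x * (A1 (fst x) * B (snd x)) - Vx x * (A3 (fst x) * B (snd x)))"
      by (simp add: dA2 algebra_simps)
    also have "\<dots> = conv (deriv \<rho>) \<rho> ?v z - conv (deriv (deriv \<rho>)) \<rho> ?v z"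
      unfolding c1 c2 by (rule set_integral_diff(2)[OF tested[OF li(1) A1] tested[OF li(1) A3]])
    finally show ?thesis using weak_dx_product[OF wxx A2 B sub'] by simp
  qed
  have pt: "cb_op \<sigma> r q V Vx Vxx Vt x * (A0 (fst x) * B (snd x)) =
      r * (V x * (A0 (fst x) * B (snd x))) - Vt x * (A0 (fst x) * B (snd x))
      - \<sigma>\<^sup>2 / 2 * (Vxx x * (A2 (fst x) * B (snd x))) - (r - q) * (Vx x * (A1 (fst x) * B (snd x)))" for x
  proof -
    have "A1 (fst x) = fst x * A0 (fst x)" "A2 (fst x) = (fst x)\<^sup>2 * A0 (fst x)"
      by (auto simp: A0_def A1_def A2_def log_kernel_def log_pullback_def exp_minus power2_eq_square)
    then show ?thesis by (simp add: cb_op_def algebra_simps)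
  qed
  have "(LINT x:D|lebesgue. cb_op \<sigma> r q V Vx Vxx Vt x * (A0 (fst x) * B (snd x))) =
      r * conv \<rho> \<rho> ?v z - conv \<rho> (deriv \<rho>) ?v z
      - \<sigma>\<^sup>2 / 2 * (conv (deriv (deriv \<rho>)) \<rho> ?v z - conv (deriv \<rho>) \<rho> ?v z) - (r - q) * conv (deriv \<rho>) \<rho> ?v z"
    using tested[OF V(2) A0] tested[OF li(3) A0] tested[OF li(2) A2] tested[OF li(1) A1]
    by (simp add: pt set_integral_diff set_integrable_mult_right c0 ct c2' c1)
  also have "\<dots> = conv_op (\<sigma>\<^sup>2 / 2) (r - q - \<sigma>\<^sup>2 / 2) r \<delta> ?v z"
    by (simp add: conv_op_def \<rho>_def algebra_simps)
  finally show ?thesis by (simp add: A0_def B_def z \<rho>_def)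
qed

lemma exp_sq_subset:
  assumes "sq z \<delta> \<subseteq> A" "x \<in> exp_sq z \<delta>"
  shows "fst x > 0" "(ln (fst x), snd x) \<in> A"
proof -
  have b: "exp (fst z - \<delta>) \<le> fst x" "fst x \<le> exp (fst z + \<delta>)" "snd z - \<delta> \<le> snd x" "snd x \<le> snd z + \<delta>"
    using assms(2) by (auto simp: exp_sq_def mem_Times_iff)
  show pos: "fst x > 0" using less_le_trans[OF exp_gt_zero b(1)] .
  have "fst z - \<delta> \<le> ln (fst x)" using b(1) ln_ge_iff[OF pos] by simp
  moreover have "ln (fst x) \<le> fst z + \<delta>"
    using b(2) exp_le_cancel_iff[of "ln (fst x)" "fst z + \<delta>"] exp_ln[OF pos] by simp
  ultimately have "(ln (fst x), snd x) \<in> sq z \<delta>" using b by (auto simp: sq_def)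
  then show "(ln (fst x), snd x) \<in> A" using assms(1) by blast
qed

text \<open>The kernel is nonnegative and has integral one, so a bound for the operator almost everywhere on
  the support is inherited by the mollified equation.\<close>

lemma conv_op_bounds:
  fixes \<sigma> r q k :: real and V Vx Vxx Vt :: "real \<times> real \<Rightarrow> real"
  assumes D: "open D" and V: "continuous_on D V" "loc_integrable D V"
    and li: "loc_integrable D Vx" "loc_integrable D Vxx" "loc_integrable D Vt"
    and wx: "weak_dx D V Vx" and wxx: "weak_dx D Vx Vxx" and wt: "weak_dt D V Vt"
    and \<delta>: "\<delta> > 0" and sub: "exp_sq z \<delta> \<subseteq> D"
  defines "L \<equiv> cb_op \<sigma> r q V Vx Vxx Vt"
  shows "(AE x in lebesgue. x \<in> exp_sq z \<delta> \<longrightarrow> k \<le> L x) \<Longrightarrow>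
      k \<le> conv_op (\<sigma>\<^sup>2 / 2) (r - q - \<sigma>\<^sup>2 / 2) r \<delta> (\<lambda>w. V (exp (fst w), snd w)) z"
    and "(AE x in lebesgue. x \<in> exp_sq z \<delta> \<longrightarrow> L x \<le> k) \<Longrightarrow>
      conv_op (\<sigma>\<^sup>2 / 2) (r - q - \<sigma>\<^sup>2 / 2) r \<delta> (\<lambda>w. V (exp (fst w), snd w)) z \<le> k"
proof -
  define \<phi> where "\<phi> x = log_kernel (moll \<delta>) (fst z) (fst x) * moll \<delta> (snd z - snd x)" for x :: "real \<times> real"
  note mb = moll_bump[OF \<delta>]
  have \<phi>c: "continuous_on U \<phi>" for U
    unfolding \<phi>_def by (rule bump_product_continuous[OF log_kernel_bump[OF mb] bump_on_reflect[OF mb]])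
  have \<phi>0: "\<phi> x \<ge> 0" for x
    using moll_nonneg[OF \<delta>] by (simp add: \<phi>_def log_kernel_def log_pullback_def)
  have \<phi>z: "\<phi> x = 0" if "x \<notin> exp_sq z \<delta>" for x
    using that bump_on_zero[OF log_kernel_bump[OF mb, of "fst z"], of "fst x"]
      bump_on_zero[OF bump_on_reflect[OF mb, of "snd z"], of "snd x"]
    by (auto simp: \<phi>_def exp_sq_def mem_Times_iff)
  have li1: "loc_integrable D (\<lambda>x. 1)"
    unfolding loc_integrable_def set_integrable_def
    using lmeasurable_compact by (auto simp: lmeasurable_iff_integrable)
  have one: "(LINT x:D|lebesgue. k * \<phi> x) = k" for k
  proof -
    have "(LINT x:D|lebesgue. (\<lambda>x. k) x * \<phi> x) = conv (moll \<delta>) (moll \<delta>) (\<lambda>w. (\<lambda>x. k) (exp (fst w), snd w)) z"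
      unfolding \<phi>_def by (rule conv_log[OF mb mb \<delta> continuous_on_const sub, symmetric])
    then show ?thesis by (simp add: conv_moll_const[OF \<delta>])
  qed
  have i1: "set_integrable lebesgue D (\<lambda>x. k * \<phi> x)" for k
    using set_integrable_tested[OF li1 compact_exp_sq sub \<phi>c \<phi>z] by (intro set_integrable_mult_right) simp
  have iL: "set_integrable lebesgue D (\<lambda>x. L x * \<phi> x)"
  proof -
    have c1: "continuous_on UNIV (\<lambda>x. fst x * \<phi> x)" "continuous_on UNIV (\<lambda>x. (fst x)\<^sup>2 * \<phi> x)"
      by (intro continuous_intros \<phi>c)+
    note t = set_integrable_tested[OF _ compact_exp_sq sub]
    have t0: "set_integrable lebesgue D (\<lambda>x. V x * \<phi> x)" by (rule t[OF V(2) \<phi>c]) (use \<phi>z in auto)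
    have t1: "set_integrable lebesgue D (\<lambda>x. Vt x * \<phi> x)" by (rule t[OF li(3) \<phi>c]) (use \<phi>z in auto)
    have t2: "set_integrable lebesgue D (\<lambda>x. Vx x * (fst x * \<phi> x))" by (rule t[OF li(1) c1(1)]) (use \<phi>z in auto)
    have t3: "set_integrable lebesgue D (\<lambda>x. Vxx x * ((fst x)\<^sup>2 * \<phi> x))" by (rule t[OF li(2) c1(2)]) (use \<phi>z in auto)
    have "set_integrable lebesgue D (\<lambda>x. r * (V x * \<phi> x) - Vt x * \<phi> x - \<sigma>\<^sup>2 / 2 * (Vxx x * ((fst x)\<^sup>2 * \<phi> x)) - (r - q) * (Vx x * (fst x * \<phi> x)))"
      using t0 t1 t2 t3 by (intro set_integral_diff set_integrable_mult_right) auto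
    moreover have "r * (V x * \<phi> x) - Vt x * \<phi> x - \<sigma>\<^sup>2 / 2 * (Vxx x * ((fst x)\<^sup>2 * \<phi> x)) - (r - q) * (Vx x * (fst x * \<phi> x)) = L x * \<phi> x" for x
      by (simp add: L_def cb_op_def algebra_simps)
    ultimately show ?thesis by simp
  qed
  have eq: "conv_op (\<sigma>\<^sup>2 / 2) (r - q - \<sigma>\<^sup>2 / 2) r \<delta> (\<lambda>w. V (exp (fst w), snd w)) z = (LINT x:D|lebesgue. L x * \<phi> x)"
    unfolding L_def \<phi>_def by (rule conv_op_eq_tested[OF D V li wx wxx wt \<delta> sub])
  show "k \<le> conv_op (\<sigma>\<^sup>2 / 2) (r - q - \<sigma>\<^sup>2 / 2) r \<delta> (\<lambda>w. V (exp (fst w), snd w)) z"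
    if ae: "AE x in lebesgue. x \<in> exp_sq z \<delta> \<longrightarrow> k \<le> L x"
  proof -
    have "(LINT x:D|lebesgue. k * \<phi> x) \<le> (LINT x:D|lebesgue. L x * \<phi> x)"
      unfolding set_lebesgue_integral_def
    proof (rule integral_mono_AE)
      show "AE x in lebesgue. indicator D x *\<^sub>R (k * \<phi> x) \<le> indicator D x *\<^sub>R (L x * \<phi> x)"
        using ae
      proof eventually_elim
        case (elim x)
        then show ?case using \<phi>0[of x] \<phi>z[of x]
          by (cases "x \<in> exp_sq z \<delta>") (auto intro!: mult_left_mono mult_right_mono)
      qed
    qed (use i1 iL in \<open>auto simp: set_integrable_def\<close>)
    then show ?thesis by (simp only: one eq)
  qed
  show "conv_op (\<sigma>\<^sup>2 / 2) (r - q - \<sigma>\<^sup>2 / 2) r \<delta> (\<lambda>w. V (exp (fst w), snd w)) z \<le> k"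
    if ae: "AE x in lebesgue. x \<in> exp_sq z \<delta> \<longrightarrow> L x \<le> k"
  proof -
    have "(LINT x:D|lebesgue. L x * \<phi> x) \<le> (LINT x:D|lebesgue. k * \<phi> x)"
      unfolding set_lebesgue_integral_def
    proof (rule integral_mono_AE)
      show "AE x in lebesgue. indicator D x *\<^sub>R (L x * \<phi> x) \<le> indicator D x *\<^sub>R (k * \<phi> x)"
        using ae
      proof eventually_elim
        case (elim x)
        then show ?case using \<phi>0[of x] \<phi>z[of x]
          by (cases "x \<in> exp_sq z \<delta>") (auto intro!: mult_left_mono mult_right_mono)
      qed
    qed (use i1 iL in \<open>auto simp: set_integrable_def\<close>)
    then show ?thesis by (simp only: one eq)
  qed
qed

section \<open>The convertible bond in logarithmic coordinates\<close>

locale convertible_bond =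
  fixes K \<gamma> T \<sigma> r q c :: real and V Vx Vxx Vt :: "real \<times> real \<Rightarrow> real"
  assumes pos: "K > 0" "\<gamma> > 0" "T > 0" "\<sigma> > 0" "r > 0" "q > 0" "c \<ge> 0"
    and cr: "c < r * K" and cq: "c < q * K"
    and sol: "cb_solution K \<gamma> T \<sigma> r q c V Vx Vxx Vt"
begin

definition "a = \<sigma>\<^sup>2 / 2"
definition "b = r - q - \<sigma>\<^sup>2 / 2"
definition "Y = ln (K / \<gamma>)"
definition "v = (\<lambda>w. V (exp (fst w), snd w))"

text \<open>In \<open>bond_cl\<close> the right end and the final time, which carry the data, are included.\<close>

definition "bond_int = {..<Y} \<times> {0<..<T}"
definition "bond_cl = {..Y} \<times> {0<..T}"

lemma a_pos: "a > 0" using pos by (simp add: a_def)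

lemma exp_Y: "exp Y = K / \<gamma>" using pos by (simp add: Y_def)

lemma open_bond_int: "open bond_int" by (simp add: bond_int_def open_Times)

lemma bond_int_subset: "bond_int \<subseteq> bond_cl" by (auto simp: bond_int_def bond_cl_def)

lemma open_domain: "open (cb_domain K \<gamma> T)" by (simp add: cb_domain_def open_Times)

lemma exp_le_iff: "exp y \<le> K / \<gamma> \<longleftrightarrow> y \<le> Y" "exp y < K / \<gamma> \<longleftrightarrow> y < Y"
  by (simp_all flip: exp_Y)

lemma domain_iff: "(exp y, s) \<in> cb_domain K \<gamma> T \<longleftrightarrow> (y, s) \<in> bond_int"
  by (simp add: cb_domain_def bond_int_def exp_le_iff)

lemma boundary_iff: "(y, s) \<in> bond_cl - bond_int \<Longrightarrow> (exp y, s) \<in> cb_boundary K \<gamma> T"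
  by (auto simp: bond_cl_def bond_int_def cb_boundary_def exp_le_iff exp_Y)

lemma v_continuous: "continuous_on bond_cl v"
  unfolding v_def
proof (rule continuous_on_compose2[where g = V])
  show "continuous_on (cb_domain K \<gamma> T \<union> cb_boundary K \<gamma> T) V"
    using sol by (simp add: cb_solution_def Let_def)
  show "(\<lambda>w. (exp (fst w), snd w)) ` bond_cl \<subseteq> cb_domain K \<gamma> T \<union> cb_boundary K \<gamma> T"
    using domain_iff boundary_iff by fastforce
qed (intro continuous_intros)

lemma v_boundary: "z \<in> bond_cl - bond_int \<Longrightarrow> v z = K"
  using sol boundary_iff[of "fst z" "snd z"] by (simp add: cb_solution_def Let_def v_def)

lemma v_bounds:
  assumes "z \<in> bond_cl"
  shows "\<gamma> * exp (fst z) \<le> v z" "v z \<le> K"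
proof -
  have "\<gamma> * exp (fst z) \<le> v z \<and> v z \<le> K"
  proof (cases "z \<in> bond_int")
    case True
    then have "(exp (fst z), snd z) \<in> cb_domain K \<gamma> T" using domain_iff[of "fst z" "snd z"] by simp
    then show ?thesis using sol by (fastforce simp: cb_solution_def Let_def v_def)
  next
    case False
    then have "v z = K" using assms v_boundary by blast
    moreover have "\<gamma> * exp (fst z) \<le> K"
      using assms exp_le_iff(1)[of "fst z"] pos by (auto simp: bond_cl_def field_simps mem_Times_iff)
    ultimately show ?thesis by simp
  qed
  then show "\<gamma> * exp (fst z) \<le> v z" "v z \<le> K" by auto
qed

lemma V_regular:
  "continuous_on (cb_domain K \<gamma> T) V" "loc_integrable (cb_domain K \<gamma> T) V"
  "loc_integrable (cb_domain K \<gamma> T) Vx" "loc_integrable (cb_domain K \<gamma> T) Vxx" "loc_integrable (cb_domain K \<gamma> T) Vt"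
  "weak_dx (cb_domain K \<gamma> T) V Vx" "weak_dx (cb_domain K \<gamma> T) Vx Vxx" "weak_dt (cb_domain K \<gamma> T) V Vt"
proof -
  have W: "W21p_loc 2 (cb_domain K \<gamma> T) V Vx Vxx Vt"
    using sol by (simp add: cb_solution_def Let_def)
  have D: "cb_domain K \<gamma> T \<in> sets lebesgue" using open_domain by simp
  show "continuous_on (cb_domain K \<gamma> T) V"
    using sol by (auto simp: cb_solution_def Let_def intro: continuous_on_subset)
  show "loc_integrable (cb_domain K \<gamma> T) V"
    "loc_integrable (cb_domain K \<gamma> T) Vx" "loc_integrable (cb_domain K \<gamma> T) Vxx" "loc_integrable (cb_domain K \<gamma> T) Vt"
    "weak_dx (cb_domain K \<gamma> T) V Vx" "weak_dx (cb_domain K \<gamma> T) Vx Vxx" "weak_dt (cb_domain K \<gamma> T) V Vt"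
    using W by (simp_all add: W21p_loc_def Lp_loc_2_loc_integrable[OF D])
qed

abbreviation "L \<equiv> cb_op \<sigma> r q V Vx Vxx Vt"

text \<open>On \<open>V = \<gamma> x\<close> one has \<open>V\<^sub>x = \<gamma>\<close> and
  \<open>V\<^sub>t = 0\<close>, and \<open>V\<^sub>x\<^sub>x = 0\<close> on \<open>V\<^sub>x =
  \<gamma>\<close>, almost everywhere.\<close>

lemma L_on_conversion:
  "AE z in lebesgue. z \<in> cb_domain K \<gamma> T \<longrightarrow> V z = \<gamma> * fst z \<longrightarrow> L z = q * V z"
proof -
  have 1: "AE z in lebesgue. z \<in> cb_domain K \<gamma> T \<longrightarrow> V z = 0 + \<gamma> * fst z + 0 * snd z \<longrightarrow> Vx z = \<gamma>"
    by (rule weak_dx_level_set[OF open_domain V_regular(2,3,6)])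
  have 2: "AE z in lebesgue. z \<in> cb_domain K \<gamma> T \<longrightarrow> Vx z = \<gamma> + 0 * fst z + 0 * snd z \<longrightarrow> Vxx z = 0"
    by (rule weak_dx_level_set[OF open_domain V_regular(3,4,7)])
  have 3: "AE z in lebesgue. z \<in> cb_domain K \<gamma> T \<longrightarrow> V z = 0 + \<gamma> * fst z + 0 * snd z \<longrightarrow> Vt z = 0"
    by (rule weak_dt_level_set[OF open_domain V_regular(2,5,8)])
  from 1 2 3 show ?thesis
    by eventually_elim (auto simp: cb_op_def algebra_simps)
qed

lemma L_on_face_value:
  "AE z in lebesgue. z \<in> cb_domain K \<gamma> T \<longrightarrow> V z = K \<longrightarrow> L z = r * K"
proof -
  have 1: "AE z in lebesgue. z \<in> cb_domain K \<gamma> T \<longrightarrow> V z = K + 0 * fst z + 0 * snd z \<longrightarrow> Vx z = 0"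
    by (rule weak_dx_level_set[OF open_domain V_regular(2,3,6)])
  have 2: "AE z in lebesgue. z \<in> cb_domain K \<gamma> T \<longrightarrow> Vx z = 0 + 0 * fst z + 0 * snd z \<longrightarrow> Vxx z = 0"
    by (rule weak_dx_level_set[OF open_domain V_regular(3,4,7)])
  have 3: "AE z in lebesgue. z \<in> cb_domain K \<gamma> T \<longrightarrow> V z = K + 0 * fst z + 0 * snd z \<longrightarrow> Vt z = 0"
    by (rule weak_dt_level_set[OF open_domain V_regular(2,5,8)])
  from 1 2 3 show ?thesis
    by eventually_elim (auto simp: cb_op_def algebra_simps)
qed

lemma L_bounds:
  "AE z in lebesgue. z \<in> cb_domain K \<gamma> T \<longrightarrow> c \<le> L z \<and> L z \<le> max q r * K \<and>
    (\<gamma> * fst z < V z \<longrightarrow> L z \<le> r * K) \<and> (\<gamma> * fst z < V z \<and> V z < K \<longrightarrow> L z = c)"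
proof -
  have 1: "AE z in lebesgue. z \<in> cb_domain K \<gamma> T \<and> \<gamma> * fst z < V z \<and> V z < K \<longrightarrow> L z = c"
    and 2: "AE z in lebesgue. z \<in> cb_domain K \<gamma> T \<longrightarrow> L z \<ge> c"
    and 3: "\<And>z. z \<in> cb_domain K \<gamma> T \<Longrightarrow> \<gamma> * fst z \<le> V z \<and> V z \<le> K"
    using sol by (auto simp: cb_solution_def Let_def)
  have mx: "r * K \<le> max q r * K" "q * K \<le> max q r * K" using pos by (auto intro!: mult_right_mono)
  from 1 2 L_on_conversion L_on_face_value show ?thesis
  proof eventually_elim
    case (elim z)
    show ?case
    proof (intro impI)
      assume z: "z \<in> cb_domain K \<gamma> T"
      then consider "V z = K" | "\<gamma> * fst z < V z" "V z < K" | "V z = \<gamma> * fst z" "V z < K"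
        using 3[OF z] by linarith
      then show "c \<le> L z \<and> L z \<le> max q r * K \<and>
        (\<gamma> * fst z < V z \<longrightarrow> L z \<le> r * K) \<and> (\<gamma> * fst z < V z \<and> V z < K \<longrightarrow> L z = c)"
      proof cases
        case 3
        then have "L z \<le> q * K" using elim z pos by simp
        then show ?thesis using 3 elim z mx by auto
      qed (use elim z mx cr in auto)
    qed
  qed
qed

lemma conv_op_v_bounds:
  assumes \<delta>: "\<delta> > 0" and sub: "sq z \<delta> \<subseteq> A" and A: "A \<subseteq> bond_int"
  shows "(AE x in lebesgue. x \<in> cb_domain K \<gamma> T \<and> (ln (fst x), snd x) \<in> A \<longrightarrow> k \<le> L x) \<Longrightarrow> k \<le> conv_op a b r \<delta> v z"
    and "(AE x in lebesgue. x \<in> cb_domain K \<gamma> T \<and> (ln (fst x), snd x) \<in> A \<longrightarrow> L x \<le> k) \<Longrightarrow> conv_op a b r \<delta> v z \<le> k"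
proof -
  have esub: "x \<in> cb_domain K \<gamma> T \<and> (ln (fst x), snd x) \<in> A" if "x \<in> exp_sq z \<delta>" for x
    using exp_sq_subset[OF sub that] domain_iff[of "ln (fst x)" "snd x"] A by auto
  then have sub': "exp_sq z \<delta> \<subseteq> cb_domain K \<gamma> T" by blast
  note cb = conv_op_bounds[OF open_domain V_regular \<delta> sub', where \<sigma> = \<sigma> and r = r and q = q and k = k,
      folded a_def b_def v_def]
  show "k \<le> conv_op a b r \<delta> v z" if "AE x in lebesgue. x \<in> cb_domain K \<gamma> T \<and> (ln (fst x), snd x) \<in> A \<longrightarrow> k \<le> L x"
    by (rule cb(1)) (use that in eventually_elim, use esub in blast)
  show "conv_op a b r \<delta> v z \<le> k" if "AE x in lebesgue. x \<in> cb_domain K \<gamma> T \<and> (ln (fst x), snd x) \<in> A \<longrightarrow> L x \<le> k"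
    by (rule cb(2)) (use that in eventually_elim, use esub in blast)
qed

text \<open>The a.e. bounds for the operator turn into pointwise bounds for the mollified value. On a square
  that avoids both obstacles the equation is exact.\<close>

lemma conv_op_v:
  assumes \<delta>: "\<delta> > 0" and sub: "sq z \<delta> \<subseteq> bond_int"
  shows "c \<le> conv_op a b r \<delta> v z" "conv_op a b r \<delta> v z \<le> max q r * K"
    "(\<And>w. w \<in> sq z \<delta> \<Longrightarrow> \<gamma> * exp (fst w) < v w) \<Longrightarrow> conv_op a b r \<delta> v z \<le> r * K"
    "(\<And>w. w \<in> sq z \<delta> \<Longrightarrow> \<gamma> * exp (fst w) < v w \<and> v w < K) \<Longrightarrow> conv_op a b r \<delta> v z = c"
proof -
  note all = conv_op_v_bounds[OF \<delta> sub subset_refl]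
  show "c \<le> conv_op a b r \<delta> v z" by (rule all(1)) (use L_bounds in eventually_elim, auto)
  show "conv_op a b r \<delta> v z \<le> max q r * K" by (rule all(2)) (use L_bounds in eventually_elim, auto)
  note loc = conv_op_v_bounds[OF \<delta> subset_refl sub]
  have pt: "V x = v (ln (fst x), snd x)" "fst x = exp (ln (fst x))" if "x \<in> cb_domain K \<gamma> T" for x
    using that by (auto simp: v_def cb_domain_def)
  show "conv_op a b r \<delta> v z \<le> r * K" if above: "\<And>w. w \<in> sq z \<delta> \<Longrightarrow> \<gamma> * exp (fst w) < v w"
  proof (rule loc(2))
    show "AE x in lebesgue. x \<in> cb_domain K \<gamma> T \<and> (ln (fst x), snd x) \<in> sq z \<delta> \<longrightarrow> L x \<le> r * K"
      using L_bounds
    proof eventually_elim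
      case (elim x)
      then show ?case using above[of "(ln (fst x), snd x)"] pt[of x] by auto
    qed
  qed
  show "conv_op a b r \<delta> v z = c" if bet: "\<And>w. w \<in> sq z \<delta> \<Longrightarrow> \<gamma> * exp (fst w) < v w \<and> v w < K"
  proof (rule antisym)
    have ae: "AE x in lebesgue. x \<in> cb_domain K \<gamma> T \<and> (ln (fst x), snd x) \<in> sq z \<delta> \<longrightarrow> L x = c"
      using L_bounds
    proof eventually_elim
      case (elim x)
      then show ?case using bet[of "(ln (fst x), snd x)"] pt[of x] by auto
    qed
    show "conv_op a b r \<delta> v z \<le> c" by (rule loc(2)) (use ae in eventually_elim, auto)
    show "c \<le> conv_op a b r \<delta> v z" by (rule loc(1)) (use ae in eventually_elim, auto)
  qed
qed

end

section \<open>Below the face value\<close>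

text \<open>The bump \<open>(\<rho>\<^sup>2 - \<zeta>\<^sup>2)\<^sup>2\<close> around a centre that moves
  with speed \<open>p\<close>. With \<open>S = \<rho>\<^sup>2 - \<zeta>\<^sup>2\<close>, applying
  the operator gives a term \<open>- 8 a \<rho>\<^sup>2\<close>, a term of order \<open>S\<close>
  and the term \<open>(r - \<Lambda>) S\<^sup>2\<close>; the value of \<open>\<Lambda>\<close> is
  the one for which the sum is minus a square.\<close>

lemma moving_bump_classical:
  fixes a b r \<rho> p y1 s1 \<epsilon> K :: real
  assumes a: "a > 0" and \<rho>: "\<rho> > 0" and \<epsilon>: "\<epsilon> \<ge> 0"
  defines "\<beta> \<equiv> 4 * \<rho> * \<bar>p + b\<bar> + 12 * a"
  defines "\<Lambda> \<equiv> r + \<beta>\<^sup>2 / (32 * a * \<rho>\<^sup>2)"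
  assumes A: "\<And>y s. (y, s) \<in> A \<Longrightarrow> \<bar>y - (y1 + p * (s1 - s))\<bar> \<le> \<rho>"
  shows "classical_super a b r A
    (\<lambda>z. K - \<epsilon> * ((\<rho>\<^sup>2 - (fst z - (y1 + p * (s1 - snd z)))\<^sup>2)\<^sup>2 * exp (- \<Lambda> * (s1 - snd z)))) (r * K)"
proof -
  define \<zeta> where "\<zeta> y s = y - (y1 + p * (s1 - s))" for y s
  define S where "S y s = \<rho>\<^sup>2 - (\<zeta> y s)\<^sup>2" for y s
  define e where "e s = exp (- \<Lambda> * (s1 - s))" for s
  have Dy: "((\<lambda>y. S y s) has_real_derivative - 2 * \<zeta> y s) (at y)" for y s
    unfolding S_def \<zeta>_def by (auto intro!: derivative_eq_intros)
  have D\<zeta>: "((\<lambda>y. \<zeta> y s) has_real_derivative 1) (at y)" for y s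
    unfolding \<zeta>_def by (auto intro!: derivative_eq_intros)
  have Ds: "((\<lambda>s. S y s) has_real_derivative - 2 * \<zeta> y s * p) (at s)" for y s
    unfolding S_def \<zeta>_def by (auto intro!: derivative_eq_intros simp: algebra_simps)
  have De: "(e has_real_derivative \<Lambda> * e s) (at s)" for s
    unfolding e_def by (auto intro!: derivative_eq_intros)
  have "classical_super a b r A (\<lambda>z. K - \<epsilon> * ((S (fst z) (snd z))\<^sup>2 * e (snd z))) (r * K)"
  proof (rule classical_superI[where \<psi> = "\<lambda>y s. K - \<epsilon> * ((S y s)\<^sup>2 * e s)"
        and \<psi>y = "\<lambda>y s. \<epsilon> * (4 * S y s * \<zeta> y s * e s)"
        and \<psi>yy = "\<lambda>y s. \<epsilon> * ((4 * S y s - 8 * (\<zeta> y s)\<^sup>2) * e s)"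
        and \<psi>s = "\<lambda>y s. - \<epsilon> * ((\<Lambda> * (S y s)\<^sup>2 - 4 * S y s * \<zeta> y s * p) * e s)"])
    fix y s assume ys: "(y, s) \<in> A"
    show "((\<lambda>y. K - \<epsilon> * ((S y s)\<^sup>2 * e s)) has_real_derivative \<epsilon> * (4 * S y s * \<zeta> y s * e s)) (at y)"
      by (auto intro!: derivative_eq_intros Dy)
    show "((\<lambda>y. \<epsilon> * (4 * S y s * \<zeta> y s * e s)) has_real_derivative \<epsilon> * ((4 * S y s - 8 * (\<zeta> y s)\<^sup>2) * e s)) (at y)"
      by (auto intro!: derivative_eq_intros Dy D\<zeta> simp: power2_eq_square algebra_simps)
    show "((\<lambda>s. K - \<epsilon> * ((S y s)\<^sup>2 * e s)) has_real_derivative - \<epsilon> * ((\<Lambda> * (S y s)\<^sup>2 - 4 * S y s * \<zeta> y s * p) * e s)) (at s)"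
      by (auto intro!: derivative_eq_intros Ds De simp: power2_eq_square algebra_simps)
    let ?S = "S y s" and ?z = "\<zeta> y s"
    have z: "\<bar>?z\<bar> \<le> \<rho>" using A[OF ys] by (simp add: \<zeta>_def)
    then have S0: "?S \<ge> 0" using \<rho> by (simp add: S_def abs_le_square_iff[symmetric])
    have "4 * ?z * (p + b) \<le> 4 * \<rho> * \<bar>p + b\<bar>"
    proof -
      have "?z * (p + b) \<le> \<bar>?z\<bar> * \<bar>p + b\<bar>" by (metis abs_ge_self abs_mult)
      also have "\<dots> \<le> \<rho> * \<bar>p + b\<bar>" using z by (intro mult_right_mono) auto
      finally show ?thesis by simp
    qed
    then have "(4 * ?z * (p + b) + 12 * a) * ?S \<le> \<beta> * ?S"
      using S0 by (intro mult_right_mono) (auto simp: \<beta>_def)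
    moreover have "0 \<le> (16 * a * \<rho>\<^sup>2 - \<beta> * ?S)\<^sup>2 / (32 * a * \<rho>\<^sup>2)" using a by simp
    moreover have "(16 * a * \<rho>\<^sup>2 - \<beta> * ?S)\<^sup>2 / (32 * a * \<rho>\<^sup>2) = 8 * a * \<rho>\<^sup>2 - \<beta> * ?S + (\<Lambda> - r) * ?S\<^sup>2"
      using a \<rho> by (simp add: \<Lambda>_def field_simps power2_eq_square)
    ultimately have le: "(4 * ?z * (p + b) + 12 * a) * ?S - 8 * a * \<rho>\<^sup>2 - (\<Lambda> - r) * ?S\<^sup>2 \<le> 0"
      by linarith
    have "0 \<le> \<epsilon> * e s * - ((4 * ?z * (p + b) + 12 * a) * ?S - 8 * a * \<rho>\<^sup>2 - (\<Lambda> - r) * ?S\<^sup>2)"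
      using le \<epsilon> by (intro mult_nonneg_nonneg) (auto simp: e_def)
    also have "8 * a * \<rho>\<^sup>2 = 8 * a * (?S + ?z\<^sup>2)" by (simp add: S_def)
    finally show "r * K \<le> - (- \<epsilon> * ((\<Lambda> * ?S\<^sup>2 - 4 * ?S * ?z * p) * e s)) - a * (\<epsilon> * ((4 * ?S - 8 * ?z\<^sup>2) * e s))
        - b * (\<epsilon> * (4 * ?S * ?z * e s)) + r * (K - \<epsilon> * (?S\<^sup>2 * e s))"
      by (simp add: algebra_simps)
  qed
  then show ?thesis by (simp add: S_def \<zeta>_def e_def)
qed

context convertible_bond
begin

lemma v_continuous_int: "continuous_on bond_int v"
  using v_continuous bond_int_subset continuous_on_subset by blast

text \<open>The gap \<open>K - V\<close> is a supersolution away from the conversion region, and on the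
  conversion region it is at least a positive constant. A small bump that starts around
  \<open>(y1, s1)\<close> and moves towards \<open>(y2, s2)\<close> therefore stays below the gap.\<close>

lemma below_face_value_spreads:
  assumes z1: "(y1, s1) \<in> bond_int" "v (y1, s1) < K" and y2: "y2 < Y" and s2: "0 < s2" "s2 < s1"
  shows "v (y2, s2) < K"
proof -
  define p where "p = (y2 - y1) / (s1 - s2)"
  define \<eta> where "\<eta> s = y1 + p * (s1 - s)" for s
  define ym where "ym = max y1 y2"
  have ym: "ym < Y" using z1 y2 by (auto simp: ym_def bond_int_def)
  have s1: "s1 < T" using z1 by (auto simp: bond_int_def)
  have \<eta>12: "\<eta> s1 = y1" "\<eta> s2 = y2" using s2 by (auto simp: \<eta>_def p_def)
  have \<eta>m: "\<eta> s \<le> ym" if "s2 \<le> s" "s \<le> s1" for s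
  proof -
    define \<theta> where "\<theta> = (s1 - s) / (s1 - s2)"
    have \<theta>: "0 \<le> \<theta>" "\<theta> \<le> 1" using that s2 by (auto simp: \<theta>_def divide_simps)
    have "\<eta> s = y1 + \<theta> * (y2 - y1)" by (simp add: \<eta>_def p_def \<theta>_def)
    also have "\<dots> = (1 - \<theta>) * y1 + \<theta> * y2" by (simp add: algebra_simps)
    also have "\<dots> \<le> (1 - \<theta>) * ym + \<theta> * ym"
      using \<theta> by (intro add_mono mult_left_mono) (auto simp: ym_def)
    finally show ?thesis by (simp add: algebra_simps)
  qed
  have o1: "open (bond_int \<inter> v -` {..<K})"
    by (rule continuous_open_preimage[OF v_continuous_int open_bond_int]) simp
  have z1': "(y1, s1) \<in> bond_int \<inter> v -` {..<K}" using z1 by simp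
  obtain \<rho>1 where \<rho>1: "\<rho>1 > 0" "sq (y1, s1) \<rho>1 \<subseteq> bond_int \<inter> v -` {..<K}"
    using open_contains_sq[OF o1 z1'] by blast
  define \<rho> where "\<rho> = min \<rho>1 ((Y - ym) / 2)"
  have \<rho>: "\<rho> > 0" "\<rho> \<le> \<rho>1" "ym + \<rho> < Y"
    using \<rho>1 ym by (auto simp: \<rho>_def min_def field_simps)
  \<comment> \<open>The bump starts at time \<open>s1\<close>, where the gap is at least \<open>m1\<close>; in the conversion region the gap
    is at least \<open>m2\<close>, since the tube stays away from \<open>y = Y\<close>.\<close>
  have seg: "{y1 - \<rho>..y1 + \<rho>} \<times> {s1} \<subseteq> bond_int \<inter> v -` {..<K}"
  proof -
    have "{y1 - \<rho>..y1 + \<rho>} \<times> {s1} \<subseteq> sq (y1, s1) \<rho>1" using \<rho> by (auto simp: sq_iff)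
    then show ?thesis using \<rho>1(2) by blast
  qed
  have "continuous_on ({y1 - \<rho>..y1 + \<rho>} \<times> {s1}) v"
    using seg by (intro continuous_on_subset[OF v_continuous_int]) auto
  moreover have "compact ({y1 - \<rho>..y1 + \<rho>} \<times> {s1})" by (intro compact_Times) auto
  moreover have "{y1 - \<rho>..y1 + \<rho>} \<times> {s1} \<noteq> {}" using \<rho> by auto
  ultimately obtain w where w: "w \<in> {y1 - \<rho>..y1 + \<rho>} \<times> {s1}" "\<And>z. z \<in> {y1 - \<rho>..y1 + \<rho>} \<times> {s1} \<Longrightarrow> v z \<le> v w"
    using continuous_attains_sup[of "{y1 - \<rho>..y1 + \<rho>} \<times> {s1}" v] by blast
  define m1 where "m1 = K - v w"
  have m1: "m1 > 0" using w(1) seg by (auto simp: m1_def)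
  define m2 where "m2 = K - \<gamma> * exp (ym + \<rho>)"
  have m2: "m2 > 0" using exp_le_iff(2)[of "ym + \<rho>"] \<rho>(3) pos by (simp add: m2_def field_simps)
  define \<epsilon> where "\<epsilon> = min m1 m2 / (\<rho>\<^sup>2)\<^sup>2"
  have \<epsilon>: "\<epsilon> > 0" "\<epsilon> * (\<rho>\<^sup>2)\<^sup>2 \<le> m1" "\<epsilon> * (\<rho>\<^sup>2)\<^sup>2 \<le> m2"
    using m1 m2 \<rho>(1) by (auto simp: \<epsilon>_def)
  define \<beta> where "\<beta> = 4 * \<rho> * \<bar>p + b\<bar> + 12 * a"
  define \<Lambda> where "\<Lambda> = r + \<beta>\<^sup>2 / (32 * a * \<rho>\<^sup>2)"
  have \<Lambda>: "\<Lambda> \<ge> 0" using pos a_pos by (simp add: \<Lambda>_def)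
  define P where "P z = (\<rho>\<^sup>2 - (fst z - \<eta> (snd z))\<^sup>2)\<^sup>2 * exp (- \<Lambda> * (s1 - snd z))" for z
  define R where "R = {z. s2 < snd z \<and> snd z \<le> s1 \<and> \<bar>fst z - \<eta> (snd z)\<bar> \<le> \<rho>}"
  define tube where "tube = {z. s2 < snd z \<and> snd z < s1 \<and> \<bar>fst z - \<eta> (snd z)\<bar> < \<rho>}"
  define A where "A = tube \<inter> (\<lambda>z. v z - \<gamma> * exp (fst z)) -` {0<..}"
  have P0: "0 \<le> P z" for z by (simp add: P_def)
  have Pm: "P z \<le> (\<rho>\<^sup>2)\<^sup>2" if z: "z \<in> R" for z
  proof -
    have "(fst z - \<eta> (snd z))\<^sup>2 \<le> \<rho>\<^sup>2" using z \<rho> by (simp add: R_def abs_le_square_iff[symmetric])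
    then have "(\<rho>\<^sup>2 - (fst z - \<eta> (snd z))\<^sup>2)\<^sup>2 \<le> (\<rho>\<^sup>2)\<^sup>2" by (intro power_mono) auto
    moreover have "exp (- \<Lambda> * (s1 - snd z)) \<le> 1" using z \<Lambda> by (simp add: R_def)
    ultimately have "P z \<le> (\<rho>\<^sup>2)\<^sup>2 * 1" unfolding P_def by (intro mult_mono) auto
    then show ?thesis by simp
  qed
  have Rint: "fst z < Y \<and> fst z \<le> ym + \<rho> \<and> 0 < snd z \<and> snd z < T" if "z \<in> R" for z
    using that \<eta>m[of "snd z"] \<rho> s2 s1 by (auto simp: R_def)
  have RD: "R \<subseteq> bond_int" using Rint by (force simp: bond_int_def mem_Times_iff)
  have tubeR: "tube \<subseteq> R" by (auto simp: tube_def R_def)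
  have "open tube"
    unfolding tube_def \<eta>_def by (intro open_Collect_conj open_Collect_less continuous_intros)
  then have openA: "open A"
    unfolding A_def
    by (intro continuous_open_preimage continuous_intros continuous_on_subset[OF v_continuous_int])
      (use tubeR RD in auto)
  have AR: "A \<subseteq> R" using tubeR by (auto simp: A_def)
  have gap: "K - v z \<ge> \<epsilon> * P z" if "z \<in> R" for z
  proof -
    have "- v z + (K - \<epsilon> * P z) \<ge> 0"
    proof (rule comparison[where u = "\<lambda>z. - v z" and \<psi> = "\<lambda>z. K - \<epsilon> * P z" and A = A and R = R and a = a and b = b and r = r
          and k = "- (r * K)" and ?s0.0 = s2 and ?s1.0 = s1 and M = "\<epsilon> * (\<rho>\<^sup>2)\<^sup>2"])
      show "r > 0" "a \<ge> 0" using pos a_pos by auto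
      show "open A" "A \<subseteq> R" by fact+
      show "s2 < snd z \<and> snd z \<le> s1" if "z \<in> R" for z using that by (simp add: R_def)
      show "compact (R \<inter> {z. s2 + e \<le> snd z \<and> - N \<le> fst z})" if e: "e > 0" for e N
      proof -
        have eq: "R \<inter> {z. s2 + e \<le> snd z \<and> - N \<le> fst z} =
            {z. snd z \<le> s1 \<and> \<bar>fst z - \<eta> (snd z)\<bar> \<le> \<rho> \<and> s2 + e \<le> snd z \<and> - N \<le> fst z}"
          using e by (auto simp: R_def)
        let ?C = "{z. snd z \<le> s1 \<and> \<bar>fst z - \<eta> (snd z)\<bar> \<le> \<rho> \<and> s2 + e \<le> snd z \<and> - N \<le> fst z}"
        let ?B = "{- N..Y} \<times> {s2..s1}"
        have cl: "closed ?C"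
          unfolding \<eta>_def by (intro closed_Collect_conj closed_Collect_le continuous_intros)
        have sb: "?C \<subseteq> ?B"
          unfolding eq[symmetric] using Rint by (force simp: R_def)
        have "compact (?B \<inter> ?C)"
          by (rule compact_Int_closed[OF _ cl]) (intro compact_Times compact_Icc)
        then show ?thesis unfolding eq Int_absorb1[OF sb] .
      qed
      show "continuous_on R (\<lambda>z. - v z)"
        by (intro continuous_intros continuous_on_subset[OF v_continuous_int RD])
      show "continuous_on R (\<lambda>z. K - \<epsilon> * P z)"
        unfolding P_def \<eta>_def by (intro continuous_intros)
      show "weak_super a b r A (\<lambda>z. - v z) (- (r * K))"
        unfolding weak_super_def conv_op_minus
      proof (intro allI impI)
        fix z \<delta> assume \<delta>: "\<delta> > 0" and sub: "sq z \<delta> \<subseteq> A"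
        have "conv_op a b r \<delta> v z \<le> r * K"
          by (rule conv_op_v(3)[OF \<delta>]) (use sub AR RD in \<open>auto simp: A_def\<close>)
        then show "- (r * K) \<le> - conv_op a b r \<delta> v z" by simp
      qed
      have "classical_super a b r A (\<lambda>z. K - \<epsilon> * P z) (r * K)"
        unfolding P_def \<eta>_def \<Lambda>_def \<beta>_def
        by (rule moving_bump_classical[OF a_pos \<rho>(1)]) (use \<epsilon>(1) AR in \<open>auto simp: R_def \<eta>_def\<close>)
      then show "classical_super a b r A (\<lambda>z. K - \<epsilon> * P z) (- (- (r * K)))" by simp
      show "0 \<le> - v z + (K - \<epsilon> * P z)" if z: "z \<in> R - A" for z
      proof -
        have zR: "z \<in> R" using z by auto
        have \<epsilon>P: "\<epsilon> * P z \<le> \<epsilon> * (\<rho>\<^sup>2)\<^sup>2" using Pm[OF zR] \<epsilon> by simp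
        have zc: "z \<in> bond_cl" using zR RD bond_int_subset by blast
        consider "\<bar>fst z - \<eta> (snd z)\<bar> = \<rho>" | "snd z = s1" | "z \<in> tube" "v z \<le> \<gamma> * exp (fst z)"
          using z zR by (fastforce simp: A_def tube_def R_def)
        then show ?thesis
        proof cases
          case 1
          then have "(fst z - \<eta> (snd z))\<^sup>2 = \<rho>\<^sup>2" by (metis power2_abs)
          then have "P z = 0" by (simp add: P_def)
          then show ?thesis using v_bounds[OF zc] by simp
        next
          case 2
          then have "z \<in> {y1 - \<rho>..y1 + \<rho>} \<times> {s1}"
            using zR \<eta>12 by (auto simp: R_def mem_Times_iff abs_le_iff)
          then have "v z \<le> v w" by (rule w(2))
          then show ?thesis using \<epsilon>P \<epsilon>(2) by (simp add: m1_def)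
        next
          case 3
          have "\<gamma> * exp (fst z) \<le> \<gamma> * exp (ym + \<rho>)" using Rint[OF zR] pos by simp
          then show ?thesis using 3 \<epsilon>P \<epsilon>(3) by (simp add: m2_def)
        qed
      qed
      show "- (\<epsilon> * (\<rho>\<^sup>2)\<^sup>2) \<le> - v z + (K - \<epsilon> * P z)" if zR: "z \<in> R" for z
      proof -
        have "\<epsilon> * P z \<le> \<epsilon> * (\<rho>\<^sup>2)\<^sup>2" using Pm[OF zR] \<epsilon> by simp
        moreover have "v z \<le> K" using zR RD bond_int_subset v_bounds by blast
        ultimately show ?thesis by simp
      qed
    qed fact
    then show ?thesis by simp
  qed
  define \<kappa> where "\<kappa> = \<epsilon> * ((\<rho>\<^sup>2)\<^sup>2 * exp (- \<Lambda> * (s1 - s2)))"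
  have \<kappa>: "\<kappa> > 0" using \<epsilon> \<rho> by (simp add: \<kappa>_def)
  have low: "v (\<eta> s, s) \<le> K - \<kappa>" if s: "s2 < s" "s < s1" for s
  proof -
    have "(\<eta> s, s) \<in> R" using s \<rho> by (simp add: R_def)
    moreover have "\<kappa> \<le> \<epsilon> * P (\<eta> s, s)"
      using \<epsilon> s \<Lambda> by (auto simp: \<kappa>_def P_def intro!: mult_left_mono)
    ultimately show ?thesis using gap[of "(\<eta> s, s)"] by simp
  qed
  have "((\<lambda>s. v (\<eta> s, s)) \<longlongrightarrow> v (\<eta> s2, s2)) (at_right s2)"
  proof (rule isCont_tendsto_compose[where g = v])
    have "(\<eta> s2, s2) \<in> bond_int" using y2 s2 s1 \<eta>12 by (simp add: bond_int_def)
    then show "isCont v (\<eta> s2, s2)"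
      using v_continuous_int open_bond_int continuous_on_eq_continuous_at by blast
    show "((\<lambda>s. (\<eta> s, s)) \<longlongrightarrow> (\<eta> s2, s2)) (at_right s2)"
      unfolding \<eta>_def by (intro tendsto_intros)
  qed
  moreover have "\<forall>\<^sub>F s in at_right s2. v (\<eta> s, s) \<le> K - \<kappa>"
    using low s2(2) by (auto simp: eventually_at_right[OF s2(2)])
  ultimately have "v (\<eta> s2, s2) \<le> K - \<kappa>" by (rule tendsto_upperbound) simp
  then show ?thesis using \<kappa> \<eta>12 by simp
qed

lemma face_value_time:
  obtains t0 where "0 \<le> t0" "t0 \<le> T" "\<And>y s. y < Y \<Longrightarrow> 0 < s \<Longrightarrow> s < t0 \<Longrightarrow> v (y, s) < K"
    "\<And>y s. y \<le> Y \<Longrightarrow> 0 < s \<Longrightarrow> t0 \<le> s \<Longrightarrow> s \<le> T \<Longrightarrow> v (y, s) = K"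
proof -
  define P where "P = {s. 0 < s \<and> s < T \<and> (\<exists>y<Y. v (y, s) < K)}"
  define t0 where "t0 = Sup (insert 0 P)"
  have bdd: "bdd_above (insert 0 P)" using pos by (intro bdd_aboveI[of _ T]) (auto simp: P_def)
  have le: "s \<le> t0" if "s \<in> insert 0 P" for s
    unfolding t0_def by (rule cSup_upper[OF that bdd])
  have t0: "0 \<le> t0" "t0 \<le> T"
    using le[of 0] pos by (auto simp: t0_def P_def intro!: cSup_least)
  have below: "v (y, s) < K" if ys: "y < Y" "0 < s" "s < t0" for y s
  proof -
    obtain s1 where s1: "s1 \<in> insert 0 P" "s < s1"
      using less_cSup_iff[OF _ bdd, of s] ys(3) by (auto simp: t0_def)
    then obtain y1 where "y1 < Y" "v (y1, s1) < K" "s1 < T" using ys(2) by (auto simp: P_def)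
    then show ?thesis
      using below_face_value_spreads[of y1 s1 y s] ys s1(2) by (auto simp: bond_int_def)
  qed
  have K1: "v (y, s) = K" if "y \<le> Y" "0 < s" "t0 < s" "s \<le> T" for y s
  proof (cases "y = Y \<or> s = T")
    case True
    then show ?thesis using that by (intro v_boundary) (auto simp: bond_cl_def bond_int_def)
  next
    case False
    then have "s \<notin> P" using le[of s] that by auto
    then have "\<not> v (y, s) < K" using that t0(1) False by (auto simp: P_def)
    then show ?thesis using v_bounds(2)[of "(y, s)"] that by (auto simp: bond_cl_def)
  qed
  have K2: "v (y, t0) = K" if "y \<le> Y" "0 < t0" for y
  proof (cases "y = Y \<or> t0 = T")
    case True
    then show ?thesis using that t0 by (intro v_boundary) (auto simp: bond_cl_def bond_int_def)
  next
    case False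
    then have "(y, t0) \<in> bond_int" using that t0 by (auto simp: bond_int_def)
    then have "isCont v (y, t0)"
      using v_continuous_int open_bond_int continuous_on_eq_continuous_at by blast
    then have "((\<lambda>s. v (y, s)) \<longlongrightarrow> v (y, t0)) (at_right t0)"
      by (rule isCont_tendsto_compose) (intro tendsto_intros)
    moreover have "\<forall>\<^sub>F s in at_right t0. v (y, s) = K"
    proof -
      have lt: "t0 < T" using False t0 by simp
      show ?thesis unfolding eventually_at_right[OF lt]
        by (intro exI[of _ T]) (use K1[OF that(1)] that(2) lt in auto)
    qed
    then have "((\<lambda>s. v (y, s)) \<longlongrightarrow> K) (at_right t0)" by (rule tendsto_eventually)
    ultimately show ?thesis using tendsto_unique[OF trivial_limit_at_right_real] by blast
  qed
  show ?thesis
  proof (rule that[of t0])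
    show "v (y, s) = K" if "y \<le> Y" "0 < s" "t0 \<le> s" "s \<le> T" for y s
      using K1[of y s] K2[of y] that by (cases "s = t0") auto
  qed (use t0 below in auto)
qed

end

section \<open>Comparison before the bond reaches its face value\<close>

locale bond_strip = convertible_bond +
  fixes t0 :: real
  assumes t0: "0 < t0" "t0 \<le> T"
    and below: "\<And>y s. y < Y \<Longrightarrow> 0 < s \<Longrightarrow> s < t0 \<Longrightarrow> v (y, s) < K"
    and final: "\<And>y. y \<le> Y \<Longrightarrow> v (y, t0) = K"
begin

definition "strip y s = {..y} \<times> {0<..s::real}" for y :: real

lemma strip_iff: "w \<in> strip y s \<longleftrightarrow> fst w \<le> y \<and> 0 < snd w \<and> snd w \<le> s"
  by (auto simp: strip_def mem_Times_iff)

lemma compact_strip_part: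
  assumes "e > 0"
  shows "compact (strip y s \<inter> {z. 0 + e \<le> snd z \<and> - N \<le> fst z})"
proof -
  have "strip y s \<inter> {z. 0 + e \<le> snd z \<and> - N \<le> fst z} = {- N..y} \<times> {e..s}"
    using assms by (auto simp: strip_iff)
  then show ?thesis by (simp add: compact_Times)
qed

lemma strip_subset: "y \<le> Y \<Longrightarrow> s \<le> t0 \<Longrightarrow> strip y s \<subseteq> bond_cl"
  using t0 by (auto simp: strip_iff bond_cl_def mem_Times_iff)

lemma v_strip_bounds:
  assumes "y \<le> Y" "0 < s" "s \<le> t0"
  shows "\<gamma> * exp y \<le> v (y, s)" "v (y, s) \<le> K" "0 < v (y, s)"
proof -
  have "(y, s) \<in> bond_cl" using assms t0 by (auto simp: bond_cl_def)
  from v_bounds[OF this] show "\<gamma> * exp y \<le> v (y, s)" "v (y, s) \<le> K" by auto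
  then show "0 < v (y, s)" using pos by (smt (verit) exp_gt_zero mult_pos_pos)
qed

lemma v_right: "0 < s \<Longrightarrow> s \<le> T \<Longrightarrow> v (Y, s) = K"
  by (rule v_boundary) (auto simp: bond_cl_def bond_int_def)

lemma v_cont_strip: "y \<le> Y \<Longrightarrow> s \<le> t0 \<Longrightarrow> continuous_on (strip y s) v"
  by (rule continuous_on_subset[OF v_continuous strip_subset])

definition "open_strip y s = {..<y} \<times> {0<..<s::real}" for y :: real

lemma open_strip_iff: "w \<in> open_strip y s \<longleftrightarrow> fst w < y \<and> 0 < snd w \<and> snd w < s"
  by (auto simp: open_strip_def mem_Times_iff)

lemma open_open_strip: "open (open_strip y s)" by (simp add: open_strip_def open_Times)

lemma open_strip_subset: "y \<le> Y \<Longrightarrow> s \<le> t0 \<Longrightarrow> open_strip y s \<subseteq> bond_int"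
  using t0 by (auto simp: open_strip_iff bond_int_def mem_Times_iff)

lemma open_strip_strip: "open_strip y s \<subseteq> strip y s"
  by (auto simp: open_strip_iff strip_iff)

text \<open>Translation by \<open>(h1, k1)\<close> preserves \<open>LV \<ge> c\<close>, and translation by
  \<open>(h2, k2)\<close> preserves \<open>LV = c\<close> outside the conversion region, so the
  difference of the two translates is a supersolution there. What remains to be checked is the
  right end, the final time and the contact set of the second translate.\<close>

lemma shift_comparison:
  assumes h: "0 \<le> h1" "0 \<le> k1" "0 \<le> h2" "0 \<le> k2"
    and dom: "y' + h1 \<le> Y" "y' + h2 \<le> Y" "s' + k1 \<le> t0" "s' + k2 \<le> t0"
    and \<psi>: "continuous_on (strip y' s') \<psi>" "classical_super a b r (open_strip y' s') \<psi> 0"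
    and low: "\<And>z. z \<in> strip y' s' \<Longrightarrow> - M \<le> \<psi> z"
    and right: "\<And>s. 0 < s \<Longrightarrow> s \<le> s' \<Longrightarrow> v (y' + h2, s + k2) \<le> v (y' + h1, s + k1) + \<psi> (y', s)"
    and top: "\<And>y. y \<le> y' \<Longrightarrow> v (y + h2, s' + k2) \<le> v (y + h1, s' + k1) + \<psi> (y, s')"
    and contact: "\<And>y s. y \<le> y' \<Longrightarrow> 0 < s \<Longrightarrow> s \<le> s' \<Longrightarrow> v (y + h2, s + k2) = \<gamma> * exp (y + h2) \<Longrightarrow>
        v (y + h2, s + k2) \<le> v (y + h1, s + k1) + \<psi> (y, s)"
    and z: "y \<le> y'" "0 < s" "s \<le> s'"
  shows "v (y + h2, s + k2) \<le> v (y + h1, s + k1) + \<psi> (y, s)"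
proof -
  let ?u1 = "\<lambda>z. v (z + (h1, k1))" and ?u2 = "\<lambda>z. v (z + (h2, k2))"
  define A where "A = open_strip y' s' \<inter> (\<lambda>z. ?u2 z - \<gamma> * exp (fst z + h2)) -` {0<..}"
  have st: "z + (h, k) \<in> strip Y t0" if "z \<in> strip y' s'" "(h, k) = (h1, k1) \<or> (h, k) = (h2, k2)" for z h k
    using that h dom by (auto simp: strip_iff)
  have it: "z + (h, k) \<in> bond_int" if "z \<in> open_strip y' s'" "(h, k) = (h1, k1) \<or> (h, k) = (h2, k2)" for z h k
    using that h dom t0 by (auto simp: open_strip_iff bond_int_def mem_Times_iff)
  have c1: "continuous_on (strip y' s') ?u1"
    by (rule continuous_on_compose2[OF v_cont_strip[OF order_refl order_refl]])
      (use st in \<open>auto intro!: continuous_intros\<close>)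
  have c2: "continuous_on (strip y' s') ?u2"
    by (rule continuous_on_compose2[OF v_cont_strip[OF order_refl order_refl]])
      (use st in \<open>auto intro!: continuous_intros\<close>)
  have openA: "open A" unfolding A_def
    by (intro continuous_open_preimage continuous_intros continuous_on_subset[OF c2 open_strip_strip] open_open_strip open_greaterThan)
  have Ains: "A \<subseteq> open_strip y' s'" by (auto simp: A_def)
  have "0 \<le> (?u1 z - ?u2 z) + \<psi> z" if "z \<in> strip y' s'" for z
  proof (rule comparison[where A = A and R = "strip y' s'" and a = a and b = b and r = r and k = 0 and ?s0.0 = 0 and ?s1.0 = s'
        and u = "\<lambda>z. ?u1 z - ?u2 z" and M = "K + M"])
    show "r > 0" "a \<ge> 0" using pos a_pos by auto
    show "A \<subseteq> strip y' s'" using Ains open_strip_strip by blast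
    show "continuous_on (strip y' s') (\<lambda>z. ?u1 z - ?u2 z)" by (intro continuous_intros c1 c2)
    show "weak_super a b r A (\<lambda>z. ?u1 z - ?u2 z) 0"
      unfolding weak_super_def
    proof (intro allI impI)
      fix z \<delta> assume \<delta>: "\<delta> > 0" and sub: "sq z \<delta> \<subseteq> A"
      have sub': "sq z \<delta> \<subseteq> open_strip y' s'" using sub Ains by blast
      have s: "sq (z + (h, k)) \<delta> \<subseteq> bond_int" if "(h, k) = (h1, k1) \<or> (h, k) = (h2, k2)" for h k
      proof
        fix w assume "w \<in> sq (z + (h, k)) \<delta>"
        then have "w - (h, k) \<in> sq z \<delta>" using sq_shift[of "w - (h, k)" "(h, k)" z \<delta>] by simp
        then have "w - (h, k) \<in> open_strip y' s'" using sub' by blast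
        from it[OF this that] show "w \<in> bond_int" by simp
      qed
      have "conv_op a b r \<delta> (\<lambda>z. ?u1 z - ?u2 z) z = conv_op a b r \<delta> ?u1 z - conv_op a b r \<delta> ?u2 z"
        by (rule conv_op_diff[OF \<delta>]) (use sub' open_strip_strip in \<open>auto intro!: continuous_on_subset[OF c1] continuous_on_subset[OF c2]\<close>)
      also have "conv_op a b r \<delta> ?u1 z = conv_op a b r \<delta> v (z + (h1, k1))"
        by (rule conv_op_shift[OF \<delta>]) (use s in \<open>auto intro: continuous_on_subset[OF v_continuous_int]\<close>)
      also have "conv_op a b r \<delta> ?u2 z = conv_op a b r \<delta> v (z + (h2, k2))"
        by (rule conv_op_shift[OF \<delta>]) (use s in \<open>auto intro: continuous_on_subset[OF v_continuous_int]\<close>)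
      also have "conv_op a b r \<delta> v (z + (h2, k2)) = c"
      proof (rule conv_op_v(4)[OF \<delta> s])
        fix w assume "w \<in> sq (z + (h2, k2)) \<delta>"
        then have "w - (h2, k2) \<in> sq z \<delta>" using sq_shift[of "w - (h2, k2)" "(h2, k2)" z \<delta>] by simp
        then have wA: "w - (h2, k2) \<in> A" using sub by blast
        then have "\<gamma> * exp (fst w) < v w" by (simp add: A_def)
        moreover have "v w < K"
        proof -
          have "w - (h2, k2) \<in> open_strip y' s'" using wA Ains by blast
          then show ?thesis using below[of "fst w" "snd w"] h dom by (auto simp: open_strip_iff)
        qed
        ultimately show "\<gamma> * exp (fst w) < v w \<and> v w < K" by simp
      qed simp
      finally show "0 \<le> conv_op a b r \<delta> (\<lambda>z. ?u1 z - ?u2 z) z"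
        using conv_op_v(1)[OF \<delta> s, of h1 k1] by simp
    qed
    show "classical_super a b r A \<psi> (- 0)"
      using \<psi>(2) Ains unfolding classical_super_def by (simp add: subset_iff) blast
    show "0 \<le> (?u1 z - ?u2 z) + \<psi> z" if z: "z \<in> strip y' s' - A" for z
    proof -
      obtain y s where ys: "z = (y, s)" by (cases z)
      have yz: "y \<le> y'" "0 < s" "s \<le> s'" using z by (auto simp: ys strip_iff)
      have g: "\<gamma> * exp (y + h2) \<le> v (y + h2, s + k2)"
        using yz h dom by (intro v_strip_bounds) auto
      consider "y = y'" | "s = s'" | "v (y + h2, s + k2) = \<gamma> * exp (y + h2)"
        using z yz g by (force simp: A_def ys open_strip_iff)
      then have "v (y + h2, s + k2) \<le> v (y + h1, s + k1) + \<psi> (y, s)"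
        by cases (use right[of s] top[of y] contact[of y s] yz in auto)
      then show ?thesis by (simp add: ys)
    qed
    show "- (K + M) \<le> (?u1 z - ?u2 z) + \<psi> z" if z: "z \<in> strip y' s'" for z
    proof -
      have "z + (h1, k1) \<in> bond_cl" "z + (h2, k2) \<in> bond_cl"
        using st[OF z] strip_subset[OF order_refl order_refl] by blast+
      then have "\<gamma> * exp (fst (z + (h1, k1))) \<le> ?u1 z" "?u2 z \<le> K"
        using v_bounds by blast+
      moreover have "0 < \<gamma> * exp (fst (z + (h1, k1)))" using pos by simp
      ultimately have "0 \<le> ?u1 z" "?u2 z \<le> K" by linarith+
      then show ?thesis using low[OF z] by simp
    qed
    show "compact (strip y' s' \<inter> {z. 0 + e \<le> snd z \<and> - N \<le> fst z})" if "e > 0" for e N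
      by (rule compact_strip_part[OF that])
  qed (use that openA \<psi>(1) in \<open>auto simp: strip_iff\<close>)
  from this[of "(y, s)"] z show ?thesis by (simp add: strip_iff)
qed

lemma lower_comparison:
  assumes \<psi>: "continuous_on (strip Y t0) \<psi>" "classical_super a b r (open_strip Y t0) \<psi> (- c)"
    and low: "\<And>z. z \<in> strip Y t0 \<Longrightarrow> - M \<le> \<psi> z"
    and right: "\<And>s. 0 < s \<Longrightarrow> s \<le> t0 \<Longrightarrow> 0 \<le> K + \<psi> (Y, s)"
    and top: "\<And>y. y \<le> Y \<Longrightarrow> 0 \<le> K + \<psi> (y, t0)"
    and z: "y \<le> Y" "0 < s" "s \<le> t0"
  shows "0 \<le> v (y, s) + \<psi> (y, s)"
proof -
  have "0 \<le> v z + \<psi> z" if "z \<in> strip Y t0" for z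
  proof (rule comparison[where A = "open_strip Y t0" and R = "strip Y t0" and a = a and b = b and r = r and k = c and ?s0.0 = 0 and ?s1.0 = t0
        and u = v and M = M])
    show "r > 0" "a \<ge> 0" using pos a_pos by auto
    show "weak_super a b r (open_strip Y t0) v c"
      unfolding weak_super_def using conv_op_v(1) open_strip_subset[of Y t0] by (meson order_refl order_trans)
    show "0 \<le> v z + \<psi> z" if z: "z \<in> strip Y t0 - open_strip Y t0" for z
    proof -
      obtain y s where ys: "z = (y, s)" by (cases z)
      have yz: "y \<le> Y" "0 < s" "s \<le> t0" "y = Y \<or> s = t0" using z by (auto simp: ys strip_iff open_strip_iff)
      then show ?thesis using right[of s] top[of y] v_right[of s] final[of y] t0 by (auto simp: ys)
    qed
    show "- M \<le> v z + \<psi> z" if z: "z \<in> strip Y t0" for z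
      using low[OF z] v_strip_bounds(3)[of "fst z" "snd z"] z by (auto simp: strip_iff)
  qed (use that compact_strip_part \<psi> open_open_strip open_strip_strip v_cont_strip in \<open>auto simp: strip_iff\<close>)
  from this[of "(y, s)"] z show ?thesis by (simp add: strip_iff)
qed

lemma upper_comparison:
  assumes y': "y' \<le> Y" and above: "\<And>y s. y < y' \<Longrightarrow> 0 < s \<Longrightarrow> s < t0 \<Longrightarrow> \<gamma> * exp y < v (y, s)"
    and \<psi>: "continuous_on (strip y' t0) \<psi>" "classical_super a b r (open_strip y' t0) \<psi> c"
    and low: "\<And>z. z \<in> strip y' t0 \<Longrightarrow> - M \<le> \<psi> z"
    and right: "\<And>s. 0 < s \<Longrightarrow> s \<le> t0 \<Longrightarrow> v (y', s) \<le> \<psi> (y', s)"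
    and top: "\<And>y. y \<le> y' \<Longrightarrow> K \<le> \<psi> (y, t0)"
    and z: "y \<le> y'" "0 < s" "s \<le> t0"
  shows "v (y, s) \<le> \<psi> (y, s)"
proof -
  have "0 \<le> - v z + \<psi> z" if "z \<in> strip y' t0" for z
  proof (rule comparison[where A = "open_strip y' t0" and R = "strip y' t0" and a = a and b = b and r = r and k = "- c" and ?s0.0 = 0 and ?s1.0 = t0
        and u = "\<lambda>z. - v z" and M = "K + M"])
    show "r > 0" "a \<ge> 0" using pos a_pos by auto
    show "weak_super a b r (open_strip y' t0) (\<lambda>z. - v z) (- c)"
      unfolding weak_super_def conv_op_minus
    proof (intro allI impI)
      fix z \<delta> assume \<delta>: "\<delta> > 0" and sub: "sq z \<delta> \<subseteq> open_strip y' t0"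
      have "conv_op a b r \<delta> v z = c"
      proof (rule conv_op_v(4)[OF \<delta>])
        show "sq z \<delta> \<subseteq> bond_int" using sub open_strip_subset[OF y' order_refl] by blast
        fix w assume "w \<in> sq z \<delta>"
        then have "w \<in> open_strip y' t0" using sub by blast
        then show "\<gamma> * exp (fst w) < v w \<and> v w < K"
          using above[of "fst w" "snd w"] below[of "fst w" "snd w"] y' by (auto simp: open_strip_iff)
      qed
      then show "- c \<le> - conv_op a b r \<delta> v z" by simp
    qed
    show "classical_super a b r (open_strip y' t0) \<psi> (- (- c))" using \<psi>(2) by simp
    show "continuous_on (strip y' t0) (\<lambda>z. - v z)" by (intro continuous_intros v_cont_strip y' order_refl)
    show "0 \<le> - v z + \<psi> z" if z: "z \<in> strip y' t0 - open_strip y' t0" for z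
    proof -
      obtain y s where ys: "z = (y, s)" by (cases z)
      have yz: "y \<le> y'" "0 < s" "s \<le> t0" "y = y' \<or> s = t0" using z by (auto simp: ys strip_iff open_strip_iff)
      then show ?thesis using right[of s] top[of y] final[of y] y' by (auto simp: ys)
    qed
    show "- (K + M) \<le> - v z + \<psi> z" if z: "z \<in> strip y' t0" for z
      using low[OF z] v_strip_bounds(2)[of "fst z" "snd z"] z y' by (auto simp: strip_iff)
  qed (use that compact_strip_part \<psi> open_open_strip open_strip_strip in \<open>auto simp: strip_iff\<close>)
  from this[of "(y, s)"] z show ?thesis by (simp add: strip_iff)
qed

subsection \<open>The value without conversion\<close>

definition "m = r * K - c"
text \<open>The value of the bond without conversion, which solves the ordinary differential equation
  \<open>- \<beta>' + r \<beta> = c\<close> with \<open>\<beta>(t0) = K\<close>.\<close>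

definition "bond s = c / r + (K - c / r) * exp (- r * (t0 - s))"
definition "bond' s = r * (K - c / r) * exp (- r * (t0 - s))"

lemma m_pos: "m > 0" using cr by (simp add: m_def)

lemma bond_gap: "r * (K - c / r) = m"
  using pos by (simp add: m_def field_simps)

lemma bond'_eq: "bond' s = m * exp (- r * (t0 - s))"
  by (simp add: bond'_def bond_gap)

lemma bond_deriv: "(bond has_real_derivative bond' s) (at s)"
  unfolding bond_def bond'_def by (auto intro!: derivative_eq_intros)

lemma bond_eq: "- bond' s + r * bond s = c"
  using pos by (simp add: bond_def bond'_def algebra_simps)

lemma bond_t0: "bond t0 = K" by (simp add: bond_def)

lemma bond'_bounds: "s \<le> t0 \<Longrightarrow> 0 \<le> bond' s \<and> bond' s \<le> m"
  unfolding bond'_eq using m_pos pos by (auto simp: mult_le_cancel_left1)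

lemma bond_increment:
  assumes "0 \<le> h" "s + h \<le> t0"
  shows "0 \<le> bond (s + h) - bond s" "bond (s + h) - bond s \<le> m * h"
proof -
  have "\<exists>x. bond (s + h) - bond s = h * bond' x \<and> x \<le> t0"
  proof (cases "h = 0")
    case False
    then have "\<exists>z>s. z < s + h \<and> bond (s + h) - bond s = (s + h - s) * bond' z"
      using assms by (intro MVT2 bond_deriv) auto
    then show ?thesis using assms by auto
  qed (use assms in auto)
  then obtain x where x: "bond (s + h) - bond s = h * bond' x" "x \<le> t0" by blast
  then show "0 \<le> bond (s + h) - bond s" "bond (s + h) - bond s \<le> m * h"
    using bond'_bounds[OF x(2)] assms by (auto simp: mult.commute intro: mult_left_mono)
qed

lemma bond_le: "s \<le> t0 \<Longrightarrow> bond s \<le> K" and bond_ge: "s \<le> t0 \<Longrightarrow> K - m * (t0 - s) \<le> bond s"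
  using bond_increment[of "t0 - s" s] by (auto simp: bond_t0)

lemma bond_pos: "0 \<le> s \<Longrightarrow> s \<le> t0 \<Longrightarrow> K * exp (- r * T) \<le> bond s"
proof -
  assume s: "0 \<le> s" "s \<le> t0"
  have "K * exp (- r * T) \<le> K * exp (- r * (t0 - s))"
    using s t0 pos by simp
  also have "\<dots> \<le> K * exp (- r * (t0 - s)) + c / r * (1 - exp (- r * (t0 - s)))"
    using s pos by simp
  also have "\<dots> = bond s" by (simp add: bond_def algebra_simps)
  finally show ?thesis .
qed

lemma bond_cont: "continuous_on S (\<lambda>z. bond (snd z))" "continuous_on S (\<lambda>z. bond (snd z + h))"
  unfolding bond_def by (intro continuous_intros)+

lemma v_ge_bond:
  assumes "y \<le> Y" "0 < s" "s \<le> t0"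
  shows "bond s \<le> v (y, s)"
proof -
  have "0 \<le> v (y, s) + (\<lambda>z. - bond (snd z)) (y, s)"
  proof (rule lower_comparison[OF _ _ _ _ _ assms, where M = K])
    show "continuous_on (strip Y t0) (\<lambda>z. - bond (snd z))" by (intro continuous_intros bond_cont)
    have "classical_super a b r (open_strip Y t0) (\<lambda>z. (\<lambda>y s. - bond s) (fst z) (snd z)) (- c)"
      by (rule classical_superI[where \<psi>y = "\<lambda>y s. 0" and \<psi>yy = "\<lambda>y s. 0" and \<psi>s = "\<lambda>y s. - bond' s"])
        (use bond_eq in \<open>auto intro!: derivative_eq_intros bond_deriv simp: algebra_simps\<close>)
    then show "classical_super a b r (open_strip Y t0) (\<lambda>z. - bond (snd z)) (- c)" by simp
  qed (use bond_le in \<open>auto simp: strip_iff bond_t0\<close>)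
  then show ?thesis by simp
qed

subsection \<open>Monotonicity and Lipschitz bounds\<close>

text \<open>The final value \<open>K\<close> is the largest value that is possible.\<close>

lemma v_mono_time:
  assumes "0 \<le> h" "y \<le> Y" "0 < s" "s + h \<le> t0"
  shows "v (y, s) \<le> v (y, s + h)"
proof -
  have "v (y + 0, s + 0) \<le> v (y + 0, s + h) + (\<lambda>z. 0) (y, s)"
  proof (rule shift_comparison[where y' = Y and s' = "t0 - h" and M = 0])
    have "classical_super a b r (open_strip Y (t0 - h)) (\<lambda>z. (\<lambda>y s. 0) (fst z) (snd z)) 0"
      by (rule classical_superI[where \<psi>y = "\<lambda>y s. 0" and \<psi>yy = "\<lambda>y s. 0" and \<psi>s = "\<lambda>y s. 0"]) auto
    then show "classical_super a b r (open_strip Y (t0 - h)) (\<lambda>z. 0) 0" by simp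
  next
    fix s assume "0 < s" "s \<le> t0 - h"
    then show "v (Y + 0, s + 0) \<le> v (Y + 0, s + h) + 0" using v_right assms t0 by simp
  next
    fix y assume "y \<le> Y"
    then show "v (y + 0, t0 - h + 0) \<le> v (y + 0, t0 - h + h) + 0"
      using final v_strip_bounds(2)[of y "t0 - h"] assms by simp
  next
    fix y s assume "y \<le> Y" "0 < s" "s \<le> t0 - h" "v (y + 0, s + 0) = \<gamma> * exp (y + 0)"
    then show "v (y + 0, s + 0) \<le> v (y + 0, s + h) + 0"
      using v_strip_bounds(1)[of y "s + h"] assms by simp
  qed (use assms in auto)
  then show ?thesis by simp
qed

text \<open>The function \<open>K - m (t0 - s)\<close> lies below the bond without conversion and hence
  below \<open>v\<close>, which is the estimate at the final time.\<close>

lemma v_lip_time: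
  assumes "0 \<le> h" "y \<le> Y" "0 < s" "s + h \<le> t0"
  shows "v (y, s + h) \<le> v (y, s) + m * h"
proof -
  have "v (y + 0, s + h) \<le> v (y + 0, s + 0) + (\<lambda>z. m * h) (y, s)"
  proof (rule shift_comparison[where y' = Y and s' = "t0 - h" and M = 0])
    have "classical_super a b r (open_strip Y (t0 - h)) (\<lambda>z. (\<lambda>y s. m * h) (fst z) (snd z)) 0"
      by (rule classical_superI[where \<psi>y = "\<lambda>y s. 0" and \<psi>yy = "\<lambda>y s. 0" and \<psi>s = "\<lambda>y s. 0"])
        (use m_pos pos assms in auto)
    then show "classical_super a b r (open_strip Y (t0 - h)) (\<lambda>z. m * h) 0" by simp
  next
    fix s assume "0 < s" "s \<le> t0 - h"
    then show "v (Y + 0, s + h) \<le> v (Y + 0, s + 0) + m * h" using v_right assms t0 m_pos by simp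
  next
    fix y assume "y \<le> Y"
    then show "v (y + 0, t0 - h + h) \<le> v (y + 0, t0 - h + 0) + m * h"
      using final v_ge_bond[of y "t0 - h"] bond_ge[of "t0 - h"] assms by simp
  next
    fix y s assume "y \<le> Y" "0 < s" "s \<le> t0 - h" "v (y + 0, s + h) = \<gamma> * exp (y + 0)"
    then show "v (y + 0, s + h) \<le> v (y + 0, s + 0) + m * h"
      using v_strip_bounds(1)[of y s] assms m_pos by (simp add: add_increasing2)
  qed (use assms m_pos in \<open>auto intro!: mult_nonneg_nonneg\<close>)
  then show ?thesis by simp
qed

text \<open>Translating in \<open>y\<close> dilates the price, which raises the obstacle.\<close>

lemma v_mono_space:
  assumes "0 \<le> h" "y + h \<le> Y" "0 < s" "s \<le> t0"
  shows "v (y, s) \<le> v (y + h, s)"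
proof -
  have "v (y + 0, s + 0) \<le> v (y + h, s + 0) + (\<lambda>z. 0) (y, s)"
  proof (rule shift_comparison[where y' = "Y - h" and s' = t0 and M = 0])
    have "classical_super a b r (open_strip (Y - h) t0) (\<lambda>z. (\<lambda>y s. 0) (fst z) (snd z)) 0"
      by (rule classical_superI[where \<psi>y = "\<lambda>y s. 0" and \<psi>yy = "\<lambda>y s. 0" and \<psi>s = "\<lambda>y s. 0"]) auto
    then show "classical_super a b r (open_strip (Y - h) t0) (\<lambda>z. 0) 0" by simp
  next
    fix s assume "0 < s" "s \<le> t0"
    then show "v (Y - h + 0, s + 0) \<le> v (Y - h + h, s + 0) + 0"
      using v_right t0 v_strip_bounds(2)[of "Y - h" s] assms by simp
  next
    fix y assume "y \<le> Y - h"
    then show "v (y + 0, t0 + 0) \<le> v (y + h, t0 + 0) + 0"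
      using final assms by simp
  next
    fix y s assume ys: "y \<le> Y - h" "0 < s" "s \<le> t0" "v (y + 0, s + 0) = \<gamma> * exp (y + 0)"
    have "\<gamma> * exp y \<le> \<gamma> * exp (y + h)" using pos assms by simp
    then show "v (y + 0, s + 0) \<le> v (y + h, s + 0) + 0"
      using v_strip_bounds(1)[of "y + h" s] ys assms by simp
  qed (use assms in auto)
  then show ?thesis by simp
qed

text \<open>The function \<open>\<gamma> x\<close> satisfies \<open>L(\<gamma> x) = q \<gamma> x \<ge>
  0\<close>, and the increment of the obstacle under the dilation is a multiple of it.\<close>

lemma v_lip_space:
  assumes "0 \<le> h" "y + h \<le> Y" "0 < s" "s \<le> t0"
  shows "v (y + h, s) \<le> v (y, s) + \<gamma> * (exp (y + h) - exp y)"
proof -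
  let ?\<psi> = "\<lambda>y. \<gamma> * (exp h - 1) * exp y"
  have nn: "0 \<le> \<gamma> * (exp h - 1) * exp y" for y using pos assms by simp
  have eq: "?\<psi> y = \<gamma> * (exp (y + h) - exp y)" for y by (simp add: exp_add algebra_simps)
  have "v (y + h, s + 0) \<le> v (y + 0, s + 0) + (\<lambda>z. ?\<psi> (fst z)) (y, s)"
  proof (rule shift_comparison[where y' = "Y - h" and s' = t0 and M = 0])
    have "classical_super a b r (open_strip (Y - h) t0) (\<lambda>z. (\<lambda>y s. ?\<psi> y) (fst z) (snd z)) 0"
    proof (rule classical_superI[where \<psi>y = "\<lambda>y s. ?\<psi> y" and \<psi>yy = "\<lambda>y s. ?\<psi> y" and \<psi>s = "\<lambda>y s. 0"])
      show "0 \<le> - 0 - a * ?\<psi> y - b * ?\<psi> y + r * ?\<psi> y" for y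
      proof -
        have "- 0 - a * ?\<psi> y - b * ?\<psi> y + r * ?\<psi> y = q * ?\<psi> y"
          by (simp add: a_def b_def algebra_simps)
        then show ?thesis using nn pos by simp
      qed
    qed (auto intro!: derivative_eq_intros)
    then show "classical_super a b r (open_strip (Y - h) t0) (\<lambda>z. ?\<psi> (fst z)) 0" by simp
    show "continuous_on (strip (Y - h) t0) (\<lambda>z. ?\<psi> (fst z))" by (intro continuous_intros)
  next
    fix s assume s: "0 < s" "s \<le> t0"
    have "K = \<gamma> * exp Y" using exp_Y pos by simp
    then show "v (Y - h + h, s + 0) \<le> v (Y - h + 0, s + 0) + ?\<psi> (fst (Y - h, s))"
      using v_right[of s] t0 v_strip_bounds(1)[of "Y - h" s] assms s eq[of "Y - h"] by (simp add: algebra_simps)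
  next
    fix y assume "y \<le> Y - h"
    then show "v (y + h, t0 + 0) \<le> v (y + 0, t0 + 0) + ?\<psi> (fst (y, t0))"
      using final assms nn[of y] by simp
  next
    fix y s assume ys: "y \<le> Y - h" "0 < s" "s \<le> t0" "v (y + h, s + 0) = \<gamma> * exp (y + h)"
    then show "v (y + h, s + 0) \<le> v (y + 0, s + 0) + ?\<psi> (fst (y, s))"
      using v_strip_bounds(1)[of y s] assms unfolding fst_conv eq by (simp add: right_diff_distrib)
  qed (use assms nn in auto)
  then show ?thesis using eq[of y] by simp
qed

end

context bond_strip
begin

section \<open>Decay near the zero share price\<close>

text \<open>To the left of this point the bond without conversion is worth at least twice as much as the
  shares.\<close>

definition "yz = ln (K * exp (- r * T) / (2 * \<gamma>))"

lemma exp_yz: "\<gamma> * exp yz = K * exp (- r * T) / 2"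
  using pos by (simp add: yz_def)

lemma yz_less_Y: "yz < Y"
proof -
  have "exp (- r * T) \<le> 1" using pos by simp
  then have "K * exp (- r * T) \<le> K * 1" using pos by (intro mult_left_mono) auto
  then have "\<gamma> * exp yz < K" unfolding exp_yz using pos by linarith
  then have "exp yz < K / \<gamma>" using pos by (simp add: field_simps)
  then show ?thesis by (simp add: exp_le_iff)
qed

lemma no_conversion_near_zero:
  assumes "y \<le> yz" "0 < s" "s \<le> t0"
  shows "\<gamma> * exp y < v (y, s)"
proof -
  have "\<gamma> * exp y \<le> \<gamma> * exp yz" using assms pos by simp
  also have "\<dots> < K * exp (- r * T)" unfolding exp_yz using pos by simp
  also have "\<dots> \<le> bond s" using bond_pos[of s] assms by simp
  also have "\<dots> \<le> v (y, s)" using v_ge_bond[of y s] assms yz_less_Y by simp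
  finally show ?thesis .
qed

definition "\<Lambda> = max 0 (4 * a + 2 * b - r)"
text \<open>The barrier \<open>x\<^sup>2\<close>, normalised at \<open>y = yz\<close>; the growth rate
  \<open>\<Lambda>\<close> makes it a supersolution.\<close>

definition "B y s = exp (2 * (y - yz) + \<Lambda> * (t0 - s))"

lemma B_pos: "B y s > 0" by (simp add: B_def)

lemma B_ge: "s \<le> t0 \<Longrightarrow> exp (2 * (y - yz)) \<le> B y s"
  by (simp add: B_def \<Lambda>_def)

lemma B_deriv: "((\<lambda>y. B y s) has_real_derivative 2 * B y s) (at y)"
  "((\<lambda>s. B y s) has_real_derivative - \<Lambda> * B y s) (at s)"
  unfolding B_def by (auto intro!: derivative_eq_intros)

lemma B_cont: "continuous_on S (\<lambda>z. B (fst z) (snd z))"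
  unfolding B_def by (intro continuous_intros)

lemma B_super: "0 \<le> (\<Lambda> - 4 * a - 2 * b + r) * B y s"
  using B_pos[of y s] by (intro mult_nonneg_nonneg) (auto simp: \<Lambda>_def)

lemma classical_B:
  assumes "k \<ge> 0"
  shows "classical_super a b r A (\<lambda>z. k * B (fst z) (snd z)) 0"
proof (rule classical_superI[where \<psi> = "\<lambda>y s. k * B y s" and \<psi>y = "\<lambda>y s. k * (2 * B y s)"
      and \<psi>yy = "\<lambda>y s. k * (4 * B y s)" and \<psi>s = "\<lambda>y s. k * (- \<Lambda> * B y s)"])
  fix y s
  have "0 \<le> k * ((\<Lambda> - 4 * a - 2 * b + r) * B y s)" using assms B_super by simp
  then show "0 \<le> - (k * (- \<Lambda> * B y s)) - a * (k * (4 * B y s)) - b * (k * (2 * B y s)) + r * (k * B y s)"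
    by (simp add: algebra_simps)
qed (auto intro!: derivative_eq_intros B_deriv)

lemma classical_time_B:
  assumes "\<And>z. z \<in> A \<Longrightarrow> snd z \<le> t0"
  shows "classical_super a b r A (\<lambda>z. bond (snd z) + m * (t0 - snd z) * B (fst z) (snd z)) c"
proof (rule classical_superI[where \<psi> = "\<lambda>y s. bond s + m * (t0 - s) * B y s" and \<psi>y = "\<lambda>y s. m * (t0 - s) * (2 * B y s)"
      and \<psi>yy = "\<lambda>y s. m * (t0 - s) * (4 * B y s)"
      and \<psi>s = "\<lambda>y s. bond' s + (- m * B y s + m * (t0 - s) * (- \<Lambda> * B y s))"])
  fix y s assume "(y, s) \<in> A"
  then have "0 \<le> m * (t0 - s) * ((\<Lambda> - 4 * a - 2 * b + r) * B y s)"
    using assms[of "(y, s)"] m_pos by (intro mult_nonneg_nonneg[OF _ B_super]) auto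
  moreover have "0 \<le> m * B y s" using m_pos B_pos[of y s] by simp
  ultimately show "c \<le> - (bond' s + (- m * B y s + m * (t0 - s) * (- \<Lambda> * B y s))) - a * (m * (t0 - s) * (4 * B y s))
      - b * (m * (t0 - s) * (2 * B y s)) + r * (bond s + m * (t0 - s) * B y s)"
    using bond_eq[of s] by (simp add: algebra_simps)
qed (auto intro!: derivative_eq_intros B_deriv bond_deriv)

text \<open>The factor \<open>t0 - s\<close> in the barrier is what makes the time increments at the final
  time small of first order.\<close>

lemma v_le_bond:
  assumes "y \<le> yz" "0 < s" "s \<le> t0"
  shows "v (y, s) \<le> bond s + m * (t0 - s) * B y s"
proof -
  have "v (y, s) \<le> (\<lambda>z. bond (snd z) + m * (t0 - snd z) * B (fst z) (snd z)) (y, s)"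
  proof (rule upper_comparison[where y' = yz and M = 0])
    show "classical_super a b r (open_strip yz t0) (\<lambda>z. bond (snd z) + m * (t0 - snd z) * B (fst z) (snd z)) c"
      by (rule classical_time_B) (simp add: open_strip_iff)
    show "continuous_on (strip yz t0) (\<lambda>z. bond (snd z) + m * (t0 - snd z) * B (fst z) (snd z))"
      by (intro continuous_intros bond_cont B_cont)
    show "- 0 \<le> bond (snd z) + m * (t0 - snd z) * B (fst z) (snd z)" if "z \<in> strip yz t0" for z
    proof -
      have "0 \<le> bond (snd z)" using bond_pos[of "snd z"] that pos by (simp add: strip_iff) (smt (verit) exp_gt_zero mult_pos_pos)
      moreover have "0 \<le> m * (t0 - snd z) * B (fst z) (snd z)"
        using m_pos B_pos[of "fst z" "snd z"] that by (intro mult_nonneg_nonneg) (auto simp: strip_iff)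
      ultimately show ?thesis by simp
    qed
    fix s assume s: "0 < s" "s \<le> t0"
    have "m * (t0 - s) * 1 \<le> m * (t0 - s) * B yz s"
      using B_ge[of s yz] s m_pos by (intro mult_left_mono) auto
    then show "v (yz, s) \<le> bond (snd (yz, s)) + m * (t0 - snd (yz, s)) * B (fst (yz, s)) (snd (yz, s))"
      using bond_ge[of s] v_strip_bounds(2)[of yz s] s yz_less_Y by simp
  qed (use assms yz_less_Y no_conversion_near_zero bond_t0 in auto)
  then show ?thesis by simp
qed

lemma classical_bond_increment:
  "classical_super a b r A (\<lambda>z. bond (snd z + h) - bond (snd z)) 0"
  "classical_super a b r A (\<lambda>z. - (bond (snd z + h) - bond (snd z))) 0"
proof -
  have D: "((\<lambda>s. bond (s + h)) has_real_derivative bond' (s + h)) (at s)" for s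
  proof -
    have "((\<lambda>s. s + h) has_real_derivative 1) (at s)" by (auto intro!: derivative_eq_intros)
    from DERIV_chain2[OF bond_deriv this] show ?thesis by simp
  qed
  have "classical_super a b r A (\<lambda>z. (\<lambda>y s. bond (s + h) - bond s) (fst z) (snd z)) 0"
    by (rule classical_superI[where \<psi>y = "\<lambda>y s. 0" and \<psi>yy = "\<lambda>y s. 0" and \<psi>s = "\<lambda>y s. bond' (s + h) - bond' s"])
      (use bond_eq in \<open>auto intro!: derivative_eq_intros D bond_deriv simp: algebra_simps\<close>)
  then show "classical_super a b r A (\<lambda>z. bond (snd z + h) - bond (snd z)) 0" by simp
  have "classical_super a b r A (\<lambda>z. (\<lambda>y s. - (bond (s + h) - bond s)) (fst z) (snd z)) 0"
    by (rule classical_superI[where \<psi>y = "\<lambda>y s. 0" and \<psi>yy = "\<lambda>y s. 0" and \<psi>s = "\<lambda>y s. - (bond' (s + h) - bond' s)"])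
      (use bond_eq in \<open>auto intro!: derivative_eq_intros D bond_deriv simp: algebra_simps\<close>)
  then show "classical_super a b r A (\<lambda>z. - (bond (snd z + h) - bond (snd z))) 0" by simp
qed

text \<open>At the final time the increment of \<open>v - bond\<close> over a step \<open>h\<close> is
  estimated by the previous bound at distance \<open>h\<close> from \<open>t0\<close>, and at
  \<open>y = yz\<close> by the global Lipschitz bound.\<close>

lemma v_time_near_zero:
  assumes h: "0 \<le> h" and ys: "y \<le> yz" "0 < s" "s + h \<le> t0"
  shows "v (y, s + h) \<le> v (y, s) + (bond (s + h) - bond s) + m * h * B y s"
    and "v (y, s) + (bond (s + h) - bond s) \<le> v (y, s + h) + m * h * B y s"
proof -
  have mhB: "0 \<le> m * h * B y s" for y s using m_pos h B_pos[of y s] by simp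
  have inc: "0 \<le> bond (s + h) - bond s \<and> bond (s + h) - bond s \<le> m * h" if "s \<le> t0 - h" for s
    using bond_increment[OF h, of s] that by simp
  have mh: "0 \<le> m * h" using m_pos h by simp
  have B1: "m * h \<le> m * h * B yz s" if "s \<le> t0 - h" for s
    using mult_left_mono[OF B_ge[of s yz] mh] that h by simp
  have "v (y + 0, s + h) \<le> v (y + 0, s + 0) + (\<lambda>z. (bond (snd z + h) - bond (snd z)) + (m * h) * B (fst z) (snd z)) (y, s)"
  proof (rule shift_comparison[where y' = yz and s' = "t0 - h" and M = 0])
    show "continuous_on (strip yz (t0 - h)) (\<lambda>z. (bond (snd z + h) - bond (snd z)) + (m * h) * B (fst z) (snd z))"
      by (intro continuous_intros bond_cont B_cont)
    show "classical_super a b r (open_strip yz (t0 - h)) (\<lambda>z. (bond (snd z + h) - bond (snd z)) + (m * h) * B (fst z) (snd z)) 0"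
      using classical_super_add[OF classical_bond_increment(1) classical_B[OF mh]] by simp
  next
    fix s assume s: "0 < s" "s \<le> t0 - h"
    then show "v (yz + 0, s + h) \<le> v (yz + 0, s + 0) +
        (bond (snd (yz, s) + h) - bond (snd (yz, s)) + m * h * B (fst (yz, s)) (snd (yz, s)))"
      using v_lip_time[OF h, of yz s] yz_less_Y inc[of s] B1[of s] by simp
  next
    fix y assume "y \<le> yz"
    then show "v (y + 0, t0 - h + h) \<le> v (y + 0, t0 - h + 0) +
        (bond (snd (y, t0 - h) + h) - bond (snd (y, t0 - h)) + m * h * B (fst (y, t0 - h)) (snd (y, t0 - h)))"
      using final[of y] v_ge_bond[of y "t0 - h"] yz_less_Y ys h mhB[of y "t0 - h"] by (simp add: bond_t0)
  next
    fix y s assume "y \<le> yz" "0 < s" "s \<le> t0 - h" "v (y + 0, s + h) = \<gamma> * exp (y + 0)"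
    then show "v (y + 0, s + h) \<le> v (y + 0, s + 0) +
        (bond (snd (y, s) + h) - bond (snd (y, s)) + m * h * B (fst (y, s)) (snd (y, s)))"
      using no_conversion_near_zero[of y "s + h"] h by simp
  qed (use assms yz_less_Y inc mhB in \<open>auto simp: strip_iff intro!: add_nonneg_nonneg\<close>)
  then show "v (y, s + h) \<le> v (y, s) + (bond (s + h) - bond s) + m * h * B y s" by simp
  have "v (y + 0, s + 0) \<le> v (y + 0, s + h) + (\<lambda>z. - (bond (snd z + h) - bond (snd z)) + (m * h) * B (fst z) (snd z)) (y, s)"
  proof (rule shift_comparison[where y' = yz and s' = "t0 - h" and M = "m * h"])
    show "continuous_on (strip yz (t0 - h)) (\<lambda>z. - (bond (snd z + h) - bond (snd z)) + (m * h) * B (fst z) (snd z))"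
      by (intro continuous_intros bond_cont B_cont)
    show "classical_super a b r (open_strip yz (t0 - h)) (\<lambda>z. - (bond (snd z + h) - bond (snd z)) + (m * h) * B (fst z) (snd z)) 0"
      using classical_super_add[OF classical_bond_increment(2) classical_B[OF mh]] by simp
  next
    fix z assume "z \<in> strip yz (t0 - h)"
    then show "- (m * h) \<le> - (bond (snd z + h) - bond (snd z)) + m * h * B (fst z) (snd z)"
      using inc[of "snd z"] mhB[of "fst z" "snd z"] by (simp add: strip_iff)
  next
    fix s assume s: "0 < s" "s \<le> t0 - h"
    then show "v (yz + 0, s + 0) \<le> v (yz + 0, s + h) +
        (- (bond (snd (yz, s) + h) - bond (snd (yz, s))) + m * h * B (fst (yz, s)) (snd (yz, s)))"
      using v_mono_time[OF h, of yz s] yz_less_Y inc[of s] B1[of s] by simp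
  next
    fix y assume "y \<le> yz"
    then show "v (y + 0, t0 - h + 0) \<le> v (y + 0, t0 - h + h) +
        (- (bond (snd (y, t0 - h) + h) - bond (snd (y, t0 - h))) + m * h * B (fst (y, t0 - h)) (snd (y, t0 - h)))"
      using final[of y] v_le_bond[of y "t0 - h"] yz_less_Y ys h by (simp add: bond_t0)
  next
    fix y s assume "y \<le> yz" "0 < s" "s \<le> t0 - h" "v (y + 0, s + 0) = \<gamma> * exp (y + 0)"
    then show "v (y + 0, s + 0) \<le> v (y + 0, s + h) +
        (- (bond (snd (y, s) + h) - bond (snd (y, s))) + m * h * B (fst (y, s)) (snd (y, s)))"
      using no_conversion_near_zero[of y s] h by simp
  qed (use assms yz_less_Y in auto)
  then show "v (y, s) + (bond (s + h) - bond s) \<le> v (y, s + h) + m * h * B y s" by simp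
qed

definition "C0 = \<gamma> * exp (yz + 2)"

lemma C0_pos: "C0 > 0" using pos by (simp add: C0_def)

lemma exp_diff_le: "exp y - exp x \<le> (y - x) * exp y" for x y :: real
proof -
  have "1 + (x - y) \<le> exp (x - y)" by (rule exp_ge_add_one_self)
  then have "(1 + (x - y)) * exp y \<le> exp (x - y) * exp y" by (intro mult_right_mono) auto
  then show ?thesis by (simp add: exp_diff algebra_simps)
qed

text \<open>Both functions are \<open>K\<close> at the final time, and at the right end of the region the
  increment is controlled by the global Lipschitz bound. The factor \<open>exp 2\<close> in
  \<open>C0\<close> pays for the right end being \<open>yz - h\<close> instead of
  \<open>yz\<close>.\<close>

lemma v_space_near_zero:
  assumes h: "0 \<le> h" "h \<le> 1" and ys: "y + h \<le> yz" "0 < s" "s \<le> t0"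
  shows "v (y + h, s) \<le> v (y, s) + C0 * h * B y s"
proof -
  have Ch: "0 \<le> C0 * h" using C0_pos h by simp
  have ChB: "0 \<le> C0 * h * B y s" for y s using Ch B_pos[of y s] by simp
  have "v (y + h, s + 0) \<le> v (y + 0, s + 0) + (\<lambda>z. (C0 * h) * B (fst z) (snd z)) (y, s)"
  proof (rule shift_comparison[where y' = "yz - h" and s' = t0 and M = 0])
    show "continuous_on (strip (yz - h) t0) (\<lambda>z. (C0 * h) * B (fst z) (snd z))"
      by (intro continuous_intros B_cont)
    show "classical_super a b r (open_strip (yz - h) t0) (\<lambda>z. (C0 * h) * B (fst z) (snd z)) 0"
      by (rule classical_B[OF Ch])
  next
    fix s assume s: "0 < s" "s \<le> t0"
    have "v (yz - h + h, s) \<le> v (yz - h, s) + \<gamma> * (exp (yz - h + h) - exp (yz - h))"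
      using s yz_less_Y by (intro v_lip_space h(1)) auto
    also have "\<gamma> * (exp (yz - h + h) - exp (yz - h)) \<le> \<gamma> * (h * exp yz)"
      using exp_diff_le[where x = "yz - h" and y = yz] pos by simp
    also have "\<gamma> * (h * exp yz) = C0 * h * exp (- 2)"
      by (simp add: C0_def exp_add exp_minus)
    also have "\<dots> \<le> C0 * h * B (yz - h) s"
    proof (rule mult_left_mono[OF _ Ch])
      have "exp (- 2) \<le> exp (2 * (yz - h - yz))" using h by simp
      also have "\<dots> \<le> B (yz - h) s" by (rule B_ge[OF s(2)])
      finally show "exp (- 2) \<le> B (yz - h) s" .
    qed
    finally show "v (yz - h + h, s + 0) \<le> v (yz - h + 0, s + 0) + C0 * h * B (fst (yz - h, s)) (snd (yz - h, s))"
      by simp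
  next
    fix y assume y: "y \<le> yz - h"
    then show "v (y + h, t0 + 0) \<le> v (y + 0, t0 + 0) + C0 * h * B (fst (y, t0)) (snd (y, t0))"
      using final[of y] final[of "y + h"] h yz_less_Y ChB[of y t0] by simp
  next
    fix y s assume "y \<le> yz - h" "0 < s" "s \<le> t0" "v (y + h, s + 0) = \<gamma> * exp (y + h)"
    then show "v (y + h, s + 0) \<le> v (y + 0, s + 0) + C0 * h * B (fst (y, s)) (snd (y, s))"
      using no_conversion_near_zero[of "y + h" s] by simp
  qed (use assms yz_less_Y ChB in auto)
  then show ?thesis by simp
qed

text \<open>Bounding \<open>t0\<close> by \<open>T\<close> removes the dependence of the barrier on the solution, so that the constants
  below depend on the data only.\<close>

definition "E = exp (\<Lambda> * T - 2 * yz)"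

lemma E_pos: "E > 0" by (simp add: E_def)

lemma B_le: "0 \<le> s \<Longrightarrow> B y s \<le> E * exp (2 * y)"
proof -
  assume s: "0 \<le> s"
  have "\<Lambda> * (t0 - s) \<le> \<Lambda> * T" using s t0 by (intro mult_left_mono) (auto simp: \<Lambda>_def)
  then have "B y s \<le> exp (\<Lambda> * T - 2 * yz + 2 * y)" by (simp add: B_def)
  then show ?thesis by (simp add: E_def exp_add)
qed

definition "C1 = C0 * E + K * exp (2 - 2 * yz)"

lemma C1_pos: "C1 > 0" using C0_pos E_pos pos by (simp add: C1_def add_pos_pos)

lemma v_space_increment:
  assumes h: "0 \<le> h" "h \<le> 1" and ys: "y + h \<le> Y" "0 < s" "s \<le> t0"
  shows "v (y + h, s) - v (y, s) \<le> C1 * h * exp (2 * y)"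
proof (cases "y + h \<le> yz")
  case True
  have "v (y + h, s) - v (y, s) \<le> C0 * h * B y s"
    using v_space_near_zero[OF h True ys(2,3)] by simp
  also have "\<dots> \<le> C0 * h * (E * exp (2 * y))"
    using B_le[of s y] ys C0_pos h by (intro mult_left_mono) auto
  also have "\<dots> \<le> C0 * h * (E * exp (2 * y)) + K * exp (2 - 2 * yz) * h * exp (2 * y)"
    using pos h by simp
  finally show ?thesis by (simp add: C1_def algebra_simps)
next
  case False
  have "v (y + h, s) - v (y, s) \<le> \<gamma> * (exp (y + h) - exp y)"
    using v_lip_space[OF h(1) ys] by simp
  also have "\<dots> \<le> \<gamma> * (h * exp (y + h))"
    using exp_diff_le[where x = y and y = "y + h"] pos by simp
  also have "\<dots> = h * (\<gamma> * exp (y + h))" by simp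
  also have "\<dots> \<le> h * K"
    using exp_le_iff(1)[of "y + h"] ys pos h by (intro mult_left_mono) (auto simp: field_simps)
  also have "\<dots> \<le> h * (K * exp (2 - 2 * yz + 2 * y))"
  proof -
    have "1 \<le> exp (2 - 2 * yz + 2 * y)" using False h by simp
    then have "K * 1 \<le> K * exp (2 - 2 * yz + 2 * y)" using pos by (intro mult_left_mono) auto
    then show ?thesis using h by (intro mult_left_mono) auto
  qed
  also have "\<dots> = K * exp (2 - 2 * yz) * h * exp (2 * y)" by (simp add: exp_add)
  also have "\<dots> \<le> C0 * E * h * exp (2 * y) + K * exp (2 - 2 * yz) * h * exp (2 * y)"
    using C0_pos E_pos h by simp
  finally show ?thesis by (simp add: C1_def algebra_simps)
qed

end

section \<open>Estimates for the mollified value\<close>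

lemma conv_increment:
  assumes \<delta>: "\<delta> > 0" and u: "continuous_on A u" and sub: "sq z \<delta> \<subseteq> A" "sq (z + k) \<delta> \<subseteq> A"
    and bd: "\<And>w. w \<in> sq z \<delta> \<Longrightarrow> lo \<le> u (w + k) - u w \<and> u (w + k) - u w \<le> hi"
  shows "lo \<le> conv (moll \<delta>) (moll \<delta>) u (z + k) - conv (moll \<delta>) (moll \<delta>) u z"
    and "conv (moll \<delta>) (moll \<delta>) u (z + k) - conv (moll \<delta>) (moll \<delta>) u z \<le> hi"
proof -
  note mb = moll_bump[OF \<delta>]
  have c1: "continuous_on (sq z \<delta>) u" and c2: "continuous_on (sq (z + k) \<delta>) u"
    using continuous_on_subset[OF u] sub by auto
  have c3: "continuous_on (sq z \<delta>) (\<lambda>w. u (w + k))"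
    by (rule continuous_on_compose2[OF c2]) (auto intro!: continuous_intros simp: sq_shift)
  have c4: "continuous_on (sq z \<delta>) (\<lambda>w. u (w + k) - u w)" by (intro continuous_intros c3 c1)
  have eq: "conv (moll \<delta>) (moll \<delta>) u (z + k) - conv (moll \<delta>) (moll \<delta>) u z =
      conv (moll \<delta>) (moll \<delta>) (\<lambda>w. u (w + k) - u w) z"
    unfolding conv_diff[OF mb mb c3 c1] conv_shift[OF mb mb c2] ..
  have "conv (moll \<delta>) (moll \<delta>) (\<lambda>w. lo) z \<le> conv (moll \<delta>) (moll \<delta>) (\<lambda>w. u (w + k) - u w) z"
    by (rule conv_moll_mono[OF \<delta> continuous_on_const c4]) (use bd in blast)
  moreover have "conv (moll \<delta>) (moll \<delta>) (\<lambda>w. u (w + k) - u w) z \<le> conv (moll \<delta>) (moll \<delta>) (\<lambda>w. hi) z"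
    by (rule conv_moll_mono[OF \<delta> c4 continuous_on_const]) (use bd in blast)
  ultimately show "lo \<le> conv (moll \<delta>) (moll \<delta>) u (z + k) - conv (moll \<delta>) (moll \<delta>) u z"
    and "conv (moll \<delta>) (moll \<delta>) u (z + k) - conv (moll \<delta>) (moll \<delta>) u z \<le> hi"
    unfolding eq conv_moll_const[OF \<delta>] by auto
qed

lemma deriv_between:
  fixes f :: "real \<Rightarrow> real"
  assumes f: "(f has_real_derivative d) (at x)" and e: "e > 0"
    and bd: "\<And>h. 0 < h \<Longrightarrow> h < e \<Longrightarrow> lo * h \<le> f (x + h) - f x \<and> f (x + h) - f x \<le> hi * h"
  shows "lo \<le> d" "d \<le> hi"
proof -
  have lim: "((\<lambda>h. (f (x + h) - f x) / h) \<longlongrightarrow> d) (at_right 0)"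
    using f unfolding DERIV_def by (rule filterlim_mono) (auto simp: at_within_le_at)
  have ev: "\<forall>\<^sub>F h in at_right 0. lo \<le> (f (x + h) - f x) / h \<and> (f (x + h) - f x) / h \<le> hi"
    unfolding eventually_at_right[OF e]
    by (intro exI[of _ e]) (use e bd in \<open>auto simp: field_simps\<close>)
  show "lo \<le> d" by (rule tendsto_lowerbound[OF lim eventually_mono[OF ev]]) auto
  show "d \<le> hi" by (rule tendsto_upperbound[OF lim eventually_mono[OF ev]]) auto
qed

lemma conv_moll_tendsto:
  assumes A: "open A" and u: "continuous_on A u" and z: "z \<in> A"
  shows "((\<lambda>\<delta>. conv (moll \<delta>) (moll \<delta>) u z) \<longlongrightarrow> u z) (at_right 0)"
proof (rule tendstoI)
  fix e :: real assume e: "e > 0"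
  have "open (A \<inter> u -` ball (u z) (e / 2))"
    by (rule continuous_open_preimage[OF u A]) simp
  moreover have "z \<in> A \<inter> u -` ball (u z) (e / 2)" using z e by simp
  ultimately obtain d where d: "d > 0" "sq z d \<subseteq> A \<inter> u -` ball (u z) (e / 2)"
    using open_contains_sq by blast
  have "dist (conv (moll \<delta>) (moll \<delta>) u z) (u z) < e" if \<delta>: "0 < \<delta>" "\<delta> < d" for \<delta>
  proof -
    have "sq z \<delta> \<subseteq> sq z d" using \<delta> by (auto simp: sq_iff)
    then have sub: "sq z \<delta> \<subseteq> A \<inter> u -` ball (u z) (e / 2)" using d(2) by blast
    have cont: "continuous_on (sq z \<delta>) u" using sub by (intro continuous_on_subset[OF u]) auto
    have near: "u z - e / 2 \<le> u w \<and> u w \<le> u z + e / 2" if "w \<in> sq z \<delta>" for w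
    proof -
      have "dist (u z) (u w) < e / 2" using sub that by auto
      then show ?thesis unfolding dist_real_def by linarith
    qed
    have "conv (moll \<delta>) (moll \<delta>) (\<lambda>w. u z - e / 2) z \<le> conv (moll \<delta>) (moll \<delta>) u z"
      by (rule conv_moll_mono[OF \<delta>(1) continuous_on_const cont]) (use near in blast)
    moreover have "conv (moll \<delta>) (moll \<delta>) u z \<le> conv (moll \<delta>) (moll \<delta>) (\<lambda>w. u z + e / 2) z"
      by (rule conv_moll_mono[OF \<delta>(1) cont continuous_on_const]) (use near in blast)
    ultimately show ?thesis
      unfolding conv_moll_const[OF \<delta>(1)] dist_real_def using e by linarith
  qed
  then show "\<forall>\<^sub>F \<delta> in at_right 0. dist (conv (moll \<delta>) (moll \<delta>) u z) (u z) < e"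
    unfolding eventually_at_right[OF d(1)] by (intro exI[of _ d]) (use d in auto)
qed

context bond_strip
begin

lemma bond_lip:
  assumes "x \<le> t0" "s \<le> t0"
  shows "\<bar>bond x - bond s\<bar> \<le> m * \<bar>x - s\<bar>"
  using bond_increment[of "x - s" s] bond_increment[of "s - x" x] assms
  by (cases "s \<le> x") auto

lemma bond'_lip:
  assumes "x \<le> t0" "s \<le> t0"
  shows "\<bar>bond' x - bond' s\<bar> \<le> r * m * \<bar>x - s\<bar>"
proof -
  have "norm (bond' x - bond' s) \<le> r * m * norm (x - s)"
  proof (rule field_differentiable_bound[where S = "{..t0}" and f' = "\<lambda>s. r * bond' s"])
    fix z :: real assume z: "z \<in> {..t0}"
    show "(bond' has_real_derivative r * bond' z) (at z within {..t0})"
      unfolding bond'_def by (auto intro!: derivative_eq_intros)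
    show "norm (r * bond' z) \<le> r * m"
      using bond'_bounds[of z] z pos by (simp add: abs_mult)
  qed (use assms in auto)
  then show ?thesis by simp
qed

lemma bond_increment_approx:
  assumes h: "0 < h" and w: "w + h \<le> t0" and s: "s \<le> t0"
  shows "\<bar>bond (w + h) - bond w - bond' s * h\<bar> \<le> r * m * (\<bar>w - s\<bar> + h) * h"
proof -
  have "\<exists>z>w. z < w + h \<and> bond (w + h) - bond w = (w + h - w) * bond' z"
    using h by (intro MVT2 bond_deriv) auto
  then obtain z where z: "w < z" "z < w + h" "bond (w + h) - bond w = h * bond' z" by auto
  have "\<bar>bond' z - bond' s\<bar> \<le> r * m * \<bar>z - s\<bar>" using z w s by (intro bond'_lip) auto
  also have "\<dots> \<le> r * m * (\<bar>w - s\<bar> + h)" using z pos m_pos by (intro mult_left_mono) auto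
  finally have "\<bar>bond' z - bond' s\<bar> * h \<le> r * m * (\<bar>w - s\<bar> + h) * h" using h by (intro mult_right_mono) auto
  moreover have "bond (w + h) - bond w - bond' s * h = (bond' z - bond' s) * h" using z by (simp add: algebra_simps)
  ultimately show ?thesis using h by (simp add: abs_mult)
qed

definition "M = max q r * K"

lemma M_pos: "M > 0" using pos by (simp add: M_def less_max_iff_disj)

text \<open>The bound for \<open>a v\<^sub>y\<^sub>y / x\<^sup>2\<close> collects the terms of the equation:
  the first four summands are for small prices, the third and the last one for the others, where
  \<open>exp (- 2 yz)\<close> compensates \<open>x\<^sup>2\<close>.\<close>

definition "Cn = 3 * r * m + m * E + \<bar>b\<bar> * C1 + r * m * T * E + (M + m + r * K) * exp (- 2 * yz)"
definition "C4 = Cn / a + C1"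

lemma Cn_pos: "Cn > 0"
proof -
  have "0 < 3 * r * m" "0 < m * E" "0 \<le> \<bar>b\<bar> * C1" "0 < r * m * T * E" "0 < (M + m + r * K) * exp (- 2 * yz)"
    using pos m_pos E_pos C1_pos M_pos by (simp_all add: add_pos_pos)
  then show ?thesis unfolding Cn_def by linarith
qed

lemma C4_pos: "C4 > 0" using Cn_pos a_pos C1_pos by (simp add: C4_def add_pos_pos)

context
  fixes y s \<delta> :: real
  assumes \<delta>: "0 < \<delta>" "\<delta> \<le> 1" and sub: "sq (y, s) \<delta> \<subseteq> open_strip Y t0"
begin

lemma continuous_open_strip: "continuous_on (open_strip Y t0) v"
  by (rule continuous_on_subset[OF v_cont_strip open_strip_strip]) auto

lemma in_square:
  assumes "w \<in> sq (y, s) \<delta>"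
  shows "fst w < Y" "0 < snd w" "snd w < t0" "fst w \<le> y + \<delta>" "\<bar>snd w - s\<bar> \<le> \<delta>"
  using sub assms by (auto simp: sq_iff open_strip_iff)

lemma s_range: "0 < s" "s < t0"
proof -
  have "(y, s) \<in> sq (y, s) \<delta>" using \<delta> by (simp add: sq_iff)
  from in_square[OF this] show "0 < s" "s < t0" by auto
qed

lemma room:
  "\<exists>e>0. \<forall>h. 0 \<le> h \<and> h < e \<longrightarrow> sq ((y, s) + (h, 0)) \<delta> \<subseteq> open_strip Y t0 \<and> sq ((y, s) + (0, h)) \<delta> \<subseteq> open_strip Y t0"
proof -
  obtain e where e: "e > 0" "sq (y, s) (\<delta> + e) \<subseteq> open_strip Y t0" using sq_enlarge[OF open_open_strip sub] by blast
  have "sq ((y, s) + (h, 0)) \<delta> \<subseteq> sq (y, s) (\<delta> + e)" "sq ((y, s) + (0, h)) \<delta> \<subseteq> sq (y, s) (\<delta> + e)"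
    if "0 \<le> h" "h < e" for h using that by (auto simp: sq_iff)
  then show ?thesis using e by (intro exI[of _ e]) blast
qed

abbreviation "W \<equiv> conv (moll \<delta>) (moll \<delta>) v"
abbreviation "Wy \<equiv> conv (deriv (moll \<delta>)) (moll \<delta>) v"
abbreviation "Wyy \<equiv> conv (deriv (deriv (moll \<delta>))) (moll \<delta>) v"
abbreviation "Ws \<equiv> conv (moll \<delta>) (deriv (moll \<delta>)) v"
abbreviation "e2 \<equiv> exp (2 * (y + \<delta>))"

lemma W_deriv_y: "((\<lambda>y. W (y, s)) has_real_derivative Wy (y, s)) (at y)"
  using conv_local_deriv_fst[OF moll_bump[OF \<delta>(1)] moll_bump[OF \<delta>(1)] open_open_strip continuous_open_strip sub] by simp

lemma W_deriv_yy: "((\<lambda>y. Wy (y, s)) has_real_derivative Wyy (y, s)) (at y)"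
  using conv_local_deriv_fst[OF bump_on_deriv[OF moll_bump[OF \<delta>(1)]] moll_bump[OF \<delta>(1)] open_open_strip continuous_open_strip sub] by simp

lemma W_deriv_s: "((\<lambda>s. W (y, s)) has_real_derivative Ws (y, s)) (at s)"
  using conv_local_deriv_snd[OF moll_bump[OF \<delta>(1)] moll_bump[OF \<delta>(1)] open_open_strip continuous_open_strip sub] by simp

lemma exp_in_square: "w \<in> sq (y, s) \<delta> \<Longrightarrow> exp (2 * fst w) \<le> e2"
  using in_square(4)[of w] by simp

lemma Wy_bounds: "0 \<le> Wy (y, s)" "Wy (y, s) \<le> C1 * e2"
proof -
  obtain e where e: "e > 0" "\<And>h. 0 \<le> h \<Longrightarrow> h < e \<Longrightarrow> sq ((y, s) + (h, 0)) \<delta> \<subseteq> open_strip Y t0"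
      "\<And>h. 0 \<le> h \<Longrightarrow> h < e \<Longrightarrow> sq ((y, s) + (0, h)) \<delta> \<subseteq> open_strip Y t0"
    using room by blast
  have bd: "0 * h \<le> W (y + h, s) - W (y, s) \<and> W (y + h, s) - W (y, s) \<le> C1 * e2 * h" if h: "0 < h" "h < min e 1" for h
  proof -
    have sub': "sq ((y, s) + (h, 0)) \<delta> \<subseteq> open_strip Y t0" using e(2)[of h] h by simp
    have b: "0 \<le> v (w + (h, 0)) - v w \<and> v (w + (h, 0)) - v w \<le> C1 * e2 * h" if w: "w \<in> sq (y, s) \<delta>" for w
    proof -
      have "w + (h, 0) \<in> sq ((y, s) + (h, 0)) \<delta>" using w by (simp only: sq_shift)
      then have wY: "fst w + h < Y" using sub' by (auto simp: open_strip_iff)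
      have st: "0 < snd w" "snd w \<le> t0" using in_square[OF w] by auto
      have "v (fst w + h, snd w) - v (fst w, snd w) \<le> C1 * h * exp (2 * fst w)"
        using v_space_increment[of h "fst w" "snd w"] h wY st by simp
      also have "\<dots> \<le> C1 * h * e2" using exp_in_square[OF w] C1_pos h by (intro mult_left_mono) auto
      finally have "v (fst w + h, snd w) - v (fst w, snd w) \<le> C1 * h * e2" .
      moreover have "v (fst w, snd w) \<le> v (fst w + h, snd w)"
        using v_mono_space[of h "fst w" "snd w"] h wY st by simp
      moreover have "w + (h, 0) = (fst w + h, snd w)" by (simp add: prod_eq_iff)
      ultimately show ?thesis by (simp add: mult_ac)
    qed
    from conv_increment[OF \<delta>(1) continuous_open_strip sub sub' b] show ?thesis by simp
  qed
  show "0 \<le> Wy (y, s)" "Wy (y, s) \<le> C1 * e2"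
    using deriv_between[OF W_deriv_y _ bd, of "min e 1"] e(1) by auto
qed

lemma Ws_bounds: "0 \<le> Ws (y, s)" "Ws (y, s) \<le> m"
  and Ws_near_zero: "y + \<delta> \<le> yz \<Longrightarrow> \<bar>Ws (y, s) - bond' s\<bar> \<le> 2 * r * m * \<delta> + m * E * e2"
proof -
  obtain e where e: "e > 0" "\<And>h. 0 \<le> h \<Longrightarrow> h < e \<Longrightarrow> sq ((y, s) + (h, 0)) \<delta> \<subseteq> open_strip Y t0"
      "\<And>h. 0 \<le> h \<Longrightarrow> h < e \<Longrightarrow> sq ((y, s) + (0, h)) \<delta> \<subseteq> open_strip Y t0"
    using room by blast
  have top: "snd w + h \<le> t0" and pair: "w + (0, h) = (fst w, snd w + h)"
    if h: "0 < h" "h < e" and w: "w \<in> sq (y, s) \<delta>" for h w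
  proof -
    have "w + (0, h) \<in> sq ((y, s) + (0, h)) \<delta>" using w by (simp only: sq_shift)
    then show "snd w + h \<le> t0" using e(3)[of h] h by (auto simp: open_strip_iff)
    show "w + (0, h) = (fst w, snd w + h)" by (simp add: prod_eq_iff)
  qed
  have bd: "0 * h \<le> W (y, s + h) - W (y, s) \<and> W (y, s + h) - W (y, s) \<le> m * h" if h: "0 < h" "h < e" for h
  proof -
    have sub': "sq ((y, s) + (0, h)) \<delta> \<subseteq> open_strip Y t0" using e(3)[of h] h by simp
    have b: "0 \<le> v (w + (0, h)) - v w \<and> v (w + (0, h)) - v w \<le> m * h" if w: "w \<in> sq (y, s) \<delta>" for w
      unfolding pair[OF h w]
      using v_mono_time[of h "fst w" "snd w"] v_lip_time[of h "fst w" "snd w"] h top[OF h w] in_square[OF w]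
      by simp
    from conv_increment[OF \<delta>(1) continuous_open_strip sub sub' b] show ?thesis by simp
  qed
  show "0 \<le> Ws (y, s)" "Ws (y, s) \<le> m" using deriv_between[OF W_deriv_s e(1) bd] by auto
  assume near: "y + \<delta> \<le> yz"
  define X where "X = 2 * r * m * \<delta> + m * E * e2"
  have bd: "(bond' s - X) * h \<le> W (y, s + h) - W (y, s) \<and> W (y, s + h) - W (y, s) \<le> (bond' s + X) * h"
    if h: "0 < h" "h < min e \<delta>" for h
  proof -
    have he: "h < e" using h by simp
    have sub': "sq ((y, s) + (0, h)) \<delta> \<subseteq> open_strip Y t0" using e(3)[of h] h by simp
    have b: "(bond' s - X) * h \<le> v (w + (0, h)) - v w \<and> v (w + (0, h)) - v w \<le> (bond' s + X) * h"
      if w: "w \<in> sq (y, s) \<delta>" for w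
    proof -
      note iw = in_square[OF w]
      have "\<bar>bond (snd w + h) - bond (snd w) - bond' s * h\<bar> \<le> r * m * (\<bar>snd w - s\<bar> + h) * h"
        using h top[OF h(1) he w] s_range by (intro bond_increment_approx) auto
      also have "\<dots> \<le> r * m * (2 * \<delta>) * h"
        using iw(5) h pos m_pos by (intro mult_right_mono mult_left_mono) auto
      also have "\<dots> = 2 * r * m * \<delta> * h" by simp
      finally have 1: "\<bar>bond (snd w + h) - bond (snd w) - bond' s * h\<bar> \<le> 2 * r * m * \<delta> * h" .
      have "B (fst w) (snd w) \<le> E * exp (2 * fst w)" using B_le[of "snd w" "fst w"] iw by simp
      also have "\<dots> \<le> E * e2" using exp_in_square[OF w] E_pos by (intro mult_left_mono) auto
      finally have "m * h * B (fst w) (snd w) \<le> m * h * (E * e2)" using m_pos h by (intro mult_left_mono) auto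
      moreover have "v (fst w, snd w + h) \<le> v (fst w, snd w) + (bond (snd w + h) - bond (snd w)) + m * h * B (fst w) (snd w)"
        "v (fst w, snd w) + (bond (snd w + h) - bond (snd w)) \<le> v (fst w, snd w + h) + m * h * B (fst w) (snd w)"
        using v_time_near_zero[of h "fst w" "snd w"] h iw near top[OF h(1) he w] by auto
      ultimately have 2: "\<bar>v (fst w, snd w + h) - v (fst w, snd w) - (bond (snd w + h) - bond (snd w))\<bar> \<le> m * h * (E * e2)"
        by linarith
      have "X * h = 2 * r * m * \<delta> * h + m * h * (E * e2)" by (simp add: X_def algebra_simps)
      moreover have "(bond' s - X) * h = bond' s * h - X * h" "(bond' s + X) * h = bond' s * h + X * h"
        by (simp_all add: algebra_simps)
      ultimately show ?thesis
        unfolding pair[OF h(1) he w] using 1 2 by (simp only: prod.collapse) linarith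
    qed
    from conv_increment[OF \<delta>(1) continuous_open_strip sub sub' b] show ?thesis by simp
  qed
  have "bond' s - X \<le> Ws (y, s)" "Ws (y, s) \<le> bond' s + X"
    using deriv_between[OF W_deriv_s _ bd, of "min e \<delta>"] e(1) \<delta>(1) by auto
  then show "\<bar>Ws (y, s) - bond' s\<bar> \<le> 2 * r * m * \<delta> + m * E * e2" unfolding X_def by linarith
qed

lemma W_between:
  assumes "\<And>w. w \<in> sq (y, s) \<delta> \<Longrightarrow> lo \<le> v w \<and> v w \<le> hi"
  shows "lo \<le> W (y, s)" "W (y, s) \<le> hi"
proof -
  have cont: "continuous_on (sq (y, s) \<delta>) v" by (rule continuous_on_subset[OF continuous_open_strip sub])
  have "conv (moll \<delta>) (moll \<delta>) (\<lambda>w. lo) (y, s) \<le> W (y, s)"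
    by (rule conv_moll_mono[OF \<delta>(1) continuous_on_const cont]) (use assms in blast)
  moreover have "W (y, s) \<le> conv (moll \<delta>) (moll \<delta>) (\<lambda>w. hi) (y, s)"
    by (rule conv_moll_mono[OF \<delta>(1) cont continuous_on_const]) (use assms in blast)
  ultimately show "lo \<le> W (y, s)" "W (y, s) \<le> hi" unfolding conv_moll_const[OF \<delta>(1)] by auto
qed

lemma W_near_zero:
  assumes near: "y + \<delta> \<le> yz"
  shows "\<bar>W (y, s) - bond s\<bar> \<le> m * \<delta> + m * T * E * e2"
proof -
  have "bond s - m * \<delta> \<le> v w \<and> v w \<le> bond s + (m * \<delta> + m * T * E * e2)" if w: "w \<in> sq (y, s) \<delta>" for w
  proof -
    note iw = in_square[OF w]
    have "\<bar>bond (snd w) - bond s\<bar> \<le> m * \<bar>snd w - s\<bar>" using iw s_range by (intro bond_lip) auto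
    also have "\<dots> \<le> m * \<delta>" using iw m_pos by (intro mult_left_mono) auto
    finally have 1: "\<bar>bond (snd w) - bond s\<bar> \<le> m * \<delta>" .
    have "B (fst w) (snd w) \<le> E * exp (2 * fst w)" using B_le[of "snd w" "fst w"] iw by simp
    also have "\<dots> \<le> E * e2" using exp_in_square[OF w] E_pos by (intro mult_left_mono) auto
    finally have BE: "B (fst w) (snd w) \<le> E * e2" .
    have "m * (t0 - snd w) * B (fst w) (snd w) \<le> m * T * (E * e2)"
      using BE B_pos[of "fst w" "snd w"] m_pos iw t0 by (intro mult_mono mult_left_mono) auto
    moreover have "v w \<le> bond (snd w) + m * (t0 - snd w) * B (fst w) (snd w)"
      using v_le_bond[of "fst w" "snd w"] iw near by simp
    moreover have "bond (snd w) \<le> v w" using v_ge_bond[of "fst w" "snd w"] iw by simp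
    ultimately show ?thesis using 1 unfolding mult.assoc by (intro conjI; linarith)
  qed
  from W_between[OF this] show ?thesis
    using m_pos pos E_pos \<delta> by (simp add: abs_le_iff) (smt (verit) exp_gt_zero mult_nonneg_nonneg)
qed

text \<open>Solve the equation for the second derivative. If the square lies to the left of
  \<open>yz\<close>, the equation is exact, and subtracting the equation for the bond without
  conversion leaves differences that are \<open>O(x\<^sup>2)\<close> up to the mollification
  error. Otherwise \<open>x\<^sup>2\<close> is bounded below and crude bounds suffice.\<close>

lemma aWyy_bound: "\<bar>a * Wyy (y, s)\<bar> \<le> Cn * (e2 + \<delta>)"
proof -
  have sub_int: "sq (y, s) \<delta> \<subseteq> bond_int" using sub open_strip_subset[OF order_refl order_refl] by blast
  define P where "P = conv_op a b r \<delta> v (y, s)"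
  have eq: "a * Wyy (y, s) = - Ws (y, s) - b * Wy (y, s) + r * W (y, s) - P"
    by (simp add: P_def conv_op_def)
  have bWy: "\<bar>b * Wy (y, s)\<bar> \<le> \<bar>b\<bar> * C1 * e2"
  proof -
    have "\<bar>b\<bar> * \<bar>Wy (y, s)\<bar> \<le> \<bar>b\<bar> * (C1 * e2)" using Wy_bounds by (intro mult_left_mono) auto
    then show ?thesis by (simp add: abs_mult mult.assoc)
  qed
  define N where "N = (M + m + r * K) * exp (- 2 * yz)"
  have N: "N \<ge> 0" using M_pos m_pos pos by (simp add: N_def)
  have pieces: "0 \<le> r * m" "0 \<le> m * E" "0 \<le> \<bar>b\<bar> * C1" "0 \<le> r * m * T * E" "0 < e2"
    using pos m_pos E_pos C1_pos by simp_all
  have CnN: "Cn = 3 * (r * m) + m * E + \<bar>b\<bar> * C1 + r * m * T * E + N" by (simp add: Cn_def N_def)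
  show ?thesis
  proof (cases "y + \<delta> \<le> yz")
    case True
    have "P = c" unfolding P_def
    proof (rule conv_op_v(4)[OF \<delta>(1) sub_int])
      fix w assume w: "w \<in> sq (y, s) \<delta>"
      note iw = in_square[OF w]
      show "\<gamma> * exp (fst w) < v w \<and> v w < K"
        using no_conversion_near_zero[of "fst w" "snd w"] below[of "fst w" "snd w"] iw True by simp
    qed
    then have "a * Wyy (y, s) = - (Ws (y, s) - bond' s) - b * Wy (y, s) + r * (W (y, s) - bond s)"
      using eq bond_eq[of s] by (simp add: algebra_simps)
    moreover have "\<bar>r * (W (y, s) - bond s)\<bar> \<le> r * (m * \<delta> + m * T * E * e2)"
      using W_near_zero[OF True] pos by (simp add: abs_mult)
    ultimately have "\<bar>a * Wyy (y, s)\<bar> \<le> (2 * r * m * \<delta> + m * E * e2) + \<bar>b\<bar> * C1 * e2 + r * (m * \<delta> + m * T * E * e2)"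
      using Ws_near_zero[OF True] bWy by linarith
    also have "\<dots> = 3 * (r * m) * \<delta> + (m * E + \<bar>b\<bar> * C1 + r * m * T * E) * e2"
      by (simp add: algebra_simps)
    also have "\<dots> \<le> Cn * \<delta> + Cn * e2"
      using pieces N \<delta>(1) by (intro add_mono mult_right_mono) (auto simp: CnN)
    finally show ?thesis by (simp add: algebra_simps)
  next
    case False
    have "c \<le> P" "P \<le> M" unfolding P_def M_def by (rule conv_op_v(1,2)[OF \<delta>(1) sub_int])+
    then have P: "\<bar>P\<bar> \<le> M" using pos by simp
    have W: "0 \<le> W (y, s)" "W (y, s) \<le> K"
      using W_between[of 0 K] v_strip_bounds in_square by (metis less_imp_le prod.collapse)+
    then have "\<bar>r * W (y, s)\<bar> \<le> r * K" using pos by (simp add: abs_mult)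
    then have "\<bar>a * Wyy (y, s)\<bar> \<le> (M + m + r * K) + \<bar>b\<bar> * C1 * e2"
      using eq P Ws_bounds bWy by linarith
    also have "(M + m + r * K) * 1 \<le> (M + m + r * K) * (exp (- 2 * yz) * e2)"
    proof (rule mult_left_mono)
      have "exp (- 2 * yz) * e2 = exp (2 * (y + \<delta> - yz))" by (simp add: exp_add[symmetric] algebra_simps)
      moreover have "1 \<le> exp (2 * (y + \<delta> - yz))" using False by simp
      ultimately show "1 \<le> exp (- 2 * yz) * e2" by simp
    qed (use M_pos m_pos pos in simp)
    then have "(M + m + r * K) + \<bar>b\<bar> * C1 * e2 \<le> N * e2 + \<bar>b\<bar> * C1 * e2" by (simp add: N_def mult.assoc)
    also have "\<dots> = (N + \<bar>b\<bar> * C1) * e2" by (simp add: algebra_simps)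
    also have "\<dots> \<le> Cn * (e2 + \<delta>)"
      using pieces N \<delta>(1) by (intro mult_mono) (auto simp: CnN)
    finally show ?thesis by simp
  qed
qed

lemma Wyy_minus_Wy: "\<bar>Wyy (y, s) - Wy (y, s)\<bar> \<le> C4 * (e2 + \<delta>)"
proof -
  have "a * \<bar>Wyy (y, s)\<bar> \<le> Cn * (e2 + \<delta>)" using aWyy_bound a_pos by (simp add: abs_mult)
  then have "\<bar>Wyy (y, s)\<bar> \<le> Cn * (e2 + \<delta>) / a" using a_pos by (simp add: field_simps)
  moreover have "\<bar>Wy (y, s)\<bar> \<le> C1 * (e2 + \<delta>)"
  proof -
    have "C1 * e2 \<le> C1 * (e2 + \<delta>)" using C1_pos \<delta>(1) by (intro mult_left_mono) auto
    then show ?thesis using Wy_bounds by linarith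
  qed
  moreover have "C4 * (e2 + \<delta>) = Cn * (e2 + \<delta>) / a + C1 * (e2 + \<delta>)" by (simp add: C4_def distrib_right)
  ultimately show ?thesis by linarith
qed

end

end

section \<open>Difference quotients\<close>

text \<open>For a differentiable function this says, up to the factor, that the derivative is Lipschitz. It
  does not mention derivatives and hence passes to pointwise limits.\<close>

definition quot_lip :: "real \<Rightarrow> real set \<Rightarrow> (real \<Rightarrow> real) \<Rightarrow> bool" where
  "quot_lip C S f \<longleftrightarrow> (\<forall>x\<in>S. \<forall>y\<in>S. \<forall>h k. h \<noteq> 0 \<longrightarrow> k \<noteq> 0 \<longrightarrow> x + h \<in> S \<longrightarrow> y + k \<in> S \<longrightarrow>
     \<bar>(f (x + h) - f x) / h - (f (y + k) - f y) / k\<bar> \<le> C * (\<bar>h\<bar> + \<bar>k\<bar> + \<bar>x - y\<bar>))"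

lemma quot_lipD:
  assumes "quot_lip C S f" "x \<in> S" "y \<in> S" "h \<noteq> 0" "k \<noteq> 0" "x + h \<in> S" "y + k \<in> S"
  shows "\<bar>(f (x + h) - f x) / h - (f (y + k) - f y) / k\<bar> \<le> C * (\<bar>h\<bar> + \<bar>k\<bar> + \<bar>x - y\<bar>)"
  using assms unfolding quot_lip_def by blast

lemma quotient_mean_value:
  fixes f :: "real \<Rightarrow> real"
  assumes D: "\<And>x. x \<in> {A..B} \<Longrightarrow> (f has_real_derivative f' x) (at x)"
    and x: "x \<in> {A..B}" "x + h \<in> {A..B}" "h \<noteq> 0"
  shows "\<exists>\<xi>\<in>{A..B}. (f (x + h) - f x) / h = f' \<xi> \<and> \<bar>\<xi> - x\<bar> \<le> \<bar>h\<bar>"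
proof (cases "h > 0")
  case True
  have "\<exists>z>x. z < x + h \<and> f (x + h) - f x = (x + h - x) * f' z"
    by (rule MVT2) (use True x in \<open>auto intro!: D\<close>)
  then obtain z where "x < z" "z < x + h" "f (x + h) - f x = h * f' z" by auto
  then show ?thesis using x True by (intro bexI[of _ z]) auto
next
  case False
  have "\<exists>z>x + h. z < x \<and> f x - f (x + h) = (x - (x + h)) * f' z"
    by (rule MVT2) (use False x in \<open>auto intro!: D\<close>)
  then obtain z where z: "x + h < z" "z < x" "f x - f (x + h) = - h * f' z" by auto
  then have "(f (x + h) - f x) / h = f' z" using x by (simp add: field_simps)
  then show ?thesis using x z False by (intro bexI[of _ z]) auto
qed

lemma quot_lip_of_second_derivative:
  fixes f :: "real \<Rightarrow> real"
  assumes D: "\<And>x. x \<in> {A..B} \<Longrightarrow> (f has_real_derivative f' x) (at x)"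
    and D': "\<And>x. x \<in> {A..B} \<Longrightarrow> (f' has_real_derivative f'' x) (at x)"
    and bd: "\<And>x. x \<in> {A..B} \<Longrightarrow> \<bar>f'' x\<bar> \<le> C"
  shows "quot_lip C {A..B} f"
  unfolding quot_lip_def
proof (intro ballI allI impI)
  fix x y h k assume x: "x \<in> {A..B}" and y: "y \<in> {A..B}" and hk: "h \<noteq> 0" "k \<noteq> 0" "x + h \<in> {A..B}" "y + k \<in> {A..B}"
  obtain \<xi> where \<xi>: "\<xi> \<in> {A..B}" "(f (x + h) - f x) / h = f' \<xi>" "\<bar>\<xi> - x\<bar> \<le> \<bar>h\<bar>"
    using quotient_mean_value[of A B f f' x h, OF D x hk(3) hk(1)] by blast
  obtain \<eta> where \<eta>: "\<eta> \<in> {A..B}" "(f (y + k) - f y) / k = f' \<eta>" "\<bar>\<eta> - y\<bar> \<le> \<bar>k\<bar>"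
    using quotient_mean_value[of A B f f' y k, OF D y hk(4) hk(2)] by blast
  have C: "C \<ge> 0" using bd[OF x] by linarith
  have "norm (f' \<xi> - f' \<eta>) \<le> C * norm (\<xi> - \<eta>)"
    by (rule field_differentiable_bound[where S = "{A..B}" and f' = f''])
      (use D' bd \<xi> \<eta> in \<open>auto intro: has_field_derivative_at_within\<close>)
  also have "\<dots> \<le> C * (\<bar>h\<bar> + \<bar>k\<bar> + \<bar>x - y\<bar>)"
    using \<xi> \<eta> C by (intro mult_left_mono) auto
  finally show "\<bar>(f (x + h) - f x) / h - (f (y + k) - f y) / k\<bar> \<le> C * (\<bar>h\<bar> + \<bar>k\<bar> + \<bar>x - y\<bar>)"
    using \<xi> \<eta> by simp
qed

text \<open>The quotients at \<open>x\<close> form a Cauchy family as the step tends to zero. The steps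
  \<open>s x n\<close> are negative, so they stay inside the interval also at its right end.\<close>

lemma quot_lip_derivative:
  assumes q: "quot_lip C {0<..b} f" and C: "C \<ge> 0"
    and L: "\<And>x y. x \<in> {0<..b} \<Longrightarrow> y \<in> {0<..b} \<Longrightarrow> \<bar>f x - f y\<bar> \<le> L * \<bar>x - y\<bar>"
  obtains d where "\<And>x. x \<in> {0<..b} \<Longrightarrow> (f has_real_derivative d x) (at x within {0<..b})"
    "\<And>x y. x \<in> {0<..b} \<Longrightarrow> y \<in> {0<..b} \<Longrightarrow> \<bar>d x - d y\<bar> \<le> C * \<bar>x - y\<bar>"
    "\<And>x. x \<in> {0<..b} \<Longrightarrow> \<bar>d x\<bar> \<le> L"
proof -
  define s where "s x n = - x * (1 / real (Suc (Suc n)))" for x :: real and n :: nat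
  define Q where "Q x n = (f (x + s x n) - f x) / s x n" for x n
  have s0: "s x \<longlonglongrightarrow> 0" for x
    unfolding s_def by (rule tendsto_mult_right_zero[OF LIMSEQ_Suc[OF LIMSEQ_Suc[OF lim_1_over_n]]])
  have sS: "x + s x n \<in> {0<..b}" "s x n \<noteq> 0" if "x \<in> {0<..b}" for x n
  proof -
    have "x + s x n = x * (1 - 1 / real (Suc (Suc n)))" by (simp add: s_def right_diff_distrib)
    moreover have "0 < 1 - 1 / real (Suc (Suc n))" "1 - 1 / real (Suc (Suc n)) \<le> 1" by simp_all
    ultimately show "x + s x n \<in> {0<..b}" using that
      by (auto intro: order_trans[OF mult_left_le] simp del: of_nat_Suc)
    show "s x n \<noteq> 0" using that by (auto simp: s_def)
  qed
  have "\<exists>d. Q x \<longlonglongrightarrow> d" if x: "x \<in> {0<..b}" for x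
  proof -
    have "Cauchy (Q x)"
    proof (rule metric_CauchyI)
      fix e :: real assume e: "e > 0"
      have "(\<lambda>n. C * \<bar>s x n\<bar>) \<longlonglongrightarrow> C * \<bar>0\<bar>" by (intro tendsto_intros s0)
      then have "\<forall>\<^sub>F n in sequentially. C * \<bar>s x n\<bar> < e / 2" using e by (intro order_tendstoD(2)) auto
      then obtain N where N: "\<And>n. n \<ge> N \<Longrightarrow> C * \<bar>s x n\<bar> < e / 2" by (auto simp: eventually_sequentially)
      have "dist (Q x k) (Q x n) < e" if kn: "k \<ge> N" "n \<ge> N" for k n
      proof -
        have "\<bar>Q x k - Q x n\<bar> \<le> C * (\<bar>s x k\<bar> + \<bar>s x n\<bar> + \<bar>x - x\<bar>)"
          unfolding Q_def by (rule quot_lipD[OF q x x]) (use sS[OF x] in auto)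
        then show ?thesis using N[OF kn(1)] N[OF kn(2)] by (simp add: dist_real_def distrib_left)
      qed
      then show "\<exists>N. \<forall>k\<ge>N. \<forall>n\<ge>N. dist (Q x k) (Q x n) < e" by blast
    qed
    then show ?thesis using Cauchy_convergent convergent_def by blast
  qed
  then obtain d where d: "\<And>x. x \<in> {0<..b} \<Longrightarrow> Q x \<longlonglongrightarrow> d x" by metis
  have near: "\<bar>(f (x + h) - f x) / h - d x\<bar> \<le> C * \<bar>h\<bar>" if x: "x \<in> {0<..b}" and h: "h \<noteq> 0" "x + h \<in> {0<..b}" for x h
  proof (rule tendsto_le[OF trivial_limit_sequentially])
    show "(\<lambda>n. C * (\<bar>h\<bar> + \<bar>s x n\<bar> + \<bar>x - x\<bar>)) \<longlonglongrightarrow> C * \<bar>h\<bar>"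
      by (auto intro!: tendsto_eq_intros s0)
    show "(\<lambda>n. \<bar>(f (x + h) - f x) / h - Q x n\<bar>) \<longlonglongrightarrow> \<bar>(f (x + h) - f x) / h - d x\<bar>"
      by (intro tendsto_intros d x)
    show "\<forall>\<^sub>F n in sequentially. \<bar>(f (x + h) - f x) / h - Q x n\<bar> \<le> C * (\<bar>h\<bar> + \<bar>s x n\<bar> + \<bar>x - x\<bar>)"
      unfolding Q_def by (intro always_eventually allI quot_lipD[OF q x x]) (use sS[OF x] h in auto)
  qed
  show ?thesis
  proof (rule that[of d])
    show "(f has_real_derivative d x) (at x within {0<..b})" if x: "x \<in> {0<..b}" for x
      unfolding has_field_derivative_iff
    proof (rule LIM_zero_cancel, rule Lim_null_comparison)
      show "((\<lambda>y. C * \<bar>y - x\<bar>) \<longlongrightarrow> 0) (at x within {0<..b})" by (auto intro!: tendsto_eq_intros)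
      have "norm ((f y - f x) / (y - x) - d x) \<le> C * \<bar>y - x\<bar>" if "y \<in> {0<..b}" "y \<noteq> x" for y
        using near[OF x, of "y - x"] that by simp
      then show "\<forall>\<^sub>F y in at x within {0<..b}. norm ((f y - f x) / (y - x) - d x) \<le> C * \<bar>y - x\<bar>"
        by (auto simp: eventually_at_filter)
    qed
    show "\<bar>d x - d y\<bar> \<le> C * \<bar>x - y\<bar>" if x: "x \<in> {0<..b}" and y: "y \<in> {0<..b}" for x y
    proof (rule tendsto_le[OF trivial_limit_sequentially])
      show "(\<lambda>n. C * (\<bar>s x n\<bar> + \<bar>s y n\<bar> + \<bar>x - y\<bar>)) \<longlonglongrightarrow> C * \<bar>x - y\<bar>"
        by (auto intro!: tendsto_eq_intros s0)
      show "(\<lambda>n. \<bar>Q x n - Q y n\<bar>) \<longlonglongrightarrow> \<bar>d x - d y\<bar>" by (intro tendsto_intros d x y)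
      show "\<forall>\<^sub>F n in sequentially. \<bar>Q x n - Q y n\<bar> \<le> C * (\<bar>s x n\<bar> + \<bar>s y n\<bar> + \<bar>x - y\<bar>)"
        unfolding Q_def by (intro always_eventually allI quot_lipD[OF q x y]) (use sS[OF x] sS[OF y] in auto)
    qed
    show "\<bar>d x\<bar> \<le> L" if x: "x \<in> {0<..b}" for x
    proof (rule tendsto_upperbound[OF tendsto_rabs[OF d[OF x]]])
      have "\<bar>Q x n\<bar> \<le> L" for n
      proof -
        have "\<bar>f (x + s x n) - f x\<bar> \<le> L * \<bar>s x n\<bar>" using L[OF sS(1)[OF x] x, of n] by simp
        then show ?thesis using sS(2)[OF x, of n] by (simp add: Q_def abs_divide divide_le_eq)
      qed
      then show "\<forall>\<^sub>F n in sequentially. \<bar>Q x n\<bar> \<le> L" by simp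
    qed simp
  qed
qed

lemma quot_lip_limit:
  assumes f: "\<And>x. x \<in> S \<Longrightarrow> ((\<lambda>n. f n x) \<longlongrightarrow> g x) F" and F: "F \<noteq> bot"
    and q: "\<forall>\<^sub>F n in F. quot_lip (c n) S (f n)" and c: "(c \<longlongrightarrow> C) F"
  shows "quot_lip C S g"
  unfolding quot_lip_def
proof (intro ballI allI impI)
  fix x y h k assume a: "x \<in> S" "y \<in> S" "h \<noteq> 0" "k \<noteq> 0" "x + h \<in> S" "y + k \<in> S"
  show "\<bar>(g (x + h) - g x) / h - (g (y + k) - g y) / k\<bar> \<le> C * (\<bar>h\<bar> + \<bar>k\<bar> + \<bar>x - y\<bar>)"
  proof (rule tendsto_le[OF F])
    show "((\<lambda>n. c n * (\<bar>h\<bar> + \<bar>k\<bar> + \<bar>x - y\<bar>)) \<longlongrightarrow> C * (\<bar>h\<bar> + \<bar>k\<bar> + \<bar>x - y\<bar>)) F"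
      by (intro tendsto_intros c)
    show "((\<lambda>n. \<bar>(f n (x + h) - f n x) / h - (f n (y + k) - f n y) / k\<bar>) \<longlongrightarrow>
        \<bar>(g (x + h) - g x) / h - (g (y + k) - g y) / k\<bar>) F"
      by (intro tendsto_intros f a)
    show "\<forall>\<^sub>F n in F. \<bar>(f n (x + h) - f n x) / h - (f n (y + k) - f n y) / k\<bar> \<le> c n * (\<bar>h\<bar> + \<bar>k\<bar> + \<bar>x - y\<bar>)"
      using q by eventually_elim (rule quot_lipD[OF _ a(1-4) a(5,6)])
  qed
qed

text \<open>The functions \<open>f (t x) / t\<close> with \<open>t < 1\<close> satisfy the estimate on the
  closed interval and converge to \<open>f\<close>.\<close>

lemma quot_lip_right_end:
  assumes q: "quot_lip C {0<..<b} f" and f: "continuous_on {0<..b} f" and C: "C \<ge> 0"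
  shows "quot_lip C {0<..b} f"
proof (rule quot_lip_limit[where F = "at_left 1" and f = "\<lambda>t x. f (t * x) / t" and c = "\<lambda>_. C"])
  show "((\<lambda>t. f (t * x) / t) \<longlongrightarrow> f x) (at_left 1)" if x: "x \<in> {0<..b}" for x
  proof -
    have "((\<lambda>t. f (t * x)) \<longlongrightarrow> f (1 * x)) (at_left 1)"
    proof (rule continuous_on_tendsto_compose[OF f])
      show "((\<lambda>t. t * x) \<longlongrightarrow> 1 * x) (at_left 1)" by (intro tendsto_intros)
      have "t * x \<in> {0<..b}" if "0 < t" "t < 1" for t
      proof -
        have "t * x \<le> 1 * x" using that x by (intro mult_right_mono) auto
        moreover have "0 < t * x" using that x by simp
        ultimately show ?thesis using x unfolding greaterThanAtMost_iff by (intro conjI; linarith)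
      qed
      then show "\<forall>\<^sub>F t in at_left 1. t * x \<in> {0<..b}"
        unfolding eventually_at_left[OF zero_less_one] by (intro exI[of _ 0]) auto
    qed (use x in simp)
    then have "((\<lambda>t. f (t * x) / t) \<longlongrightarrow> f (1 * x) / 1) (at_left 1)"
      by (intro tendsto_intros) auto
    then show ?thesis by simp
  qed
  have "quot_lip C {0<..b} (\<lambda>x. f (t * x) / t)" if t: "0 < t" "t < 1" for t
    unfolding quot_lip_def
  proof (intro ballI allI impI)
    fix x y h k assume a: "x \<in> {0<..b}" "y \<in> {0<..b}" "h \<noteq> 0" "k \<noteq> 0" "x + h \<in> {0<..b}" "y + k \<in> {0<..b}"
    have in': "t * w \<in> {0<..<b}" if "w \<in> {0<..b}" for w
    proof -
      have "t * w < 1 * w" using that t by (intro mult_strict_right_mono) auto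
      moreover have "0 < t * w" using that t by simp
      ultimately show ?thesis using that unfolding greaterThanAtMost_iff greaterThanLessThan_iff by (intro conjI; linarith)
    qed
    have "\<bar>(f (t * x + t * h) - f (t * x)) / (t * h) - (f (t * y + t * k) - f (t * y)) / (t * k)\<bar> \<le>
        C * (\<bar>t * h\<bar> + \<bar>t * k\<bar> + \<bar>t * x - t * y\<bar>)"
      by (rule quot_lipD[OF q]) (use a t in' in \<open>auto simp flip: distrib_left\<close>)
    also have "\<dots> = C * (t * (\<bar>h\<bar> + \<bar>k\<bar> + \<bar>x - y\<bar>))"
      using t by (simp add: abs_mult right_diff_distrib[symmetric] distrib_left)
    also have "\<dots> \<le> C * (1 * (\<bar>h\<bar> + \<bar>k\<bar> + \<bar>x - y\<bar>))"
      using t C by (intro mult_left_mono mult_right_mono) auto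
    finally show "\<bar>(f (t * (x + h)) / t - f (t * x) / t) / h - (f (t * (y + k)) / t - f (t * y) / t) / k\<bar> \<le> C * (\<bar>h\<bar> + \<bar>k\<bar> + \<bar>x - y\<bar>)"
      by (simp add: distrib_left diff_divide_distrib)
  qed
  then show "\<forall>\<^sub>F t in at_left 1. quot_lip C {0<..b} (\<lambda>x. f (t * x) / t)"
    unfolding eventually_at_left[OF zero_less_one] by (intro exI[of _ 0]) auto
qed auto

context bond_strip
begin

lemma v_ln: "x > 0 \<Longrightarrow> v (ln x, s) = V (x, s)"
  by (simp add: v_def)

text \<open>In the price variable the second derivative of the mollified value is \<open>(W\<^sub>y\<^sub>y
  - W\<^sub>y) / x\<^sup>2\<close>. The error term \<open>\<delta> / x\<^sup>2\<close> disappears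
  in the limit on a compact set of prices, so the constant does not depend on that set.\<close>

lemma V_quot_lip_compact:
  assumes A: "0 < A" "A \<le> B'" "B' < K / \<gamma>" and s: "0 < s" "s < t0"
  shows "quot_lip C4 {A..B'} (\<lambda>x. V (x, s))"
proof -
  define F where "F \<delta> x = conv (moll \<delta>) (moll \<delta>) v (ln x, s)" for \<delta> x
  define c' where "c' \<delta> = C4 * (exp (2 * \<delta>) + \<delta> / A\<^sup>2)" for \<delta>
  define d where "d = Min {1, Y - ln B', s, t0 - s}"
  have "ln B' < Y"
    unfolding Y_def using A by (subst ln_less_cancel_iff) auto
  then have d: "d > 0" using s by (simp add: d_def)
  have sub: "sq (ln x, s) \<delta> \<subseteq> open_strip Y t0" if "x \<in> {A..B'}" "\<delta> < d" for x \<delta>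
  proof -
    have "\<delta> < Y - ln B'" "\<delta> < s" "\<delta> < t0 - s" using that(2) by (auto simp: d_def)
    moreover have "ln x \<le> ln B'" using that A by simp
    ultimately show ?thesis by (auto simp: sq_iff open_strip_iff)
  qed
  have "quot_lip (c' \<delta>) {A..B'} (F \<delta>)" if \<delta>: "0 < \<delta>" "\<delta> < d" for \<delta>
  proof -
    have \<delta>1: "\<delta> \<le> 1" using \<delta> by (simp add: d_def)
    define Wy where "Wy = conv (deriv (moll \<delta>)) (moll \<delta>) v"
    define Wyy where "Wyy = conv (deriv (deriv (moll \<delta>))) (moll \<delta>) v"
    show ?thesis
    proof (rule quot_lip_of_second_derivative[where f' = "\<lambda>x. Wy (ln x, s) / x" and f'' = "\<lambda>x. (Wyy (ln x, s) - Wy (ln x, s)) / x\<^sup>2"])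
      fix x assume x: "x \<in> {A..B'}"
      have xp: "x > 0" using x A by simp
      note Dln = DERIV_ln_divide[OF xp]
      show "(F \<delta> has_real_derivative Wy (ln x, s) / x) (at x)"
        unfolding F_def Wy_def
        using DERIV_chain2[OF W_deriv_y[OF \<delta>(1) \<delta>1 sub[OF x \<delta>(2)]] Dln] by simp
      have "((\<lambda>x. Wy (ln x, s)) has_real_derivative Wyy (ln x, s) / x) (at x)"
        unfolding Wyy_def Wy_def
        using DERIV_chain2[OF W_deriv_yy[OF \<delta>(1) \<delta>1 sub[OF x \<delta>(2)]] Dln] by simp
      then show "((\<lambda>x. Wy (ln x, s) / x) has_real_derivative (Wyy (ln x, s) - Wy (ln x, s)) / x\<^sup>2) (at x)"
        using xp by (auto intro!: derivative_eq_intros simp: field_simps power2_eq_square)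
      have "\<bar>Wyy (ln x, s) - Wy (ln x, s)\<bar> \<le> C4 * (exp (2 * (ln x + \<delta>)) + \<delta>)"
        unfolding Wyy_def Wy_def by (rule Wyy_minus_Wy[OF \<delta>(1) \<delta>1 sub[OF x \<delta>(2)]])
      also have "exp (2 * (ln x + \<delta>)) = x\<^sup>2 * exp (2 * \<delta>)"
      proof -
        have "exp (2 * (ln x + \<delta>)) = exp (ln x) * exp (ln x) * exp (2 * \<delta>)"
          unfolding exp_add[symmetric] by simp
        then show ?thesis using xp by (simp add: power2_eq_square)
      qed
      finally have "\<bar>Wyy (ln x, s) - Wy (ln x, s)\<bar> / x\<^sup>2 \<le> C4 * (x\<^sup>2 * exp (2 * \<delta>) + \<delta>) / x\<^sup>2"
        by (rule divide_right_mono) simp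
      also have "\<dots> = C4 * (exp (2 * \<delta>) + \<delta> / x\<^sup>2)" using xp by (simp add: field_simps)
      also have "\<dots> \<le> c' \<delta>"
        unfolding c'_def using C4_pos x A \<delta>
        by (intro mult_left_mono add_left_mono divide_left_mono power_mono) auto
      finally show "\<bar>(Wyy (ln x, s) - Wy (ln x, s)) / x\<^sup>2\<bar> \<le> c' \<delta>" by simp
    qed
  qed
  then have ev: "\<forall>\<^sub>F \<delta> in at_right 0. quot_lip (c' \<delta>) {A..B'} (F \<delta>)"
    unfolding eventually_at_right[OF d] by (intro exI[of _ d]) (use d in auto)
  show ?thesis
  proof (rule quot_lip_limit[OF _ _ ev])
    show "((\<lambda>\<delta>. F \<delta> x) \<longlongrightarrow> V (x, s)) (at_right 0)" if x: "x \<in> {A..B'}" for x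
    proof -
      have "ln x < Y" using x A \<open>ln B' < Y\<close> by (auto intro: le_less_trans[of _ "ln B'"])
      then have "(ln x, s) \<in> open_strip Y t0" using s by (simp add: open_strip_iff)
      from conv_moll_tendsto[OF open_open_strip continuous_on_subset[OF v_cont_strip open_strip_strip] this]
      show ?thesis using x A by (simp add: F_def v_ln)
    qed
    have "(c' \<longlongrightarrow> C4 * (exp (2 * 0) + 0 / A\<^sup>2)) (at_right 0)"
      unfolding c'_def using A by (intro tendsto_intros) auto
    then show "(c' \<longlongrightarrow> C4) (at_right 0)" by simp
  qed simp
qed

lemma V_quot_lip_open:
  assumes s: "0 < s" "s < t0"
  shows "quot_lip C4 {0<..<K / \<gamma>} (\<lambda>x. V (x, s))"
  unfolding quot_lip_def
proof (intro ballI allI impI)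
  fix x y h k assume a: "x \<in> {0<..<K / \<gamma>}" "y \<in> {0<..<K / \<gamma>}" "h \<noteq> 0" "k \<noteq> 0" "x + h \<in> {0<..<K / \<gamma>}" "y + k \<in> {0<..<K / \<gamma>}"
  define A where "A = min (min x y) (min (x + h) (y + k))"
  define B' where "B' = max (max x y) (max (x + h) (y + k))"
  have "quot_lip C4 {A..B'} (\<lambda>x. V (x, s))"
    by (rule V_quot_lip_compact[OF _ _ _ s]) (use a in \<open>auto simp: A_def B'_def min_def max_def\<close>)
  moreover have "x \<in> {A..B'}" "y \<in> {A..B'}" "x + h \<in> {A..B'}" "y + k \<in> {A..B'}"
    by (auto simp: A_def B'_def min_le_iff_disj le_max_iff_disj)
  ultimately show "\<bar>(V (x + h, s) - V (x, s)) / h - (V (y + k, s) - V (y, s)) / k\<bar> \<le> C4 * (\<bar>h\<bar> + \<bar>k\<bar> + \<bar>x - y\<bar>)"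
    using a(3,4) by (intro quot_lipD)
qed

end

section \<open>Estimates up to the boundary\<close>

lemma (in convertible_bond) value_estimates:
  assumes x: "0 < x" "x \<le> K / \<gamma>" and t: "0 < t" "t \<le> T"
  shows "\<bar>V (x, t)\<bar> \<le> K"
    and "\<And>t'. 0 < t' \<Longrightarrow> t' \<le> T \<Longrightarrow> \<bar>V (x, t) - V (x, t')\<bar> \<le> r * K * \<bar>t - t'\<bar>"
    and "\<And>x'. 0 < x' \<Longrightarrow> x' \<le> K / \<gamma> \<Longrightarrow> \<bar>V (x, t) - V (x', t)\<bar> \<le> \<gamma> * \<bar>x - x'\<bar>"
    and "quot_lip (max 0 (bond_strip.C4 K \<gamma> T \<sigma> r q c)) {0<..K / \<gamma>} (\<lambda>x. V (x, t))"
proof -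
  have Vv: "V (x, s) = v (ln x, s)" if "0 < x" for x s using that by (simp add: v_def)
  have lnY: "ln x \<le> Y" if "0 < x" "x \<le> K / \<gamma>" for x using that by (simp add: Y_def)
  have "(ln x, t) \<in> bond_cl" using lnY[OF x] t by (simp add: bond_cl_def)
  from v_bounds[OF this] have "0 \<le> V (x, t)" "V (x, t) \<le> K"
    using x pos by (auto simp: Vv intro: order_trans[rotated])
  then show "\<bar>V (x, t)\<bar> \<le> K" by simp
  obtain t0 where t0: "0 \<le> t0" "t0 \<le> T" and below: "\<And>y s. y < Y \<Longrightarrow> 0 < s \<Longrightarrow> s < t0 \<Longrightarrow> v (y, s) < K"
    and face: "\<And>y s. y \<le> Y \<Longrightarrow> 0 < s \<Longrightarrow> t0 \<le> s \<Longrightarrow> s \<le> T \<Longrightarrow> v (y, s) = K"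
    using face_value_time by blast
  have VK: "V (x, s) = K" if "0 < x" "x \<le> K / \<gamma>" "0 < s" "t0 \<le> s" "s \<le> T" for x s
    using face[OF lnY[OF that(1,2)] that(3-5)] Vv[OF that(1)] by simp
  have const: "quot_lip (max 0 (bond_strip.C4 K \<gamma> T \<sigma> r q c)) {0<..K / \<gamma>} (\<lambda>x. V (x, t))" if "t0 \<le> t"
    unfolding quot_lip_def using VK that t by auto
  show "\<bar>V (x, t) - V (x, t')\<bar> \<le> r * K * \<bar>t - t'\<bar>" if t': "0 < t'" "t' \<le> T" for t'
  proof (cases "t0 = 0")
    case True
    then show ?thesis using VK[OF x] t t' pos by simp
  next
    case False
    interpret S: bond_strip K \<gamma> T \<sigma> r q c V Vx Vxx Vt t0
      by unfold_locales (use False t0 below face in auto)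
    have inc: "0 \<le> V (x, s') - V (x, s) \<and> V (x, s') - V (x, s) \<le> r * K * (s' - s)" if "0 < s" "s \<le> s'" "s' \<le> t0" for s s'
    proof -
      have "S.m * (s' - s) \<le> r * K * (s' - s)" using that pos by (intro mult_right_mono) (auto simp: S.m_def)
      then show ?thesis
        using S.v_mono_time[of "s' - s" "ln x" s] S.v_lip_time[of "s' - s" "ln x" s] that lnY[OF x] Vv[OF x(1)]
        by simp
    qed
    have VM: "V (x, s) = V (x, min s t0)" if "0 < s" "s \<le> T" for s
      using VK[OF x, of s] VK[OF x, of t0] that t0 False by (auto simp: min_def)
    have "\<bar>V (x, p) - V (x, p')\<bar> \<le> r * K * \<bar>p - p'\<bar>" if "0 < p" "p \<le> t0" "0 < p'" "p' \<le> t0" for p p'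
    proof (cases "p \<le> p'")
      case True
      then show ?thesis using inc[of p p'] that by (simp add: abs_if)
    next
      case False
      then show ?thesis using inc[of p' p] that by (simp add: abs_if)
    qed
    then have "\<bar>V (x, min t t0) - V (x, min t' t0)\<bar> \<le> r * K * \<bar>min t t0 - min t' t0\<bar>"
      using t t' False t0 by simp
    also have "\<dots> \<le> r * K * \<bar>t - t'\<bar>" using pos by (intro mult_left_mono) auto
    finally show ?thesis using VM[OF t] VM[OF t'] by simp
  qed
  show "\<bar>V (x, t) - V (x', t)\<bar> \<le> \<gamma> * \<bar>x - x'\<bar>" if x': "0 < x'" "x' \<le> K / \<gamma>" for x'
  proof (cases "t0 \<le> t")
    case True
    then show ?thesis using VK[OF x] VK[OF x'] t pos by simp
  next
    case False
    interpret S: bond_strip K \<gamma> T \<sigma> r q c V Vx Vxx Vt t0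
      by unfold_locales (use False t t0 below face in auto)
    have inc: "0 \<le> V (b, t) - V (a, t) \<and> V (b, t) - V (a, t) \<le> \<gamma> * (b - a)" if "0 < a" "a \<le> b" "b \<le> K / \<gamma>" for a b
      using S.v_mono_space[of "ln b - ln a" "ln a" t] S.v_lip_space[of "ln b - ln a" "ln a" t] that lnY[of b] False t
        Vv[of a] Vv[of b] by simp
    show ?thesis
    proof (cases "x \<le> x'")
      case True
      then show ?thesis using inc[of x x'] x x' by (simp add: abs_if)
    next
      case False
      then show ?thesis using inc[of x' x] x x' by (simp add: abs_if)
    qed
  qed
  show "quot_lip (max 0 (bond_strip.C4 K \<gamma> T \<sigma> r q c)) {0<..K / \<gamma>} (\<lambda>x. V (x, t))"
  proof (cases "t0 \<le> t")
    case False
    interpret S: bond_strip K \<gamma> T \<sigma> r q c V Vx Vxx Vt t0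
      by unfold_locales (use False t t0 below face in auto)
    have "continuous_on {0<..K / \<gamma>} (\<lambda>x. v (ln x, t))"
      by (rule continuous_on_compose2[OF v_continuous])
        (use lnY t in \<open>auto intro!: continuous_intros simp: bond_cl_def\<close>)
    then have "continuous_on {0<..K / \<gamma>} (\<lambda>x. V (x, t))"
      by (rule continuous_on_eq) (use Vv in auto)
    then have "quot_lip S.C4 {0<..K / \<gamma>} (\<lambda>x. V (x, t))"
      using S.V_quot_lip_open[of t] False t S.C4_pos by (intro quot_lip_right_end) auto
    then show ?thesis using S.C4_pos by (simp add: max_def)
  qed (rule const)
qed

text \<open>The Lipschitz bound in time makes the values along \<open>t = T / n\<close> a Cauchy sequence,
  whose limit is the extension to \<open>t = 0\<close>. All estimates are closed conditions and
  hold there as well.\<close>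

lemma uniformly_C11x_C01t_extension:
  fixes V :: "real \<times> real \<Rightarrow> real"
  assumes T: "T > 0" and C: "0 \<le> C"
    and bound: "\<And>x t. x \<in> {0<..b} \<Longrightarrow> t \<in> {0<..T} \<Longrightarrow> \<bar>V (x, t)\<bar> \<le> C"
    and time: "\<And>x t s. x \<in> {0<..b} \<Longrightarrow> t \<in> {0<..T} \<Longrightarrow> s \<in> {0<..T} \<Longrightarrow> \<bar>V (x, t) - V (x, s)\<bar> \<le> C * \<bar>t - s\<bar>"
    and space: "\<And>x y t. x \<in> {0<..b} \<Longrightarrow> y \<in> {0<..b} \<Longrightarrow> t \<in> {0<..T} \<Longrightarrow> \<bar>V (x, t) - V (y, t)\<bar> \<le> C * \<bar>x - y\<bar>"
    and quot: "\<And>t. t \<in> {0<..T} \<Longrightarrow> quot_lip C {0<..b} (\<lambda>x. V (x, t))"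
  obtains U where "\<And>x t. x \<in> {0<..b} \<Longrightarrow> t \<in> {0<..T} \<Longrightarrow> U (x, t) = V (x, t)"
    "uniformly_C11x_C01t C ({0<..b} \<times> {0..T}) U"
proof -
  define \<tau> where "\<tau> n = T * (1 / real (Suc n))" for n
  have \<tau>: "\<tau> n \<in> {0<..T}" for n using T by (simp add: \<tau>_def field_simps)
  have \<tau>0: "\<tau> \<longlonglongrightarrow> 0" unfolding \<tau>_def by (rule tendsto_mult_right_zero[OF LIMSEQ_Suc[OF lim_1_over_n]])
  have "\<exists>l. (\<lambda>n. V (x, \<tau> n)) \<longlonglongrightarrow> l" if x: "x \<in> {0<..b}" for x
  proof -
    have "Cauchy (\<lambda>n. V (x, \<tau> n))"
    proof (rule metric_CauchyI)
      fix e :: real assume e: "e > 0"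
      have "(\<lambda>n. C * \<bar>\<tau> n\<bar>) \<longlonglongrightarrow> C * \<bar>0\<bar>" by (intro tendsto_intros \<tau>0)
      then have "\<forall>\<^sub>F n in sequentially. C * \<bar>\<tau> n\<bar> < e / 2" using e by (intro order_tendstoD(2)) auto
      then obtain N where N: "\<And>n. n \<ge> N \<Longrightarrow> C * \<bar>\<tau> n\<bar> < e / 2" by (auto simp: eventually_sequentially)
      have "dist (V (x, \<tau> k)) (V (x, \<tau> n)) < e" if kn: "k \<ge> N" "n \<ge> N" for k n
      proof -
        have "\<bar>V (x, \<tau> k) - V (x, \<tau> n)\<bar> \<le> C * \<bar>\<tau> k - \<tau> n\<bar>" by (rule time[OF x \<tau> \<tau>])
        also have "\<dots> \<le> C * (\<bar>\<tau> k\<bar> + \<bar>\<tau> n\<bar>)" using C by (intro mult_left_mono) auto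
        finally show ?thesis using N[OF kn(1)] N[OF kn(2)] by (simp add: dist_real_def distrib_left)
      qed
      then show "\<exists>N. \<forall>k\<ge>N. \<forall>n\<ge>N. dist (V (x, \<tau> k)) (V (x, \<tau> n)) < e" by blast
    qed
    then show ?thesis using Cauchy_convergent convergent_def by blast
  qed
  then obtain g where g: "\<And>x. x \<in> {0<..b} \<Longrightarrow> (\<lambda>n. V (x, \<tau> n)) \<longlonglongrightarrow> g x" by metis
  define U where "U z = (if 0 < snd z then V z else g (fst z))" for z
  have Ub: "\<bar>U (x, t)\<bar> \<le> C" if "x \<in> {0<..b}" "t \<in> {0..T}" for x t
  proof (cases "t = 0")
    case True
    have "\<bar>g x\<bar> \<le> C"
      by (rule tendsto_upperbound[OF tendsto_rabs[OF g[OF that(1)]]]) (use bound[OF that(1) \<tau>] in auto)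
    then show ?thesis using True by (simp add: U_def)
  qed (use bound that in \<open>auto simp: U_def\<close>)
  have g_time: "\<bar>V (x, t) - g x\<bar> \<le> C * \<bar>t\<bar>" if x: "x \<in> {0<..b}" and t: "t \<in> {0<..T}" for x t
  proof (rule tendsto_le[OF trivial_limit_sequentially])
    show "(\<lambda>n. C * \<bar>t - \<tau> n\<bar>) \<longlonglongrightarrow> C * \<bar>t\<bar>" by (auto intro!: tendsto_eq_intros \<tau>0)
    show "(\<lambda>n. \<bar>V (x, t) - V (x, \<tau> n)\<bar>) \<longlonglongrightarrow> \<bar>V (x, t) - g x\<bar>" by (intro tendsto_intros g x)
    show "\<forall>\<^sub>F n in sequentially. \<bar>V (x, t) - V (x, \<tau> n)\<bar> \<le> C * \<bar>t - \<tau> n\<bar>"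
      using time[OF x t \<tau>] by simp
  qed
  have Ut: "\<bar>U (x, t) - U (x, s)\<bar> \<le> C * \<bar>t - s\<bar>" if "x \<in> {0<..b}" "t \<in> {0..T}" "s \<in> {0..T}" for x t s
    using time[of x t s] g_time[of x t] g_time[of x s] that
    by (cases "t = 0"; cases "s = 0") (auto simp: U_def abs_minus_commute)
  have Ux: "\<bar>U (x, t) - U (y, t)\<bar> \<le> C * \<bar>x - y\<bar>" if x: "x \<in> {0<..b}" and y: "y \<in> {0<..b}" and t: "t \<in> {0..T}" for x y t
  proof (cases "t = 0")
    case True
    have "\<bar>g x - g y\<bar> \<le> C * \<bar>x - y\<bar>"
      by (rule tendsto_upperbound[OF tendsto_rabs[OF tendsto_diff[OF g[OF x] g[OF y]]]]) (use space[OF x y \<tau>] in auto)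
    then show ?thesis using True by (simp add: U_def)
  qed (use space[OF x y] t in \<open>auto simp: U_def\<close>)
  have Uq: "quot_lip C {0<..b} (\<lambda>x. U (x, t))" if t: "t \<in> {0..T}" for t
  proof (cases "t = 0")
    case True
    have "quot_lip C {0<..b} g"
      by (rule quot_lip_limit[where F = sequentially and f = "\<lambda>n x. V (x, \<tau> n)" and c = "\<lambda>_. C"])
        (use g quot[OF \<tau>] in auto)
    then show ?thesis using True by (simp add: U_def)
  qed (use quot t in \<open>auto simp: U_def\<close>)
  have "\<exists>d. (\<forall>x\<in>{0<..b}. ((\<lambda>x. U (x, t)) has_real_derivative d x) (at x within {0<..b}) \<and> \<bar>d x\<bar> \<le> C) \<and>
      (\<forall>x\<in>{0<..b}. \<forall>y\<in>{0<..b}. \<bar>d x - d y\<bar> \<le> C * \<bar>x - y\<bar>)" if t: "t \<in> {0..T}" for t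
  proof -
    obtain d where d: "\<And>x. x \<in> {0<..b} \<Longrightarrow> ((\<lambda>x. U (x, t)) has_real_derivative d x) (at x within {0<..b})"
      "\<And>x y. x \<in> {0<..b} \<Longrightarrow> y \<in> {0<..b} \<Longrightarrow> \<bar>d x - d y\<bar> \<le> C * \<bar>x - y\<bar>"
      "\<And>x. x \<in> {0<..b} \<Longrightarrow> \<bar>d x\<bar> \<le> C"
      using quot_lip_derivative[OF Uq[OF t] C Ux[OF _ _ t]] by metis
    then show ?thesis by (intro exI[of _ d]) blast
  qed
  then obtain d where d: "\<And>t x. t \<in> {0..T} \<Longrightarrow> x \<in> {0<..b} \<Longrightarrow> ((\<lambda>x. U (x, t)) has_real_derivative d t x) (at x within {0<..b}) \<and> \<bar>d t x\<bar> \<le> C"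
    "\<And>t x y. t \<in> {0..T} \<Longrightarrow> x \<in> {0<..b} \<Longrightarrow> y \<in> {0<..b} \<Longrightarrow> \<bar>d t x - d t y\<bar> \<le> C * \<bar>x - y\<bar>"
    by metis
  have slice: "{y. (y, t) \<in> {0<..b} \<times> {0..T}} = {0<..b}" if "t \<in> {0..T}" for t using that by auto
  show ?thesis
  proof (rule that[of U])
    show "U (x, t) = V (x, t)" if "x \<in> {0<..b}" "t \<in> {0<..T}" for x t using that by (simp add: U_def)
    show "uniformly_C11x_C01t C ({0<..b} \<times> {0..T}) U"
      unfolding uniformly_C11x_C01t_def
    proof (intro exI[of _ "\<lambda>z. d (snd z) (fst z)"] conjI allI impI ballI)
      fix x t assume xt: "(x, t) \<in> {0<..b} \<times> {0..T}"
      then have "t \<in> {0..T}" "x \<in> {0<..b}" by auto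
      from d(1)[OF this] show "((\<lambda>y. U (y, t)) has_real_derivative d (snd (x, t)) (fst (x, t))) (at x within {y. (y, t) \<in> {0<..b} \<times> {0..T}})"
        unfolding slice[OF \<open>t \<in> {0..T}\<close>] by simp
    qed (use Ub Ut d in auto)
  qed
qed

lemma closure_cb_domain:
  assumes "K > 0" "\<gamma> > 0" "T > 0"
  shows "closure (cb_domain K \<gamma> T) - {z. fst z = 0} = {0<..K / \<gamma>} \<times> {0..T}"
proof -
  have "closure (cb_domain K \<gamma> T) = {0..K / \<gamma>} \<times> {0..T}"
    using assms by (simp add: cb_domain_def closure_Times closure_greaterThanLessThan)
  then show ?thesis by (auto simp: less_le)
qed

theorem theorem2p1:
  fixes K \<gamma> T \<sigma> r q c :: real
  assumes "K > 0" "\<gamma> > 0" "T > 0" "\<sigma> > 0" "r > 0" "q > 0" "c \<ge> 0"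
    and "c < r * K" "c < q * K"
  shows "\<exists>C. \<forall>V Vx Vxx Vt.
           cb_solution K \<gamma> T \<sigma> r q c V Vx Vxx Vt \<longrightarrow>
           vanishing_at_zero T Vx Vxx \<longrightarrow>
           conversion_region K \<gamma> T V \<noteq> {} \<longrightarrow>
           (\<exists>U. (\<forall>z \<in> cb_domain K \<gamma> T \<union> (cb_boundary K \<gamma> T - {z. fst z = 0}). U z = V z) \<and>
                uniformly_C11x_C01t C (closure (cb_domain K \<gamma> T) - {z. fst z = 0}) U)"
proof -
  define C4 where "C4 = max 0 (bond_strip.C4 K \<gamma> T \<sigma> r q c)"
  define C where "C = K + r * K + \<gamma> + C4"
  have rK: "0 < r * K" using assms by simp
  have C: "0 \<le> C" "K \<le> C" "r * K \<le> C" "\<gamma> \<le> C" "C4 \<le> C"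
    using assms rK by (auto simp: C_def C4_def)
  show ?thesis
  proof (intro exI[of _ C] allI impI)
    fix V Vx Vxx Vt
    assume sol: "cb_solution K \<gamma> T \<sigma> r q c V Vx Vxx Vt"
    interpret convertible_bond K \<gamma> T \<sigma> r q c V Vx Vxx Vt
      by unfold_locales (use assms sol in auto)
    note est = value_estimates
    have quot: "quot_lip C {0<..K / \<gamma>} (\<lambda>x. V (x, t))" if "t \<in> {0<..T}" for t
    proof -
      have "quot_lip C4 {0<..K / \<gamma>} (\<lambda>x. V (x, t))"
        unfolding C4_def by (rule est(4)[of "K / \<gamma>"]) (use assms that in auto)
      then show ?thesis
        unfolding quot_lip_def using C(5) by (meson abs_ge_zero add_nonneg_nonneg mult_right_mono order_trans)
    qed
    obtain U where U: "\<And>x t. x \<in> {0<..K / \<gamma>} \<Longrightarrow> t \<in> {0<..T} \<Longrightarrow> U (x, t) = V (x, t)"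
      "uniformly_C11x_C01t C ({0<..K / \<gamma>} \<times> {0..T}) U"
    proof (rule uniformly_C11x_C01t_extension[of T C "K / \<gamma>" V])
      show "\<bar>V (x, t)\<bar> \<le> C" if "x \<in> {0<..K / \<gamma>}" "t \<in> {0<..T}" for x t
        using est(1)[of x t] that C(2) by simp
      show "\<bar>V (x, t) - V (x, s)\<bar> \<le> C * \<bar>t - s\<bar>" if "x \<in> {0<..K / \<gamma>}" "t \<in> {0<..T}" "s \<in> {0<..T}" for x t s
        using est(2)[of x t s] that mult_right_mono[OF C(3), of "\<bar>t - s\<bar>"] by simp
      show "\<bar>V (x, t) - V (y, t)\<bar> \<le> C * \<bar>x - y\<bar>" if "x \<in> {0<..K / \<gamma>}" "y \<in> {0<..K / \<gamma>}" "t \<in> {0<..T}" for x y t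
        using est(3)[of x t y] that mult_right_mono[OF C(4), of "\<bar>x - y\<bar>"] by simp
    qed (use assms C(1) quot in auto)
    have corner: "U (K / \<gamma>, 0) = V (K / \<gamma>, 0)"
    proof -
      have VK: "V (K / \<gamma>, t) = K" if "t \<in> {0..T}" for t
        using sol that by (auto simp: cb_solution_def Let_def cb_boundary_def)
      have "\<bar>U (K / \<gamma>, 0) - K\<bar> \<le> C * t" if t: "0 < t" "t \<le> T" for t
      proof -
        have "(K / \<gamma>, 0) \<in> {0<..K / \<gamma>} \<times> {0..T}" "(K / \<gamma>, t) \<in> {0<..K / \<gamma>} \<times> {0..T}"
          using assms t by auto
        then have "\<bar>U (K / \<gamma>, 0) - U (K / \<gamma>, t)\<bar> \<le> C * \<bar>0 - t\<bar>"
          using U(2) unfolding uniformly_C11x_C01t_def by blast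
        then show ?thesis using U(1)[of "K / \<gamma>" t] VK[of t] assms t by simp
      qed
      note small = this
      have "\<bar>U (K / \<gamma>, 0) - K\<bar> \<le> 0"
      proof (rule tendsto_lowerbound[where F = "at_right 0" and f = "\<lambda>t. C * t"])
        show "((\<lambda>t. C * t) \<longlongrightarrow> 0) (at_right 0)" by (auto intro!: tendsto_eq_intros)
        show "\<forall>\<^sub>F t in at_right 0. \<bar>U (K / \<gamma>, 0) - K\<bar> \<le> C * t"
          unfolding eventually_at_right[OF \<open>T > 0\<close>] using small assms by (intro exI[of _ T]) auto
      qed simp
      then show ?thesis using VK[of 0] assms by simp
    qed
    have agree: "U z = V z" if z: "z \<in> cb_domain K \<gamma> T \<union> (cb_boundary K \<gamma> T - {z. fst z = 0})" for z
    proof (cases "snd z = 0")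
      case True
      then have "z = (K / \<gamma>, 0)" using z assms by (auto simp: cb_domain_def cb_boundary_def)
      then show ?thesis using corner by simp
    next
      case False
      then have "fst z \<in> {0<..K / \<gamma>}" "snd z \<in> {0<..T}"
        using z assms by (auto simp: cb_domain_def cb_boundary_def less_le)
      from U(1)[OF this] show ?thesis by simp
    qed
    show "\<exists>U. (\<forall>z \<in> cb_domain K \<gamma> T \<union> (cb_boundary K \<gamma> T - {z. fst z = 0}). U z = V z) \<and>
        uniformly_C11x_C01t C (closure (cb_domain K \<gamma> T) - {z. fst z = 0}) U"
      using agree U(2) assms by (intro exI[of _ U]) (simp add: closure_cb_domain)
  qed
qed

end
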